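(* Let $p\in\mathbb{N}$. For arbitrary real vectors $\mathbf{a},\mathbf{b}\in\mathbb{R}^p$ with $\mathbf{a}$ normal (i.e. $a_i-b_k\notin\mathbb{N}_0$ for all $i,k$) there exists $N\in\mathbb{N}_0$ such that $$\frac{(-1)^{\eta}}{\Gamma(\mathbf{a})}\,G^{p,1}_{p+1,p+1}\!\left(t\,\Big|\begin{array}{l}n,\mathbf{b}+n-1\\ \mathbf{a}+n-1,0\end{array}\right)>0$$ for all $n\ge N$ and $t\in(0,1]$, where $\eta\in\{0,1\}$ is the number defined in the context.
   Context: $\mathbb{N}_0=\mathbb{N}\cup\{0\}$. For a vector $\mathbf{a}=(a_1,\dots,a_p)$: $\Gamma(\mathbf{a})=\prod_i\Gamma(a_i)$, $(\mathbf{a})_j=\prod_i(a_i)_j$, $\mathbf{a}+\mu=(a_1+\mu,\dots,a_p+\mu)$; conditions such as $-\mathbf{a}\notin\mathbb{N}_0$ are element-wise. For $0<t<1$ and $-\mathbf{a}\notin\mathbb{N}_0$, $$\widehat{G}_n(t)=G^{p,1}_{p+1,p+1}\!\left(t\,\Big|\begin{array}{l}n,\mathbf{b}+n-1\\ \mathbf{a}+n-1,0\end{array}\right)=\frac{1}{2\pi i}\int_{\mathcal{L}}\frac{\Gamma(\mathbf{a}+n-1+s)\,\Gamma(1-n-s)}{\Gamma(\mathbf{b}+n-1+s)\,\Gamma(1-s)}\,t^{-s}\,ds,$$ where $\mathcal{L}$ is a left loop (starting and ending at $-\infty$, traversed counterclockwise) that leaves all the points $1-a_j-n-l$, $l\in\mathbb{N}_0$,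 on its left and all the points $1-n+k$, $k\in\mathbb{N}_0$, on its right. If some components of $\mathbf{a}$ are non-positive integers, $\widehat{G}_n(t)/\Gamma(\mathbf{a})$ denotes its extension by continuity in $\mathbf{a}$, namely $\frac{t^{n-1}}{(n-1)!}\sum_{j=0}^{n-1}\frac{(1-n)_j(\mathbf{a})_j}{\Gamma(\mathbf{b}+j)\,j!}t^{-j}$ (and $0$ if $n=0$). The value at $t=1$ is the limit as $t\to1^-$ (which exists for all large $n$). Definition of $\eta\in\{0,1\}$ for real $\mathbf{a},\mathbf{b}$ with $\mathbf{a}$ normal: put $\widehat{a}_1=\min_ia_i$ and take any integer $n$ with $n+\widehat{a}_1>0$ (the value of $\eta$ does not depend on it). If $-\mathbf{a}\notin\mathbb{N}_0$, then $$(-1)^\eta=\mathrm{sgn}\left[\frac{1}{\Gamma(\mathbf{a})(\widehat{a}_1)_n\prod_{i=1}^p\Gamma(b_i-\widehat{a}_1)}\right].$$ If $\mathbf{a}$ contains non-positive integers, and $-m_1,\dots,-m_j$ are all its non-positive integer components, then $(-1)^\eta=\mathrm{sgn}\left[\frac{(-1)^m(\mathbf{a})_m}{\Gamma(\mathbf{b}+m)}\right]$ with $m=\min(m_1,\dots,m_j,n-1)$ (so $m=\min(m_1,\dots,m_j)$ for such $n$). *)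

theory Defs
  imports "HOL-Complex_Analysis.Complex_Analysis"
begin

text \<open>
  A left loop is encoded by its bounded part \<open>g\<close>: the loop itself comes in from \<open>-\<infinity>\<close> along the
  horizontal ray ending at \<open>pathstart g\<close>, follows \<open>g\<close>, and returns to \<open>-\<infinity>\<close> along the horizontal
  ray issuing from \<open>pathfinish g\<close>. Both rays lie to the left of \<open>g\<close> and the incoming one is the
  lower one, so the loop is simple and is traversed counterclockwise.
\<close>

definition left_loop :: "(real \<Rightarrow> complex) \<Rightarrow> bool" where
  "left_loop g \<longleftrightarrow>
     valid_path g \<and> arc g \<and>
     Re (pathstart g) = Re (pathfinish g) \<and> Im (pathstart g) < Im (pathfinish g) \<and>
     (\<forall>x\<in>{0<..<1}. Re (pathstart g) < Re (g x))"

text \<open>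
  Closing \<open>g\<close> by the vertical segment between its end points cuts the region on the left of the
  loop into the part enclosed by the closed curve and a half-strip between the two rays.
\<close>

definition loop_left :: "(real \<Rightarrow> complex) \<Rightarrow> complex set" where
  "loop_left g =
     {z. Re (pathstart g) < Re z \<and> z \<notin> path_image g \<and>
         winding_number (g +++ linepath (pathfinish g) (pathstart g)) z = 1} \<union>
     {z. Re z \<le> Re (pathstart g) \<and> Im (pathstart g) < Im z \<and> Im z < Im (pathfinish g)}"

definition loop_right :: "(real \<Rightarrow> complex) \<Rightarrow> complex set" where
  "loop_right g =
     {z. Re (pathstart g) < Re z \<and> z \<notin> path_image g \<and>
         winding_number (g +++ linepath (pathfinish g) (pathstart g)) z = 0} \<union>
     {z. Re z \<le> Re (pathstart g) \<and> (Im z < Im (pathstart g) \<or> Im (pathfinish g) < Im z)}"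

definition loop_truncation :: "(real \<Rightarrow> complex) \<Rightarrow> real \<Rightarrow> real \<Rightarrow> complex" where
  "loop_truncation g R =
     linepath (pathstart g - of_real R) (pathstart g) +++ g +++
     linepath (pathfinish g) (pathfinish g - of_real R)"

definition has_left_loop_integral ::
    "(complex \<Rightarrow> complex) \<Rightarrow> complex \<Rightarrow> (real \<Rightarrow> complex) \<Rightarrow> bool" where
  "has_left_loop_integral f w g \<longleftrightarrow>
     (\<forall>R>0. f contour_integrable_on loop_truncation g R) \<and>
     ((\<lambda>R. contour_integral (loop_truncation g R) f) \<longlongrightarrow> w) at_top"

definition normal_params :: "real ^ 'p \<Rightarrow> real ^ 'p \<Rightarrow> bool" where
  "normal_params a b \<longleftrightarrow> (\<forall>i k. a $ i - b $ k \<notin> \<nat>)"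

text \<open>Reciprocals of Gamma are written with \<^const>\<open>rGamma\<close>, which vanishes at the poles of Gamma.\<close>

definition Ghat_integrand ::
    "real ^ 'p \<Rightarrow> real ^ 'p \<Rightarrow> nat \<Rightarrow> real \<Rightarrow> complex \<Rightarrow> complex" where
  "Ghat_integrand a b n t s =
     (\<Prod>i\<in>UNIV. Gamma (of_real (a $ i) + of_nat n - 1 + s)) * Gamma (1 - of_nat n - s) *
     (\<Prod>i\<in>UNIV. rGamma (of_real (b $ i) + of_nat n - 1 + s)) * rGamma (1 - s) *
     of_real t powr (- s)"

definition Ghat_loop :: "real ^ 'p \<Rightarrow> nat \<Rightarrow> (real \<Rightarrow> complex) \<Rightarrow> bool" where
  "Ghat_loop a n g \<longleftrightarrow>
     left_loop g \<and>
     (\<forall>j. \<forall>l::nat. 1 - of_real (a $ j) - of_nat n - of_nat l \<in> loop_left g) \<and>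
     (\<forall>k::nat. 1 - of_nat n + of_nat k \<in> loop_right g)"

text \<open>
  The Meijer function for \<open>0 < t < 1\<close> and \<open>a\<close> without components in \<open>{0, -1, -2, \<dots>}\<close>: the common
  value of the integral over all admissible loops.
\<close>

definition Ghat :: "real ^ 'p \<Rightarrow> real ^ 'p \<Rightarrow> nat \<Rightarrow> real \<Rightarrow> complex" where
  "Ghat a b n t =
     1 / (2 * of_real pi * \<i>) *
     (THE w. \<forall>g. Ghat_loop a n g \<longrightarrow> has_left_loop_integral (Ghat_integrand a b n t) w g)"

text \<open>
  The Meijer function divided by \<open>\<Gamma>(a)\<close> for \<open>0 < t < 1\<close>, extended by continuity in \<open>a\<close> to the
  points where \<open>\<Gamma>(a)\<close> has a pole. For \<open>n = 0\<close> the sum in the second branch is empty.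
\<close>

definition Ghat_over_Gamma_open ::
    "real ^ 'p \<Rightarrow> real ^ 'p \<Rightarrow> nat \<Rightarrow> real \<Rightarrow> complex" where
  "Ghat_over_Gamma_open a b n t =
     (if \<forall>i. - (a $ i) \<notin> \<nat>
      then Ghat a b n t / of_real (\<Prod>i\<in>UNIV. Gamma (a $ i))
      else of_real
        (t ^ (n - 1) / fact (n - 1) *
         (\<Sum>j<n. pochhammer (1 - real n) j * (\<Prod>i\<in>UNIV. pochhammer (a $ i) j) *
                 (\<Prod>i\<in>UNIV. rGamma (b $ i + real j)) / fact j * inverse t ^ j)))"

definition Ghat_over_Gamma ::
    "real ^ 'p \<Rightarrow> real ^ 'p \<Rightarrow> nat \<Rightarrow> real \<Rightarrow> complex" where
  "Ghat_over_Gamma a b n t =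
     (if t = 1 then Lim (at_left 1) (Ghat_over_Gamma_open a b n)
      else Ghat_over_Gamma_open a b n t)"

definition min_comp :: "real ^ 'p \<Rightarrow> real" where
  "min_comp a = Min (range (\<lambda>i. a $ i))"

definition eta_sign :: "real ^ 'p \<Rightarrow> real ^ 'p \<Rightarrow> nat \<Rightarrow> real" where
  "eta_sign a b n =
     (if \<forall>i. - (a $ i) \<notin> \<nat>
      then sgn (1 / ((\<Prod>i\<in>UNIV. Gamma (a $ i)) * pochhammer (min_comp a) n *
                     (\<Prod>i\<in>UNIV. Gamma (b $ i - min_comp a))))
      else (let m = Min (insert (n - 1) {k. \<exists>i. a $ i = - real k})
            in sgn ((- 1) ^ m * (\<Prod>i\<in>UNIV. pochhammer (a $ i) m) *
                    (\<Prod>i\<in>UNIV. rGamma (b $ i + real m)))))"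

text \<open>The auxiliary \<open>n\<close> is arbitrary; the value does not depend on it when \<open>a\<close> is normal.\<close>

definition eta :: "real ^ 'p \<Rightarrow> real ^ 'p \<Rightarrow> nat" where
  "eta a b =
     (THE e. e \<in> {0, 1} \<and> (\<forall>n. real n + min_comp a > 0 \<longrightarrow> (- 1) ^ e = eta_sign a b n))"

end

theory Submission
  imports Defs
begin

text \<open>
Substitute \<open>u = s + n - 1\<close> in the integral. Up to the factor \<open>t ^ (n - 1)\<close> the integrand becomes
\<open>F u * t powr (- u) / pochhammer (- u) n\<close>, where \<open>F u\<close> is the product of the quotients
\<open>Gamma (a$i + u) / Gamma (b$i + u)\<close>. Its poles are the points \<open>- a$i - l\<close>, which belong to the
left of the loop, and the natural numbers below \<open>n\<close>, which belong to the right. Along leftward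
translations \<open>F\<close> grows at most polynomially (lemma \<open>gamma_ratio_growth\<close>), so for large \<open>n\<close> the
integral over every admissible loop converges to the sum of the residues at the left poles
(\<open>left_loop_integral_residues\<close>). Loops exist although the two families of poles may interlace: the graph of
a suitable polynomial separates them (\<open>left_loop_exists\<close>).

Write \<open>\<alpha>\<close> for the least component of \<open>a\<close>. If no component of \<open>a\<close> is a non-positive integer, the residue
at the rightmost left pole \<open>- \<alpha>\<close> decides the sign. It equals a factor
\<open>t powr \<alpha> / pochhammer (\<alpha> + K) (n - K)\<close> times a coefficient of a product of two power series. One of them is
fixed; the other has nonnegative coefficients which, up to the relevant order, increase steeply when \<open>n\<close> is
large, because its logarithmic derivative is large (\<open>dominant_residue\<close>). So the sign is that of the constant
coefficient \<open>lead\<close> of the fixed series, for all large \<open>n\<close> and all \<open>t\<close> at once. The remaining left poles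
lie to the left of a line \<open>Re u = - \<alpha> - \<epsilon>\<close>. Their residues are bounded through an integral over rectangles
with right side on that line (\<open>multiplier_residue_sum_bound\<close>), where the factor that depends on \<open>n\<close> and \<open>t\<close>
is at most \<open>t powr (\<alpha> + \<epsilon>) / pochhammer (\<alpha> + K + \<epsilon>) (n - K)\<close>. This is smaller than the main term by the factor
\<open>pochhammer (\<alpha> + K) (n - K) / pochhammer (\<alpha> + K + \<epsilon>) (n - K)\<close>, which tends to 0; because \<open>t \<le> 1\<close>, it is
so uniformly in \<open>t\<close> (\<open>W_positive\<close>). The sums of residues also make sense at \<open>t = 1\<close>, satisfy the same estimates
there and depend continuously on \<open>t\<close> up to that point, which settles the limit value.

If some components of \<open>a\<close> are non-positive integers, the function is a finite sum over \<open>j\<close>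
whose last nonvanishing term, with \<open>j = m\<close>, dominates all the others as \<open>n\<close> grows
(\<open>degenerate_sum_sign\<close>), and its sign is the one that defines \<open>eta\<close>.
\<close>

section \<open>Discrete sets of real poles, residues and closed truncations of left loops\<close>

definition real_discrete :: "complex set \<Rightarrow> bool" where
  "real_discrete P \<longleftrightarrow> (\<forall>p\<in>P. Im p = 0) \<and> (\<forall>r. finite (P \<inter> cball 0 r))"

lemma real_discrete_closed:
  assumes "real_discrete P"
  shows "closed P"
  unfolding closed_limpt
proof (intro allI impI)
  fix x assume "x islimpt P"
  then have "infinite (P \<inter> ball x 1)"
    by (simp add: islimpt_eq_infinite_ball)
  moreover have "P \<inter> ball x 1 \<subseteq> P \<inter> cball 0 (norm x + 1)"
    by (auto simp: dist_norm) (smt (verit) norm_minus_commute norm_triangle_sub)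
  ultimately show "x \<in> P"
    using assms finite_subset unfolding real_discrete_def by blast
qed

lemma real_discrete_subset: "real_discrete P \<Longrightarrow> Q \<subseteq> P \<Longrightarrow> real_discrete Q"
  unfolding real_discrete_def by (meson Int_mono finite_subset order_refl subset_iff)

text \<open>
Reflection in the real axis reverses a circle about a real point, so for a function that commutes
with conjugation the integral over the circle is the negative of its own conjugate; dividing by
\<open>2 * pi * \<i>\<close> makes the residue real.
\<close>

lemma residue_in_Reals:
  assumes "open S" "z \<in> S" "Im z = 0" and holo: "f holomorphic_on (S - {z})"
    and sym: "\<And>u. u \<in> S - {z} \<Longrightarrow> f (cnj u) = cnj (f u)"
  shows "residue f z \<in> \<real>"
proof -
  obtain r where r: "r > 0" "cball z r \<subseteq> S"
    using assms open_contains_cball by blast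
  define g where "g = circlepath z r"
  have z: "cnj z = z" using assms(3) by (simp add: complex_eq_iff)
  have I: "(f has_contour_integral 2 * pi * \<i> * residue f z) g"
    unfolding g_def by (rule base_residue) (use assms r in auto)
  have rev: "cnj \<circ> g = reversepath g"
    by (auto simp: g_def circlepath_def part_circlepath_cnj z o_def reversepath_part_circlepath fun_eq_iff)
       (simp add: part_circlepath_def linepath_def reversepath_def algebra_simps exp_diff exp_minus divide_inverse)
  have im: "path_image g \<subseteq> S - {z}"
    using r by (auto simp: g_def)
  have "- (2 * pi * \<i> * residue f z) = contour_integral (cnj \<circ> g) f"
    using contour_integral_unique[OF has_contour_integral_reversepath[OF _ I]] unfolding rev
    by (simp add: g_def)
  also have "\<dots> = cnj (contour_integral g (cnj \<circ> f \<circ> cnj))"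
    by (rule contour_integral_cnj) (simp add: g_def)
  also have "contour_integral g (cnj \<circ> f \<circ> cnj) = contour_integral g f"
    by (rule contour_integral_eq) (use im sym in \<open>auto simp: o_def subset_iff\<close>)
  also have "\<dots> = 2 * pi * \<i> * residue f z"
    using I contour_integral_unique by blast
  finally have "residue f z = cnj (residue f z)" by simp
  then show ?thesis by (metis Reals_cnj_iff)
qed

lemma residue_bound_sphere:
  assumes "open S" "cball z r \<subseteq> S" "r > 0" and holo: "f holomorphic_on (S - {z})"
    and B: "\<And>u. u \<in> sphere z r \<Longrightarrow> norm (f u) \<le> B"
  shows "norm (residue f z) \<le> r * B"
proof -
  have I: "(f has_contour_integral 2 * pi * \<i> * residue f z) (circlepath z r)"
    by (rule base_residue[OF assms(1)]) (use assms in auto)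
  have "z + of_real r \<in> sphere z r" using \<open>r > 0\<close> by (simp add: dist_norm)
  then have "0 \<le> B" using B norm_ge_zero order_trans by blast
  then have "norm (2 * pi * \<i> * residue f z) \<le> B * (2 * pi * r)"
    using has_contour_integral_bound_circlepath[OF I] assms(3) B by (auto simp: dist_norm norm_minus_commute)
  then show ?thesis by (simp add: norm_mult field_simps)
qed

text \<open>
The truncated loop is closed by a vertical segment far to the left, so that the residue theorem
applies. The winding numbers of this closed curve are the ones that the regions
\<open>loop_left\<close> and \<open>loop_right\<close> record, cut off at the segment.
\<close>

definition closed_truncation :: "(real \<Rightarrow> complex) \<Rightarrow> real \<Rightarrow> real \<Rightarrow> complex" where
  "closed_truncation g R =
     loop_truncation g R +++ linepath (pathfinish g - of_real R) (pathstart g - of_real R)"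

lemma
  assumes "left_loop g"
  shows valid_path_loop_truncation: "valid_path (loop_truncation g R)"
    and valid_path_closed_truncation: "valid_path (closed_truncation g R)"
    and closed_truncation_closed: "pathfinish (closed_truncation g R) = pathstart (closed_truncation g R)"
    and path_image_loop_truncation: "path_image (loop_truncation g R) =
       closed_segment (pathstart g - of_real R) (pathstart g) \<union> path_image g \<union>
       closed_segment (pathfinish g) (pathfinish g - of_real R)"
    and path_image_closed_truncation: "path_image (closed_truncation g R) =
       path_image (loop_truncation g R) \<union>
       closed_segment (pathfinish g - of_real R) (pathstart g - of_real R)"
  using assms unfolding left_loop_def loop_truncation_def closed_truncation_def
  by (auto simp: path_image_join valid_path_join)

lemma left_loop_Re:
  assumes "left_loop g" "z \<in> path_image g"
  shows "Re z > Re (pathstart g) \<or> z = pathstart g \<or> z = pathfinish g"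
proof -
  obtain x where x: "z = g x" "x \<in> {0..1}" using assms by (auto simp: path_image_def)
  then show ?thesis using assms(1) unfolding left_loop_def pathstart_def pathfinish_def
    by (cases "x = 0"; cases "x = 1") auto
qed

text \<open>
To the right of the end points of \<open>g\<close> both regions avoid the loop by definition; elsewhere the
loop consists of its two rays only, which bound the strip without belonging to it.
\<close>

lemma loop_left_right_notin_rays:
  assumes "left_loop g" "p \<in> loop_left g \<union> loop_right g" "R > 0"
  shows "p \<notin> path_image (loop_truncation g R)"
  using assms left_loop_Re[OF assms(1), of p]
  unfolding path_image_loop_truncation[OF assms(1)] loop_left_def loop_right_def left_loop_def
  by (auto simp: closed_segment_same_Im closed_segment_eq_real_ivl split: if_splits)

text \<open>
Insert the vertical chord through the two end points of \<open>g\<close> in both directions. The closed curve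
becomes the curve from the definition of the two regions plus a rectangle. A point to the right
of the chord sees only the first, a point to the left of it only the second.
\<close>

lemma winding_closed_truncation_aux:
  assumes g: "left_loop g" and R: "R > 0" and p: "p \<in> loop_left g \<union> loop_right g"
    and ne: "Re p \<noteq> Re (pathstart g)" "Re p \<noteq> Re (pathstart g) - R"
  shows "winding_number (closed_truncation g R) p =
     (if p \<in> loop_left g \<and> Re p > Re (pathstart g) - R then 1 else 0)"
proof -
  define s e where "s = pathstart g" and "e = pathfinish g"
  have se: "Re s = Re e" "Im s < Im e" and vg: "valid_path g"
    using g by (auto simp: left_loop_def s_def e_def)
  have im: "p \<notin> closed_segment (s - R) s" "p \<notin> path_image g" "p \<notin> closed_segment e (e - R)"
    using loop_left_right_notin_rays[OF g p R]
    unfolding path_image_loop_truncation[OF g] s_def e_def by auto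
  have im2: "p \<notin> closed_segment s e" "p \<notin> closed_segment e s" "p \<notin> closed_segment (e - R) (s - R)"
    using ne se by (auto simp: closed_segment_same_Re s_def e_def)
  note im = im im2
  define wg where "wg = winding_number g p"
  define w1 where "w1 = winding_number (linepath (s - R) s) p"
  define w2 where "w2 = winding_number (linepath s e) p"
  define w3 where "w3 = winding_number (linepath e (e - R)) p"
  define w4 where "w4 = winding_number (linepath (e - R) (s - R)) p"
  have pg: "path g" "pathstart g = s" "pathfinish g = e"
    using vg by (auto simp: valid_path_imp_path s_def e_def)
  have W: "winding_number (closed_truncation g R) p = w1 + wg + w3 + w4"
    unfolding closed_truncation_def loop_truncation_def s_def[symmetric] e_def[symmetric]
      w1_def w3_def w4_def wg_def using im pg
    by (simp add: winding_number_join path_image_join)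
  have "Complex (Re e) (Im (s - of_real R)) = s" "Complex (Re (s - of_real R)) (Im e) = e - of_real R"
    using se by (auto simp: complex_eq_iff)
  then have rp: "rectpath (s - R) e = linepath (s - R) s +++ linepath s e +++ linepath e (e - R) +++ linepath (e - R) (s - R)"
    unfolding rectpath_def Let_def by simp
  have Rt: "winding_number (rectpath (s - R) e) p = w1 + w2 + w3 + w4"
    unfolding rp w1_def w2_def w3_def w4_def using im
    by (simp add: winding_number_join path_image_join)
  have "winding_number (linepath e s) p = - w2"
    unfolding w2_def using winding_number_reversepath[of "linepath s e" p] im by simp
  then have C: "winding_number (g +++ linepath e s) p = wg - w2"
    unfolding wg_def using im pg by (simp add: winding_number_join)
  have sum: "winding_number (closed_truncation g R) p =
     winding_number (rectpath (s - R) e) p + winding_number (g +++ linepath e s) p"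
    using W Rt C by simp
  show ?thesis
  proof (cases "Re p > Re s")
    case True
    then have "winding_number (rectpath (s - R) e) p = 0"
      by (intro winding_number_rectpath_outside) (use se R in \<open>auto simp: in_cbox_complex_iff\<close>)
    moreover have "p \<in> loop_left g \<Longrightarrow> winding_number (g +++ linepath e s) p = 1"
      using True unfolding loop_left_def s_def e_def by auto
    moreover have "p \<in> loop_right g \<Longrightarrow> winding_number (g +++ linepath e s) p = 0"
      using True unfolding loop_right_def s_def e_def by auto
    moreover have "Re p > Re (pathstart g) - R" using True R by (simp add: s_def)
    ultimately show ?thesis using p sum
      by (metis Un_iff add_0)
  next
    case False
    then have lt: "Re p < Re s" using ne by (simp add: s_def)
    have "winding_number (g +++ linepath e s) p = 0"
    proof (rule winding_number_zero_outside)
      show "convex {z. Re z \<ge> Re s}" by (rule convex_halfspace_Re_ge)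
      show "path_image (g +++ linepath e s) \<subseteq> {z. Re s \<le> Re z}"
      proof
        fix z assume "z \<in> path_image (g +++ linepath e s)"
        then have "z \<in> path_image g \<or> z \<in> closed_segment e s"
          using pg by (simp add: path_image_join)
        then show "z \<in> {z. Re s \<le> Re z}"
          using left_loop_Re[OF g, of z] se pg by (auto simp: closed_segment_same_Re)
      qed
    qed (use pg lt in auto)
    moreover have "winding_number (rectpath (s - R) e) p = 1" if "p \<in> loop_left g" "Re p > Re s - R"
      by (intro winding_number_rectpath)
         (use that lt se in \<open>auto simp: in_box_complex_iff loop_left_def s_def e_def\<close>)
    moreover have "winding_number (rectpath (s - R) e) p = 0" if "\<not> (p \<in> loop_left g \<and> Re p > Re s - R)"
    proof (intro winding_number_rectpath_outside)
      show "p \<notin> cbox (s - R) e"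
        using that lt se p ne by (auto simp: in_cbox_complex_iff loop_left_def loop_right_def s_def e_def)
    qed (use se R in auto)
    ultimately show ?thesis using sum unfolding s_def by auto
  qed
qed

text \<open>
A point on the line through the chord is moved slightly to the left: it stays in its region and
does not cross the curve, so its winding number does not change.
\<close>

lemma winding_closed_truncation:
  assumes g: "left_loop g" and R: "R > 0" and p: "p \<in> loop_left g \<union> loop_right g"
    and ne: "Re p \<noteq> Re (pathstart g) - R"
  shows "p \<notin> path_image (closed_truncation g R)"
    and "winding_number (closed_truncation g R) p =
     (if p \<in> loop_left g \<and> Re p > Re (pathstart g) - R then 1 else 0)"
proof -
  have se: "Re (pathstart g) = Re (pathfinish g)" using g by (auto simp: left_loop_def)
  show 1: "p \<notin> path_image (closed_truncation g R)"
    using loop_left_right_notin_rays[OF g p R] ne se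
    by (auto simp: path_image_closed_truncation[OF g] closed_segment_same_Re)
  show "winding_number (closed_truncation g R) p =
     (if p \<in> loop_left g \<and> Re p > Re (pathstart g) - R then 1 else 0)"
  proof (cases "Re p = Re (pathstart g)")
    case True
    have pa: "path (closed_truncation g R)"
      by (simp add: g valid_path_closed_truncation valid_path_imp_path)
    obtain d where d: "d > 0" "ball p d \<inter> path_image (closed_truncation g R) = {}"
      using 1 pa by (metis Compl_iff closed_path_image disjoint_eq_subset_Compl open_Compl open_contains_ball)
    define q where "q = p - of_real (min (d/2) (R/2))"
    have q: "Re q < Re p" "Re q > Re p - R" "Im q = Im p"
      using d R by (auto simp: q_def)
    have qb: "q \<in> ball p d" using d R by (auto simp: q_def dist_norm)
    have "winding_number (closed_truncation g R) p = winding_number (closed_truncation g R) q"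
      by (rule winding_number_eq[OF pa closed_truncation_closed[OF g], of _ "ball p d"]) (use d qb in auto)
    also have "\<dots> = (if q \<in> loop_left g \<and> Re q > Re (pathstart g) - R then 1 else 0)"
      by (rule winding_closed_truncation_aux[OF g R]) (use p q True in \<open>auto simp: loop_left_def loop_right_def\<close>)
    also have "q \<in> loop_left g \<longleftrightarrow> p \<in> loop_left g"
      using q True unfolding loop_left_def by auto
    finally show ?thesis using q True R by auto
  qed (use winding_closed_truncation_aux[OF g R p _ ne] in auto)
qed

section \<open>Left loop integrals as sums of residues\<close>

text \<open>
The decay that makes integrals along leftward rays converge. It is only demanded along the
orbits \<open>u - k\<close> of points all of whose translates avoid the poles, uniformly on compact sets of
such points; a bound in terms of \<open>Re u\<close> alone would fail, since poles accumulate at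
\<open>-\<infinity>\<close>. The exponent 2 is the least integer for which the bounds are summable in \<open>k\<close>.
\<close>

definition decays_left :: "complex set \<Rightarrow> (complex \<Rightarrow> complex) \<Rightarrow> bool" where
  "decays_left P f \<longleftrightarrow>
     (\<forall>C. compact C \<and> (\<forall>u\<in>C. \<forall>k::nat. u - of_nat k \<notin> P) \<longrightarrow>
        (\<exists>B\<ge>0. \<forall>u\<in>C. \<forall>k. norm (f (u - of_nat k)) \<le> B / (real k + 1) ^ 2))"

lemma decays_leftE:
  assumes "decays_left P f" "compact C" "\<And>u k. u \<in> C \<Longrightarrow> u - of_nat k \<notin> P"
  obtains B where "B \<ge> 0" "\<And>u k. u \<in> C \<Longrightarrow> norm (f (u - of_nat k)) \<le> B / (real k + 1) ^ 2"
proof -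
  have "\<exists>B\<ge>0. \<forall>u\<in>C. \<forall>k. norm (f (u - of_nat k)) \<le> B / (real k + 1) ^ 2"
    using assms unfolding decays_left_def by simp
  then show ?thesis using that by blast
qed

lemma sum_inverse_squares_le: "(\<Sum>j<k. 1 / (real j + 1) ^ 2) \<le> 2"
proof -
  have "(\<Sum>j<k. 1 / (real j + 1) ^ 2) \<le> 2 - 1 / real k" if "k > 0"
    using that
  proof (induction k)
    case (Suc k)
    show ?case
    proof (cases "k = 0")
      case False
      then have "k > 0" by simp
      then have "1 / (real k + 1) ^ 2 \<le> 1 / real k - 1 / real (Suc k)"
        by (simp add: divide_simps power2_eq_square) (simp add: algebra_simps)
      then show ?thesis using Suc.IH[OF \<open>k > 0\<close>] by simp
    qed simp
  qed simp
  then show ?thesis by (cases "k = 0") (auto intro: order_trans)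
qed

lemma summable_inverse_squares_shift: "summable (\<lambda>j. 1 / (real j + 1) ^ 2)"
  by (rule summableI_nonneg_bounded[where x = 2]) (auto intro: sum_inverse_squares_le)

lemma tendsto_inverse_square_shift: "(\<lambda>k. B / (real k + 1) ^ 2) \<longlonglongrightarrow> 0"
proof -
  have "(\<lambda>k. 1 / (real k + 1) ^ 2) \<longlonglongrightarrow> 0"
    using summable_inverse_squares_shift by (rule summable_LIMSEQ_zero)
  from tendsto_mult_left[OF this, of B] show ?thesis by simp
qed

text \<open>
On the unit piece number \<open>k\<close> of the ray the integrand is at most \<open>B / (k + 1)^2\<close>, so the
integrals over the pieces form an absolutely convergent series with sum at most \<open>2 * B\<close>.
\<close>

locale decaying_ray =
  fixes f :: "complex \<Rightarrow> complex" and z :: complex and B :: real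
  assumes cont: "continuous_on ((\<lambda>x. z - of_real x) ` {0..}) f"
    and B: "B \<ge> 0"
    and bound: "\<And>x k. x \<in> {0..1} \<Longrightarrow> norm (f (z - of_real x - of_nat k)) \<le> B / (real k + 1) ^ 2"
begin

lemma segment_in_ray:
  assumes "0 \<le> a" "a \<le> b"
  shows "closed_segment (z - of_real b) (z - of_real a) = (\<lambda>x. z - of_real x) ` {a..b}"
proof -
  have "y \<in> closed_segment (z - of_real b) (z - of_real a) \<longleftrightarrow> y \<in> (\<lambda>x. z - of_real x) ` {a..b}" for y
  proof
    assume "y \<in> closed_segment (z - of_real b) (z - of_real a)"
    then have "Im y = Im z" "Re y \<in> {Re z - b .. Re z - a}"
      using assms by (auto simp: closed_segment_same_Im closed_segment_eq_real_ivl)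
    then have "y = z - of_real (Re z - Re y)" "Re z - Re y \<in> {a..b}"
      by (auto simp: complex_eq_iff)
    then show "y \<in> (\<lambda>x. z - of_real x) ` {a..b}" by blast
  qed (use assms in \<open>auto simp: closed_segment_same_Im closed_segment_eq_real_ivl\<close>)
  then show ?thesis by blast
qed

lemma integrable:
  assumes "0 \<le> a" "a \<le> b"
  shows "f contour_integrable_on linepath (z - of_real b) (z - of_real a)"
  by (rule contour_integrable_continuous_linepath, rule continuous_on_subset[OF cont])
     (use assms segment_in_ray[OF assms] in auto)

definition ray_integral where "ray_integral R = contour_integral (linepath (z - of_real R) z) f"

lemma ray_integral_split:
  assumes "0 \<le> a" "a \<le> b"
  shows "ray_integral b = contour_integral (linepath (z - of_real b) (z - of_real a)) f + ray_integral a"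
proof -
  have "z - of_real a \<in> closed_segment (z - of_real b) (z - of_real 0)"
    using segment_in_ray[of 0 b] assms by auto
  moreover have "continuous_on (closed_segment (z - of_real b) (z - of_real 0)) f"
    by (rule continuous_on_subset[OF cont]) (use assms segment_in_ray[of 0 b] in auto)
  ultimately show ?thesis unfolding ray_integral_def
    using contour_integral_split_linepath[of "z - of_real b" z f "z - of_real a"] by simp
qed

lemma piece_bound:
  assumes "x \<in> {0..1}"
  shows "norm (contour_integral (linepath (z - of_real (real k + x)) (z - of_real (real k))) f)
           \<le> B / (real k + 1) ^ 2"
proof -
  have "norm (contour_integral (linepath (z - of_real (real k + x)) (z - of_real (real k))) f)
     \<le> B / (real k + 1) ^ 2 * norm ((z - of_real (real k)) - (z - of_real (real k + x)))"
  proof (rule contour_integral_bound_linepath)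
    fix u assume "u \<in> closed_segment (z - of_real (real k + x)) (z - of_real (real k))"
    then obtain y where "u = z - of_real y" "y \<in> {real k .. real k + x}"
      using segment_in_ray[of "real k" "real k + x"] assms by auto
    then show "norm (f u) \<le> B / (real k + 1) ^ 2"
      using bound[of "y - real k" k] assms by simp
  qed (use B integrable[of "real k" "real k + x"] assms in auto)
  also have "norm ((z - of_real (real k)) - (z - of_real (real k + x))) = x"
    using assms by simp
  also have "B / (real k + 1) ^ 2 * x \<le> B / (real k + 1) ^ 2 * 1"
    by (rule mult_left_mono) (use assms B in auto)
  finally show ?thesis by simp
qed

definition unit_piece where "unit_piece k = contour_integral (linepath (z - of_real (real k + 1)) (z - of_real (real k))) f"

lemma ray_integral_sum: "ray_integral (real k) = (\<Sum>j<k. unit_piece j)"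
proof (induction k)
  case (Suc k)
  then show ?case using ray_integral_split[of "real k" "real k + 1"] by (simp add: unit_piece_def add.commute)
qed (simp add: ray_integral_def)

lemma unit_piece_bound: "norm (unit_piece k) \<le> B / (real k + 1) ^ 2"
  unfolding unit_piece_def using piece_bound[of 1 k] by simp

lemma ray_integral_bound: "norm (ray_integral (real k)) \<le> 2 * B"
proof -
  have "norm (ray_integral (real k)) \<le> (\<Sum>j<k. B * (1 / (real j + 1) ^ 2))"
    unfolding ray_integral_sum by (rule sum_norm_le) (use unit_piece_bound in auto)
  also have "\<dots> \<le> B * 2"
    unfolding sum_distrib_left[symmetric]
    by (rule mult_left_mono) (use B sum_inverse_squares_le in auto)
  finally show ?thesis by simp
qed

lemma ray_integral_convergent: "\<exists>l. (ray_integral \<longlongrightarrow> l) at_top"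
proof -
  have "summable (\<lambda>k. B * (1 / (real k + 1) ^ 2))"
    by (rule summable_mult[OF summable_inverse_squares_shift])
  then have "summable unit_piece"
    by (rule summable_comparison_test'[where g = "\<lambda>k. B * (1 / (real k + 1) ^ 2)" and N = 0])
       (use unit_piece_bound in auto)
  then obtain l where "unit_piece sums l" by (auto simp: summable_def)
  then have lim: "(\<lambda>k. ray_integral (real k)) \<longlonglongrightarrow> l"
    unfolding ray_integral_sum sums_def .
  have fl: "filterlim (\<lambda>R. nat \<lfloor>R\<rfloor>) sequentially (at_top :: real filter)"
    by (rule filterlim_compose[OF filterlim_nat_sequentially filterlim_floor_sequentially])
  have "((\<lambda>R. ray_integral (real (nat \<lfloor>R\<rfloor>)) + (ray_integral R - ray_integral (real (nat \<lfloor>R\<rfloor>)))) \<longlongrightarrow> l + 0) at_top"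
  proof (intro tendsto_add)
    show "((\<lambda>R::real. ray_integral (real (nat \<lfloor>R\<rfloor>))) \<longlongrightarrow> l) at_top"
      using filterlim_compose[OF lim fl] by simp
    show "((\<lambda>R. ray_integral R - ray_integral (real (nat \<lfloor>R\<rfloor>))) \<longlongrightarrow> 0) at_top"
    proof (rule Lim_null_comparison)
      show "((\<lambda>R::real. B / (real (nat \<lfloor>R\<rfloor>) + 1) ^ 2) \<longlongrightarrow> 0) at_top"
        by (rule filterlim_compose[OF tendsto_inverse_square_shift fl])
      show "\<forall>\<^sub>F R in at_top. norm (ray_integral R - ray_integral (real (nat \<lfloor>R\<rfloor>))) \<le> B / (real (nat \<lfloor>R\<rfloor>) + 1) ^ 2"
        using eventually_ge_at_top[of 0]
      proof eventually_elim
        case (elim R)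
        define k where "k = nat \<lfloor>R\<rfloor>"
        define x where "x = R - real k"
        have x: "x \<in> {0..1}" unfolding x_def k_def using elim by (auto; linarith)
        have "R = real k + x" by (simp add: x_def)
        then have "ray_integral R - ray_integral (real k) = contour_integral (linepath (z - of_real (real k + x)) (z - of_real (real k))) f"
          using ray_integral_split[of "real k" R] x by simp
        then show ?case using piece_bound[OF x, of k] unfolding k_def by simp
      qed
    qed
  qed
  then show ?thesis by auto
qed

end

lemma decaying_rayI:
  assumes dec: "decays_left P f" and P: "real_discrete P" and holo: "f holomorphic_on -P" and "Im z \<noteq> 0"
  shows "\<exists>B. decaying_ray f z B"
proof -
  have notin: "u \<notin> P" if "Im u = Im z" for u
    using P that assms(4) unfolding real_discrete_def by auto
  obtain B where B: "B \<ge> 0" "\<And>u k. u \<in> (\<lambda>x. z - of_real x) ` {0..1} \<Longrightarrow> norm (f (u - of_nat k)) \<le> B / (real k + 1) ^ 2"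
  proof (rule decays_leftE[OF dec])
    show "compact ((\<lambda>x. z - complex_of_real x) ` {0..1})"
      by (intro compact_continuous_image continuous_intros) auto
    show "u - of_nat k \<notin> P" if "u \<in> (\<lambda>x. z - complex_of_real x) ` {0..1}" for u k
      using that by (intro notin) auto
  qed blast
  have "continuous_on ((\<lambda>x. z - of_real x) ` {0..}) f"
    by (rule continuous_on_subset[OF holomorphic_on_imp_continuous_on[OF holo]]) (use notin in auto)
  then show ?thesis using B by (intro exI[of _ B]) (auto simp: decaying_ray_def)
qed

lemma vertical_integral_bound:
  assumes b: "\<And>y. y \<in> closed_segment (Im u) (Im v) \<Longrightarrow> norm (f (Complex c y)) \<le> B" and "B \<ge> 0"
    and "f contour_integrable_on linepath u v" and "Re u = c" "Re v = c"
  shows "norm (contour_integral (linepath u v) f) \<le> B * \<bar>Im v - Im u\<bar>"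
proof -
  have "norm (contour_integral (linepath u v) f) \<le> B * norm (v - u)"
  proof (rule contour_integral_bound_linepath)
    fix x assume "x \<in> closed_segment u v"
    then have "x = Complex c (Im x)" "Im x \<in> closed_segment (Im u) (Im v)"
      using assms by (auto simp: closed_segment_same_Re complex_eq_iff)
    then show "norm (f x) \<le> B" using b by metis
  qed (use assms in auto)
  also have "norm (v - u) = \<bar>Im v - Im u\<bar>"
    using assms by (simp add: cmod_eq_Im)
  finally show ?thesis .
qed

text \<open>
A closed curve lies in some disc, which contains only finitely many of the poles; the poles with
winding number 1 are among them.
\<close>

lemma residue_theorem_real_poles:
  assumes P: "real_discrete P" and holo: "f holomorphic_on -P"
    and g: "valid_path g" "pathfinish g = pathstart g" "path_image g \<inter> P = {}"
    and w: "\<And>p. p \<in> P \<Longrightarrow> winding_number g p = (if p \<in> Q then 1 else 0)" and "Q \<subseteq> P"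
  shows "finite Q" "contour_integral g f = 2 * pi * \<i> * (\<Sum>p\<in>Q. residue f p)"
proof -
  obtain r where r: "path_image g \<subseteq> ball 0 r"
    using bounded_subset_ballD[OF bounded_path_image[OF valid_path_imp_path[OF g(1)]]] by blast
  have out: "winding_number g x = 0" if "x \<notin> ball 0 r" for x
    by (rule winding_number_zero_outside[of _ "ball 0 r"]) (use that r g valid_path_imp_path in auto)
  define pts where "pts = P \<inter> ball 0 r"
  have "pts \<subseteq> P \<inter> cball 0 r" by (auto simp: pts_def)
  then have fin: "finite pts" using P finite_subset unfolding real_discrete_def by blast
  have Q: "Q \<subseteq> pts" using out w \<open>Q \<subseteq> P\<close> unfolding pts_def by force
  then show "finite Q" using fin finite_subset by blast
  have "contour_integral g f = 2 * pi * \<i> * (\<Sum>p\<in>pts. winding_number g p * residue f p)"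
  proof (rule Residue_theorem)
    show "f holomorphic_on ball 0 r - pts"
      by (rule holomorphic_on_subset[OF holo]) (auto simp: pts_def)
    show "path_image g \<subseteq> ball 0 r - pts" using r g by (auto simp: pts_def)
  qed (use fin out g in auto)
  also have "(\<Sum>p\<in>pts. winding_number g p * residue f p) = (\<Sum>p\<in>Q. residue f p)"
    by (rule sum.mono_neutral_cong_right) (use fin Q w in \<open>auto simp: pts_def\<close>)
  finally show "contour_integral g f = 2 * pi * \<i> * (\<Sum>p\<in>Q. residue f p)" .
qed

lemma loop_left_right_disjoint: "loop_left g \<inter> loop_right g = {}"
  unfolding loop_left_def loop_right_def by auto

text \<open>
Close the loop at the abscissae \<open>c - k\<close>, which avoid all poles. The vertical segments are
translates of one fixed segment, so their contribution tends to 0 by the decay of \<open>f\<close>, while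
the truncated integrals converge because the rays do. Hence the sums of residues converge, and
their limit depends on the poles on the left alone, not on the loop.
\<close>

theorem left_loop_integral_residues:
  assumes g: "left_loop g" and L: "L \<subseteq> loop_left g" and Q: "Q \<subseteq> loop_right g"
    and P: "real_discrete P" "P = L \<union> Q"
    and unb: "\<And>x. \<exists>p\<in>L. Re p \<le> x"
    and holo: "f holomorphic_on -P" and dec: "decays_left P f"
    and c: "\<And>p k. p \<in> P \<Longrightarrow> Re p \<noteq> c - real k"
  shows "\<exists>w. has_left_loop_integral f w g \<and>
     (\<lambda>k. 2 * pi * \<i> * (\<Sum>p | p \<in> L \<and> Re p > c - real k. residue f p)) \<longlonglongrightarrow> w"
proof -
  define s e where "s = pathstart g" and "e = pathfinish g"
  have se: "Re s = Re e" "Im s < Im e" "valid_path g"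
    using g by (auto simp: left_loop_def s_def e_def)
  \<comment> \<open>A real pole in \<open>loop_left g\<close> that is not to the right of the end points lies between the two rays,
so the real axis does, too.\<close>
  obtain p0 where "p0 \<in> L" "Re p0 \<le> Re s" using unb by blast
  then have Im: "Im s < 0" "0 < Im e"
    using L P unfolding real_discrete_def s_def e_def loop_left_def by (auto dest!: subsetD)
  obtain Bs Be where Bs: "decaying_ray f s Bs" and Be: "decaying_ray f e Be"
    using decaying_rayI[OF dec P(1) holo] Im by (metis less_irrefl)
  interpret S: decaying_ray f s Bs by fact
  interpret E: decaying_ray f e Be by fact
  have notin: "path_image (loop_truncation g R) \<inter> P = {}" if "R > 0" for R
    using loop_left_right_notin_rays[OF g _ that] P L Q by blast
  have int: "f contour_integrable_on loop_truncation g R" if "R > 0" for R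
    by (rule contour_integrable_holomorphic_simple[OF holo])
       (use real_discrete_closed[OF P(1)] notin[OF that] valid_path_loop_truncation[OF g] in auto)
  have intg: "f contour_integrable_on g"
    by (rule contour_integrable_holomorphic_simple[OF holo])
       (use real_discrete_closed[OF P(1)] notin[of 1] se path_image_loop_truncation[OF g, of 1] in auto)
  have truncation_eq: "contour_integral (loop_truncation g R) f = S.ray_integral R + contour_integral g f - E.ray_integral R" if "R > 0" for R
  proof -
    have "f contour_integrable_on linepath (s - of_real R) s" "f contour_integrable_on linepath (e - of_real R) e"
      using S.integrable[of 0 R] E.integrable[of 0 R] that by auto
    then have i: "f contour_integrable_on linepath (s - of_real R) s"
       "f contour_integrable_on linepath e (e - of_real R)"
       "contour_integral (linepath e (e - of_real R)) f = - E.ray_integral R"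
      using contour_integrable_reversepath[of "linepath (e - of_real R) e" f]
            contour_integral_reversepath[of "linepath (e - of_real R) e" f]
      by (auto simp: E.ray_integral_def)
    then show ?thesis
      unfolding loop_truncation_def s_def[symmetric] e_def[symmetric] S.ray_integral_def
      using intg se by (simp add: s_def e_def)
  qed
  obtain ls le where "(S.ray_integral \<longlongrightarrow> ls) at_top" "(E.ray_integral \<longlongrightarrow> le) at_top"
    using S.ray_integral_convergent E.ray_integral_convergent by blast
  then have "((\<lambda>R. S.ray_integral R + contour_integral g f - E.ray_integral R) \<longlongrightarrow> ls + contour_integral g f - le) at_top"
    by (intro tendsto_intros)
  then have lim: "((\<lambda>R. contour_integral (loop_truncation g R) f) \<longlongrightarrow> ls + contour_integral g f - le) at_top"
    by (rule Lim_transform_eventually)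
       (rule eventually_mono[OF eventually_gt_at_top[of 0]], simp add: truncation_eq)
  define w where "w = ls + contour_integral g f - le"
  have has: "has_left_loop_integral f w g"
    unfolding has_left_loop_integral_def w_def using int lim by auto
  \<comment> \<open>Truncating at this length puts the closing segment at the abscissa \<open>c - k\<close>.\<close>
  define r where "r k = Re s - c + real k" for k
  have "filterlim (\<lambda>k. (Re s - c) + real k) at_top sequentially"
    by (rule filterlim_tendsto_add_at_top[OF tendsto_const filterlim_real_sequentially])
  then have rlim: "filterlim r at_top sequentially" unfolding r_def .
  obtain B where B: "B \<ge> 0" "\<And>u k. u \<in> closed_segment (Complex c (Im e)) (Complex c (Im s)) \<Longrightarrow>
      norm (f (u - of_nat k)) \<le> B / (real k + 1) ^ 2"
  proof (rule decays_leftE[OF dec])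
    show "u - of_nat k \<notin> P" if "u \<in> closed_segment (Complex c (Im e)) (Complex c (Im s))" for u k
      using that c[of "u - of_nat k" k] by (auto simp: closed_segment_same_Re)
  qed auto
  define V where "V k = contour_integral (linepath (e - of_real (r k)) (s - of_real (r k))) f" for k
  have ev: "\<forall>\<^sub>F k in sequentially. r k > 0"
    using rlim by (auto simp: filterlim_at_top_dense)
  have key: "norm (V k) \<le> B / (real k + 1) ^ 2 * \<bar>Im s - Im e\<bar> \<and>
       contour_integral (loop_truncation g (r k)) f + V k =
       2 * pi * \<i> * (\<Sum>p | p \<in> L \<and> Re p > c - real k. residue f p)" if r: "r k > 0" for k
  proof
    have rk: "Re s - r k = c - real k" by (simp add: r_def)
    have ne: "Re p \<noteq> Re (pathstart g) - r k" if "p \<in> P" for p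
      using c[OF that, of k] rk by (simp add: s_def)
    have disj: "path_image (closed_truncation g (r k)) \<inter> P = {}"
      using winding_closed_truncation(1)[OF g r _ ne] P L Q by blast
    have vint: "f contour_integrable_on linepath (e - of_real (r k)) (s - of_real (r k))"
      by (rule contour_integrable_holomorphic_simple[OF holo])
         (use real_discrete_closed[OF P(1)] disj path_image_closed_truncation[OF g] in \<open>auto simp: s_def e_def\<close>)
    have "norm (V k) \<le> B / (real k + 1) ^ 2 * \<bar>Im (s - of_real (r k)) - Im (e - of_real (r k))\<bar>"
      unfolding V_def
    proof (rule vertical_integral_bound[where c = "c - real k"])
      fix y assume "y \<in> closed_segment (Im (e - of_real (r k))) (Im (s - of_real (r k)))"
      then have "Complex c y \<in> closed_segment (Complex c (Im e)) (Complex c (Im s))"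
        by (simp add: closed_segment_same_Re)
      moreover have "Complex c y - of_nat k = Complex (c - real k) y" by (simp add: complex_eq_iff)
      ultimately show "norm (f (Complex (c - real k) y)) \<le> B / (real k + 1) ^ 2"
        using B(2) by metis
    qed (use B vint rk se in auto)
    then show "norm (V k) \<le> B / (real k + 1) ^ 2 * \<bar>Im s - Im e\<bar>" by simp
    have "contour_integral (loop_truncation g (r k)) f + V k = contour_integral (closed_truncation g (r k)) f"
      unfolding closed_truncation_def V_def s_def[symmetric] e_def[symmetric]
      by (subst contour_integral_join) (use int[OF r] vint valid_path_loop_truncation[OF g] in auto)
    also have "\<dots> = 2 * pi * \<i> * (\<Sum>p | p \<in> L \<and> Re p > c - real k. residue f p)"
    proof (rule residue_theorem_real_poles(2)[OF P(1) holo valid_path_closed_truncation[OF g] closed_truncation_closed[OF g] disj])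
      fix p assume p: "p \<in> P"
      have "winding_number (closed_truncation g (r k)) p =
         (if p \<in> loop_left g \<and> Re p > Re (pathstart g) - r k then 1 else 0)"
        by (rule winding_closed_truncation(2)[OF g r _ ne[OF p]]) (use p P L Q in blast)
      moreover have "p \<in> loop_left g \<longleftrightarrow> p \<in> L"
        using p P L Q loop_left_right_disjoint[of g] by blast
      ultimately show "winding_number (closed_truncation g (r k)) p = (if p \<in> {p \<in> L. c - real k < Re p} then 1 else 0)"
        using rk by (simp add: s_def)
    qed (use P in auto)
    finally show "contour_integral (loop_truncation g (r k)) f + V k =
       2 * pi * \<i> * (\<Sum>p | p \<in> L \<and> Re p > c - real k. residue f p)" .
  qed
  have V0: "V \<longlonglongrightarrow> 0"
  proof (rule Lim_null_comparison)
    show "\<forall>\<^sub>F k in sequentially. norm (V k) \<le> B / (real k + 1) ^ 2 * \<bar>Im s - Im e\<bar>"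
      using ev by eventually_elim (use key in blast)
    show "(\<lambda>k. B / (real k + 1) ^ 2 * \<bar>Im s - Im e\<bar>) \<longlonglongrightarrow> 0"
      using tendsto_mult_right[OF tendsto_inverse_square_shift, of B "\<bar>Im s - Im e\<bar>"] by simp
  qed
  have "(\<lambda>k. contour_integral (loop_truncation g (r k)) f + V k) \<longlonglongrightarrow> w + 0"
    by (intro tendsto_add V0 filterlim_compose[OF _ rlim]) (use lim w_def in simp)
  then have "(\<lambda>k. 2 * pi * \<i> * (\<Sum>p | p \<in> L \<and> Re p > c - real k. residue f p)) \<longlonglongrightarrow> w"
    unfolding add_0_right
    by (rule Lim_transform_eventually) (rule eventually_mono[OF ev], use key in blast)
  then show ?thesis using has by blast
qed

section \<open>Bounding sums of residues by a fixed contour\<close>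

text \<open>
The left translates of the frame by integers cover the boundary of every rectangle
\<open>[c - k, c] \<times> [-1, 1\<close>], so a bound for \<open>f\<close> along the translates of this one compact set
bounds all those boundary integrals simultaneously.
\<close>

definition frame :: "real \<Rightarrow> complex set" where
  "frame c = closed_segment (Complex (c - 1) (-1)) (Complex c (-1)) \<union>
     closed_segment (Complex (c - 1) 1) (Complex c 1) \<union>
     closed_segment (Complex c (-1)) (Complex c 1)"

lemma compact_frame: "compact (frame c)"
  unfolding frame_def by (intro compact_Un compact_segment)

lemma mem_frame: "u \<in> frame c \<longleftrightarrow>
   (\<bar>Im u\<bar> = 1 \<and> c - 1 \<le> Re u \<and> Re u \<le> c) \<or> (\<bar>Im u\<bar> \<le> 1 \<and> Re u = c)"
  unfolding frame_def
  by (auto simp: closed_segment_same_Im closed_segment_same_Re closed_segment_eq_real_ivl abs_if split: if_splits)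

lemma frame_shift_notin:
  assumes "real_discrete P" "\<And>p k. p \<in> P \<Longrightarrow> Re p \<noteq> c - real k" "u \<in> frame c"
  shows "u - of_nat k \<notin> P"
proof
  assume "u - of_nat k \<in> P"
  then show False
    using assms(1) assms(2)[of "u - of_nat k" k] assms(3) unfolding real_discrete_def mem_frame by auto
qed

lemma norm_four_terms: "norm (a + b + (- c + d)) \<le> norm a + norm b + (norm c + norm d)"
  for a b c d :: "'a::real_normed_vector"
  using order_trans[OF norm_triangle_ineq add_mono[OF norm_triangle_ineq norm_triangle_ineq], of a b "-c" d] by simp

text \<open>
Each of the four sides contributes at most \<open>2 * B\<close> to the boundary integral: the vertical ones
have length 2, the horizontal ones are sums of unit pieces of size \<open>B / (j + 1)^2\<close>. Division by
\<open>2 * pi\<close> leaves less than \<open>2 * B\<close>, and the bound does not depend on \<open>k\<close>.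
\<close>

lemma rectangle_residue_bound:
  assumes P: "real_discrete P" and holo: "f holomorphic_on -P"
    and c: "\<And>p k. p \<in> P \<Longrightarrow> Re p \<noteq> c - real k" and "B \<ge> 0"
    and bound: "\<And>u k. u \<in> frame c \<Longrightarrow> norm (f (u - of_nat k)) \<le> B / (real k + 1) ^ 2"
  shows "norm (\<Sum>p | p \<in> P \<and> c - real k < Re p \<and> Re p < c. residue f p) \<le> 2 * B"
proof (cases "k = 0")
  case True
  then have "{p. p \<in> P \<and> c - real k < Re p \<and> Re p < c} = {}" by auto
  then show ?thesis using \<open>B \<ge> 0\<close> by (metis mult_nonneg_nonneg norm_zero sum.empty zero_le_numeral)
next
  case False
  define z1 z2 where "z1 = Complex c (-1)" and "z2 = Complex c 1"
  have cont: "continuous_on A f" if "\<And>u. u \<in> A \<Longrightarrow> Im u \<noteq> 0" for A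
    by (rule continuous_on_subset[OF holomorphic_on_imp_continuous_on[OF holo]])
       (use that P in \<open>auto simp: real_discrete_def\<close>)
  interpret A: decaying_ray f z1 B
    by unfold_locales (use \<open>B \<ge> 0\<close> in \<open>auto intro!: cont bound simp: z1_def mem_frame\<close>)
  interpret C: decaying_ray f z2 B
    by unfold_locales (use \<open>B \<ge> 0\<close> in \<open>auto intro!: cont bound simp: z2_def mem_frame\<close>)
  define g where "g = rectpath (z1 - of_nat k) z2"
  have "Complex (Re z2) (Im (z1 - of_nat k)) = z1" "Complex (Re (z1 - of_nat k)) (Im z2) = z2 - of_nat k"
    by (auto simp: z1_def z2_def complex_eq_iff)
  then have g: "g = linepath (z1 - of_nat k) z1 +++ linepath z1 z2 +++
      linepath z2 (z2 - of_nat k) +++ linepath (z2 - of_nat k) (z1 - of_nat k)"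
    unfolding g_def rectpath_def Let_def by simp
  have pi: "path_image g \<inter> P = {}"
  proof -
    have "p \<notin> P" if "p \<in> path_image g" for p
    proof
      assume "p \<in> P"
      then have "Im p = 0" "Re p \<noteq> c" "Re p \<noteq> c - real k"
        using P c[of p 0] c[of p k] by (auto simp: real_discrete_def)
      then show False
        using that unfolding g by (auto simp: path_image_join z1_def z2_def closed_segment_same_Im closed_segment_same_Re)
    qed
    then show ?thesis by blast
  qed
  have int: "f contour_integrable_on linepath u v" if "closed_segment u v \<subseteq> path_image g" for u v
    by (rule contour_integrable_holomorphic_simple[OF holo])
       (use real_discrete_closed[OF P] pi that in auto)
  have sub: "closed_segment (z1 - of_nat k) z1 \<subseteq> path_image g" "closed_segment z1 z2 \<subseteq> path_image g"
     "closed_segment z2 (z2 - of_nat k) \<subseteq> path_image g" "closed_segment (z2 - of_nat k) (z1 - of_nat k) \<subseteq> path_image g"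
    unfolding g by (auto simp: path_image_join)
  note ints = int[OF sub(1)] int[OF sub(2)] int[OF sub(3)] int[OF sub(4)]
  have "contour_integral (linepath z2 (z2 - of_nat k)) f = - C.ray_integral (real k)"
    using contour_integral_reversepath[of "linepath (z2 - of_nat k) z2" f]
    by (simp add: C.ray_integral_def)
  then have "contour_integral g f = A.ray_integral (real k) + contour_integral (linepath z1 z2) f +
      (- C.ray_integral (real k) + contour_integral (linepath (z2 - of_nat k) (z1 - of_nat k)) f)"
    unfolding g A.ray_integral_def using ints by (simp add: contour_integrable_joinI)
  moreover have "norm (contour_integral (linepath z1 z2) f) \<le> B * \<bar>Im z2 - Im z1\<bar>"
  proof (rule vertical_integral_bound[OF _ \<open>B \<ge> 0\<close> ints(2)])
    fix y assume "y \<in> closed_segment (Im z1) (Im z2)"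
    then have "Complex c y \<in> frame c"
      by (auto simp: mem_frame z1_def z2_def closed_segment_eq_real_ivl)
    from bound[OF this, of 0] show "norm (f (Complex c y)) \<le> B" by simp
  qed (auto simp: z1_def z2_def)
  moreover have "norm (contour_integral (linepath (z2 - of_nat k) (z1 - of_nat k)) f)
      \<le> B * \<bar>Im (z1 - of_nat k) - Im (z2 - of_nat k)\<bar>"
  proof (rule vertical_integral_bound[OF _ \<open>B \<ge> 0\<close> ints(4)])
    fix y assume "y \<in> closed_segment (Im (z2 - of_nat k)) (Im (z1 - of_nat k))"
    then have fr: "Complex c y \<in> frame c"
      by (auto simp: mem_frame z1_def z2_def closed_segment_eq_real_ivl split: if_splits)
    have "Complex c y - of_nat k = Complex (c - real k) y" by (simp add: complex_eq_iff)
    then have "norm (f (Complex (c - real k) y)) \<le> B / (real k + 1) ^ 2"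
      using bound[OF fr, of k] by simp
    also have "\<dots> \<le> B / 1" by (rule divide_left_mono) (use \<open>B \<ge> 0\<close> in auto)
    finally show "norm (f (Complex (c - real k) y)) \<le> B" by simp
  qed (auto simp: z1_def z2_def)
  ultimately have "norm (contour_integral g f) \<le> 2 * B + B * 2 + (2 * B + B * 2)"
    using A.ray_integral_bound[of k] C.ray_integral_bound[of k]
      norm_four_terms[of "A.ray_integral (real k)" "contour_integral (linepath z1 z2) f" "C.ray_integral (real k)"
        "contour_integral (linepath (z2 - of_nat k) (z1 - of_nat k)) f"]
    by (simp add: z1_def z2_def)
  also have "contour_integral g f = 2 * pi * \<i> * (\<Sum>p | p \<in> P \<and> c - real k < Re p \<and> Re p < c. residue f p)"
  proof (rule residue_theorem_real_poles(2)[OF P holo])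
    fix p assume p: "p \<in> P"
    then have "Im p = 0" "Re p \<noteq> c" "Re p \<noteq> c - real k"
      using P c[of p 0] c[of p k] by (auto simp: real_discrete_def)
    moreover have "winding_number g p = 1" if "p \<in> box (z1 - of_nat k) z2"
      unfolding g_def by (rule winding_number_rectpath[OF that])
    moreover have "winding_number g p = 0" if "p \<notin> cbox (z1 - of_nat k) z2"
      unfolding g_def by (rule winding_number_rectpath_outside) (use that in \<open>auto simp: z1_def z2_def\<close>)
    ultimately show "winding_number g p = (if p \<in> {p \<in> P. c - real k < Re p \<and> Re p < c} then 1 else 0)"
      using p by (auto simp: in_box_complex_iff in_cbox_complex_iff z1_def z2_def)
  qed (use pi in \<open>auto simp: g_def\<close>)
  finally have "2 * pi * norm (\<Sum>p | p \<in> P \<and> c - real k < Re p \<and> Re p < c. residue f p) \<le> 8 * B"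
    by (simp add: norm_mult)
  moreover have "4 * norm (\<Sum>p | p \<in> P \<and> c - real k < Re p \<and> Re p < c. residue f p)
      \<le> 2 * pi * norm (\<Sum>p | p \<in> P \<and> c - real k < Re p \<and> Re p < c. residue f p)"
    by (rule mult_right_mono) (use pi_gt3 in auto)
  ultimately show ?thesis by linarith
qed

lemma real_discrete_finite_strip:
  assumes "real_discrete P"
  shows "finite {p \<in> P. x < Re p \<and> Re p < y}"
proof -
  have "{p \<in> P. x < Re p \<and> Re p < y} \<subseteq> P \<inter> cball 0 (max \<bar>x\<bar> \<bar>y\<bar>)"
    using assms unfolding real_discrete_def by (auto simp: cmod_eq_Re)
  then show ?thesis using assms finite_subset unfolding real_discrete_def by blast
qed

lemma isolated_in_real_discrete:
  assumes "real_discrete P" "d > 0"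
  obtains r where "0 < r" "r \<le> d" "cball q r \<inter> P \<subseteq> {q}"
proof -
  have "open (- (P - {q}))"
    by (rule open_Compl[OF real_discrete_closed[OF real_discrete_subset[OF assms(1)]]]) blast
  moreover have "q \<in> - (P - {q})" by simp
  ultimately obtain r where "r > 0" "cball q r \<subseteq> - (P - {q})"
    using open_contains_cball by blast
  then have "0 < min r d" "min r d \<le> d" "cball q (min r d) \<inter> P \<subseteq> {q}"
    using assms(2) by auto
  then show ?thesis using that by blast
qed

text \<open>
The residue is an integral over a circle about \<open>q\<close> that is small enough to stay in the half-plane
where the multiplier is bounded.
\<close>

lemma multiplier_residue_bound:
  assumes P: "real_discrete P" and holo: "\<phi> holomorphic_on -P" and q: "Im q = 0" "Re q < c"
  obtains M where "M \<ge> 0" "\<And>m \<mu>. m holomorphic_on -P \<Longrightarrow>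
     (\<And>u. Re u \<le> c \<Longrightarrow> u \<notin> P \<Longrightarrow> norm (m u) \<le> \<mu>) \<Longrightarrow>
     norm (residue (\<lambda>u. \<phi> u * m u) q) \<le> M * \<mu>"
proof -
  obtain r where r: "0 < r" "r \<le> c - Re q" "cball q r \<inter> P \<subseteq> {q}"
    using isolated_in_real_discrete[OF P, of "c - Re q"] q by auto
  have sP: "sphere q r \<inter> P = {}" using r by auto
  have "continuous_on (sphere q r) \<phi>"
    by (rule continuous_on_subset[OF holomorphic_on_imp_continuous_on[OF holo]]) (use sP in auto)
  then have "bounded (\<phi> ` sphere q r)"
    using compact_continuous_image compact_imp_bounded compact_sphere by blast
  then obtain B where B: "B > 0" "\<And>u. u \<in> sphere q r \<Longrightarrow> norm (\<phi> u) \<le> B"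
    unfolding bounded_pos by blast
  show ?thesis
  proof
    show "r * B \<ge> 0" using B r by simp
    fix m :: "complex \<Rightarrow> complex" and \<mu> assume m: "m holomorphic_on -P"
      and mu: "\<And>u. Re u \<le> c \<Longrightarrow> u \<notin> P \<Longrightarrow> norm (m u) \<le> \<mu>"
    have "norm (residue (\<lambda>u. \<phi> u * m u) q) \<le> r * (B * \<mu>)"
    proof (rule residue_bound_sphere)
      show "open (- (P - {q}))"
        by (rule open_Compl[OF real_discrete_closed[OF real_discrete_subset[OF P]]]) blast
      show "(\<lambda>u. \<phi> u * m u) holomorphic_on - (P - {q}) - {q}"
        by (rule holomorphic_on_subset[where s = "-P"]) (use m holo in \<open>auto intro: holomorphic_intros\<close>)
      fix u assume u: "u \<in> sphere q r"
      then have "Re u \<le> Re q + r"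
        using abs_Re_le_cmod[of "q - u"] by (auto simp: dist_norm)
      moreover have "u \<notin> P" using u sP by blast
      ultimately have "norm (m u) \<le> \<mu>" using mu[of u] r by simp
      then show "norm (\<phi> u * m u) \<le> B * \<mu>"
        unfolding norm_mult by (intro mult_mono) (use B u in auto)
    qed (use r in auto)
    then show "norm (residue (\<lambda>u. \<phi> u * m u) q) \<le> r * B * \<mu>" by (simp add: mult.assoc)
  qed
qed

text \<open>
In the application \<open>\<phi>\<close> is fixed and the multiplier \<open>m\<close> carries all the dependence on \<open>n\<close> and \<open>t\<close>.
The rectangle integral bounds the residues at all poles with abscissa below \<open>c\<close>; the finitely many of
them that lie in \<open>Q\<close> are bounded separately and subtracted. The constant depends neither on \<open>m\<close> nor on \<open>k\<close>.
\<close>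

theorem multiplier_residue_sum_bound:
  assumes P: "real_discrete P" "P = L \<union> Q" "L \<inter> Q = {}"
    and holo: "\<phi> holomorphic_on -P" and dec: "decays_left P \<phi>"
    and c: "\<And>p k. p \<in> P \<Longrightarrow> Re p \<noteq> c - real k" and Q: "\<And>q. q \<in> Q \<Longrightarrow> Re q \<ge> d"
  obtains M where "M \<ge> 0" "\<And>m \<mu> k. m holomorphic_on -P \<Longrightarrow>
     (\<And>u. Re u \<le> c \<Longrightarrow> u \<notin> P \<Longrightarrow> norm (m u) \<le> \<mu>) \<Longrightarrow> c - real k < d \<Longrightarrow>
     norm (\<Sum>p | p \<in> L \<and> c - real k < Re p \<and> Re p < c. residue (\<lambda>u. \<phi> u * m u) p) \<le> M * \<mu>"
proof -
  define Qc where "Qc = {q \<in> Q. Re q < c}"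
  have "Qc \<subseteq> {p \<in> P. d - 1 < Re p \<and> Re p < c}" using Q P unfolding Qc_def by force
  then have finQ: "finite Qc" using real_discrete_finite_strip[OF P(1)] finite_subset by blast
  have "\<exists>M\<ge>0. \<forall>m \<mu>. m holomorphic_on -P \<longrightarrow>
     (\<forall>u. Re u \<le> c \<longrightarrow> u \<notin> P \<longrightarrow> norm (m u) \<le> \<mu>) \<longrightarrow>
     norm (residue (\<lambda>u. \<phi> u * m u) q) \<le> M * \<mu>" if "q \<in> Qc" for q
  proof -
    have "Im q = 0" "Re q < c" using that P unfolding Qc_def real_discrete_def by auto
    then obtain M where "M \<ge> 0" and "\<And>m \<mu>. m holomorphic_on -P \<Longrightarrow>
       (\<And>u. Re u \<le> c \<Longrightarrow> u \<notin> P \<Longrightarrow> norm (m u) \<le> \<mu>) \<Longrightarrow>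
       norm (residue (\<lambda>u. \<phi> u * m u) q) \<le> M * \<mu>"
      using multiplier_residue_bound[OF P(1) holo] by blast
    then show ?thesis by (intro exI[of _ M] conjI allI impI) auto
  qed
  then obtain Mq where Mq: "\<And>q. q \<in> Qc \<Longrightarrow> Mq q \<ge> 0" "\<And>q m \<mu>. q \<in> Qc \<Longrightarrow> m holomorphic_on -P \<Longrightarrow>
     (\<And>u. Re u \<le> c \<Longrightarrow> u \<notin> P \<Longrightarrow> norm (m u) \<le> \<mu>) \<Longrightarrow>
     norm (residue (\<lambda>u. \<phi> u * m u) q) \<le> Mq q * \<mu>"
    by metis
  obtain B where B: "B \<ge> 0" "\<And>u k. u \<in> frame c \<Longrightarrow> norm (\<phi> (u - of_nat k)) \<le> B / (real k + 1) ^ 2"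
    by (rule decays_leftE[OF dec compact_frame]) (use frame_shift_notin[OF P(1) c] in auto)
  show ?thesis
  proof
    show "2 * B + (\<Sum>q\<in>Qc. Mq q) \<ge> 0" using B Mq by (intro add_nonneg_nonneg sum_nonneg) auto
    fix m :: "complex \<Rightarrow> complex" and \<mu> k assume m: "m holomorphic_on -P"
      and mu: "\<And>u. Re u \<le> c \<Longrightarrow> u \<notin> P \<Longrightarrow> norm (m u) \<le> \<mu>" and k: "c - real k < d"
    let ?f = "\<lambda>u. \<phi> u * m u"
    have fr: "Complex c 1 \<in> frame c" by (simp add: mem_frame)
    have "Complex c 1 \<notin> P" using frame_shift_notin[OF P(1) c fr, of 0] by simp
    then have "norm (m (Complex c 1)) \<le> \<mu>" using mu by simp
    then have "\<mu> \<ge> 0" by (rule order_trans[OF norm_ge_zero])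
    have "norm (\<Sum>p | p \<in> P \<and> c - real k < Re p \<and> Re p < c. residue ?f p) \<le> 2 * (B * \<mu>)"
    proof (rule rectangle_residue_bound[OF P(1) _ c])
      show "?f holomorphic_on -P" by (intro holomorphic_intros m holo)
      fix u j assume u: "u \<in> frame c"
      have "norm (m (u - of_nat j)) \<le> \<mu>"
        by (rule mu) (use u frame_shift_notin[OF P(1) c u, of j] in \<open>auto simp: mem_frame\<close>)
      then have "norm (?f (u - of_nat j)) \<le> B / (real j + 1) ^ 2 * \<mu>"
        unfolding norm_mult by (intro mult_mono B u) (use B in auto)
      then show "norm (?f (u - of_nat j)) \<le> B * \<mu> / (real j + 1) ^ 2" by simp
    qed (use B \<open>\<mu> \<ge> 0\<close> in auto)
    moreover have "{p. p \<in> P \<and> c - real k < Re p \<and> Re p < c} = {p. p \<in> L \<and> c - real k < Re p \<and> Re p < c} \<union> Qc"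
      using P(2) k Q unfolding Qc_def by force
    moreover have "finite {p. p \<in> L \<and> c - real k < Re p \<and> Re p < c}"
      by (rule finite_subset[OF _ real_discrete_finite_strip[OF P(1), of "c - real k" c]]) (use P in auto)
    ultimately have "norm ((\<Sum>p | p \<in> L \<and> c - real k < Re p \<and> Re p < c. residue ?f p) + (\<Sum>p\<in>Qc. residue ?f p)) \<le> 2 * (B * \<mu>)"
      using finQ P(3) by (subst sum.union_disjoint[symmetric]) (auto simp: Qc_def)
    moreover have "norm (\<Sum>p\<in>Qc. residue ?f p) \<le> (\<Sum>p\<in>Qc. Mq p * \<mu>)"
      by (rule sum_norm_le) (use Mq(2) m mu in blast)
    ultimately have "norm (\<Sum>p | p \<in> L \<and> c - real k < Re p \<and> Re p < c. residue ?f p) \<le> 2 * (B * \<mu>) + (\<Sum>p\<in>Qc. Mq p * \<mu>)"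
      by (smt (verit) norm_triangle_ineq4 add_diff_cancel_right')
    then show "norm (\<Sum>p | p \<in> L \<and> c - real k < Re p \<and> Re p < c. residue ?f p) \<le> (2 * B + (\<Sum>q\<in>Qc. Mq q)) * \<mu>"
      by (simp add: sum_distrib_right distrib_right mult.assoc)
  qed
qed

section \<open>Left loops separating two sets of real points\<close>

lemma winding_number_zero_ray:
  assumes g: "path g" "pathfinish g = pathstart g" and "v \<noteq> 0"
    and ray: "\<And>s. s \<ge> 0 \<Longrightarrow> z + of_real s * v \<notin> path_image g"
  shows "winding_number g z = 0"
proof -
  obtain B where B: "\<And>z. B \<le> norm z \<Longrightarrow> winding_number g z = 0"
    using winding_number_zero_at_infinity[OF g] by blast
  define s where "s = (\<bar>B\<bar> + norm z) / norm v"
  have s: "s \<ge> 0" by (simp add: s_def)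
  have "norm (of_real s * v) = \<bar>B\<bar> + norm z"
    unfolding norm_mult norm_of_real using s \<open>v \<noteq> 0\<close> by (simp add: s_def)
  then have "B \<le> norm (z + of_real s * v)"
    using norm_diff_ineq[of "of_real s * v" z] by (simp add: add.commute)
  then have "winding_number g (z + of_real s * v) = 0" by (rule B)
  moreover have "winding_number g z = winding_number g (z + of_real s * v)"
  proof (rule winding_number_eq[OF g])
    show "connected ((\<lambda>s. z + of_real s * v) ` {0..})"
      by (intro connected_continuous_image continuous_intros connected_Ici)
    show "z \<in> (\<lambda>s. z + of_real s * v) ` {0..}" by (rule image_eqI[of _ _ 0]) auto
  qed (use s ray in auto)
  ultimately show ?thesis by simp
qed

definition graph_path :: "real \<Rightarrow> real \<Rightarrow> (real \<Rightarrow> real) \<Rightarrow> real \<Rightarrow> complex" where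
  "graph_path c d P x = Complex (c + (d - c) * x) (P (c + (d - c) * x))"

lemma path_image_graph_path:
  assumes "c < d"
  shows "path_image (graph_path c d P) = (\<lambda>x. Complex x (P x)) ` {c..d}"
proof -
  have "(\<lambda>x. c + (d - c) * x) ` {0..1} = {c..d}"
    using image_affinity_atLeastAtMost[of "d - c" c 0 1] assms by (simp add: add.commute)
  then have "(\<lambda>x. Complex x (P x)) ` {c..d} = (\<lambda>x. Complex x (P x)) ` ((\<lambda>x. c + (d - c) * x) ` {0..1})"
    by simp
  then show ?thesis unfolding path_image_def graph_path_def image_image by simp
qed

lemma valid_path_graph_path:
  assumes "real_polynomial_function P"
  shows "valid_path (graph_path c d P)"
proof -
  have l: "real_polynomial_function (\<lambda>x. c + (d - c) * x)"
    by (intro real_polynomial_function.intros bounded_linear_ident)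
  have "real_polynomial_function (P \<circ> (\<lambda>x. c + (d - c) * x))"
    by (rule real_polynomial_function_compose[OF _ assms]) (use l in \<open>simp add: real_polynomial_function_eq\<close>)
  then have "polynomial_function (\<lambda>x. (c + (d - c) * x) *\<^sub>R (1::complex) + (P (c + (d - c) * x)) *\<^sub>R \<i>)"
    using l unfolding real_polynomial_function_eq o_def
    by (intro polynomial_function_add[OF polynomial_function_mult[OF _ polynomial_function_const]
                polynomial_function_mult[OF _ polynomial_function_const]])
  moreover have "graph_path c d P = (\<lambda>x. (c + (d - c) * x) *\<^sub>R (1::complex) + (P (c + (d - c) * x)) *\<^sub>R \<i>)"
    by (auto simp: graph_path_def complex_eq_iff fun_eq_iff)
  ultimately show ?thesis using valid_path_polynomial_function by metis
qed

text \<open>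
The loop follows the graph of \<open>P\<close> from \<open>c\<close> to \<open>d\<close>, goes up to height \<open>h\<close> and returns along a
horizontal line. A real point between \<open>c\<close> and \<open>d\<close> is enclosed if and only if the graph passes
below it, so arbitrarily interlaced sets of points are separated by choosing the sign of \<open>P\<close>.
\<close>

definition graph_loop :: "real \<Rightarrow> real \<Rightarrow> (real \<Rightarrow> real) \<Rightarrow> real \<Rightarrow> real \<Rightarrow> complex" where
  "graph_loop c d P h =
     graph_path c d P +++ (linepath (Complex d (P d)) (Complex d h) +++ linepath (Complex d h) (Complex c h))"

locale graph_loop_data =
  fixes c d h \<delta> :: real and P :: "real \<Rightarrow> real"
  assumes cd: "c < d" and poly: "real_polynomial_function P"
    and Ph: "\<And>x. x \<in> {c..d} \<Longrightarrow> P x < h" and Pc: "P c = - \<delta>" and Pd: "P d > 0" and \<delta>: "\<delta> > 0"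
begin

lemma h: "h > 0" using Ph[of d] Pd cd by simp

lemma ends: "pathstart (graph_path c d P) = Complex c (P c)" "pathfinish (graph_path c d P) = Complex d (P d)"
  "pathstart (graph_loop c d P h) = Complex c (P c)" "pathfinish (graph_loop c d P h) = Complex c h"
  by (auto simp: graph_loop_def graph_path_def pathstart_def pathfinish_def joinpaths_def linepath_def)

lemma image: "path_image (graph_loop c d P h) = (\<lambda>x. Complex x (P x)) ` {c..d} \<union>
    closed_segment (Complex d (P d)) (Complex d h) \<union> closed_segment (Complex d h) (Complex c h)"
  unfolding graph_loop_def by (simp add: path_image_join ends path_image_graph_path[OF cd] Un_assoc)

lemma arc_graph_path: "arc (graph_path c d P)"
  unfolding arc_def using valid_path_imp_path[OF valid_path_graph_path[OF poly]] cd
  by (auto simp: inj_on_def graph_path_def)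

lemma arc: "arc (graph_loop c d P h)"
  unfolding graph_loop_def
proof (intro arc_join arc_graph_path arc_linepath)
  show "Complex d (P d) \<noteq> Complex d h" "Complex d h \<noteq> Complex c h" using Ph[of d] cd by auto
  have "P x \<noteq> h" if "c \<le> x" "x \<le> d" for x using Ph[of x] that by auto
  then show "path_image (graph_path c d P) \<inter>
      path_image (linepath (Complex d (P d)) (Complex d h) +++ linepath (Complex d h) (Complex c h))
      \<subseteq> {pathstart (linepath (Complex d (P d)) (Complex d h) +++ linepath (Complex d h) (Complex c h))}"
  proof (intro subsetI)
    fix z assume "z \<in> path_image (graph_path c d P) \<inter>
      path_image (linepath (Complex d (P d)) (Complex d h) +++ linepath (Complex d h) (Complex c h))"
    then obtain x where x: "z = Complex x (P x)" "c \<le> x" "x \<le> d"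
      and "z \<in> closed_segment (Complex d (P d)) (Complex d h) \<or> z \<in> closed_segment (Complex d h) (Complex c h)"
      by (auto simp: path_image_graph_path[OF cd] path_image_join)
    then have "x = d" using \<open>\<And>x. c \<le> x \<Longrightarrow> x \<le> d \<Longrightarrow> P x \<noteq> h\<close>[of x]
      by (auto simp: closed_segment_same_Re closed_segment_same_Im)
    then show "z \<in> {pathstart (linepath (Complex d (P d)) (Complex d h) +++ linepath (Complex d h) (Complex c h))}"
      using x by simp
  qed
qed (use cd in \<open>auto simp: ends closed_segment_same_Re closed_segment_same_Im\<close>)

lemma left_loop: "left_loop (graph_loop c d P h)"
  unfolding left_loop_def
proof (intro conjI ballI)
  show "valid_path (graph_loop c d P h)"
    unfolding graph_loop_def by (intro valid_path_join valid_path_graph_path poly) (auto simp: ends)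
  show "arc (graph_loop c d P h)" by (rule arc)
  show "Re (pathstart (graph_loop c d P h)) = Re (pathfinish (graph_loop c d P h))"
    "Im (pathstart (graph_loop c d P h)) < Im (pathfinish (graph_loop c d P h))"
    using Ph[of c] cd by (auto simp: ends)
  fix x :: real assume x: "x \<in> {0<..<1}"
  let ?g = "graph_loop c d P h"
  have "?g x \<noteq> ?g 0" "?g x \<noteq> ?g 1"
    using arc x unfolding arc_def inj_on_def by (auto, force+)
  then have ne: "?g x \<noteq> Complex c (P c)" "?g x \<noteq> Complex c h"
    using ends by (auto simp: pathstart_def pathfinish_def)
  have "?g x \<in> path_image ?g" using x by (auto simp: path_image_def)
  then have "Re (?g x) \<ge> c" "Re (?g x) = c \<Longrightarrow> ?g x = Complex c (P c) \<or> ?g x = Complex c h"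
    unfolding image using cd
    by (auto simp: closed_segment_same_Re closed_segment_same_Im closed_segment_eq_real_ivl complex_eq_iff split: if_splits)
  then show "Re (pathstart ?g) < Re (?g x)" using ne by (force simp: ends)
qed

abbreviation closed_loop where
  "closed_loop \<equiv> graph_loop c d P h +++ linepath (Complex c h) (Complex c (P c))"

lemma path_closed_loop: "path closed_loop" "pathfinish closed_loop = pathstart closed_loop"
  "path_image closed_loop = path_image (graph_loop c d P h) \<union> closed_segment (Complex c h) (Complex c (P c))"
  using arc_imp_path[OF arc] by (auto simp: ends path_image_join)

text \<open>
The downward vertical ray from the point misses the closed curve.
\<close>

lemma mem_right:
  assumes "x > c" "x \<le> d \<Longrightarrow> P x > 0"
  shows "Complex x 0 \<in> loop_right (graph_loop c d P h)"
proof -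
  have ray: "Complex x (- s) \<notin> path_image closed_loop" if "s \<ge> 0" for s
    unfolding path_closed_loop image using assms that cd h Pd \<delta> Ph[of d]
    by (auto simp: closed_segment_same_Re closed_segment_same_Im closed_segment_eq_real_ivl split: if_splits)
  have "winding_number closed_loop (Complex x 0) = 0"
  proof (rule winding_number_zero_ray[OF path_closed_loop(1,2), of "-\<i>"])
    fix s :: real assume "s \<ge> 0"
    have "Complex x 0 + complex_of_real s * - \<i> = Complex x (- s)" by (simp add: complex_eq_iff)
    then show "Complex x 0 + complex_of_real s * - \<i> \<notin> path_image closed_loop"
      using ray[OF \<open>s \<ge> 0\<close>] by simp
  qed auto
  then show ?thesis using ray[of 0] assms unfolding loop_right_def path_closed_loop ends by auto
qed

lemma mem_left_strip:
  assumes "x \<le> c"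
  shows "Complex x 0 \<in> loop_left (graph_loop c d P h)"
  using assms h Pc \<delta> unfolding loop_left_def ends by auto

text \<open>
Replace the graph by the segment \<open>A E\<close> at height \<open>-\<delta>\<close> followed by the vertical segment \<open>E D\<close>.
The upward ray from the point meets neither the graph nor these segments, so the winding number is
unchanged, and what remains is a rectangle around the point.
\<close>

lemma mem_left:
  assumes x: "x > c" "x < d" "P x = - \<delta>"
  shows "Complex x 0 \<in> loop_left (graph_loop c d P h)"
proof -
  define z where "z = Complex x 0"
  define A D E T U where "A = Complex c (-\<delta>)" and "D = Complex d (P d)" and "E = Complex d (-\<delta>)"
    and "T = Complex d h" and "U = Complex c h"
  define W where "W u v = winding_number (linepath u v) z" for u v
  have notin: "z \<notin> closed_segment D E" "z \<notin> closed_segment E A" "z \<notin> closed_segment D T" "z \<notin> closed_segment E T"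
     "z \<notin> closed_segment T U" "z \<notin> closed_segment U A" "z \<notin> closed_segment A E" "z \<notin> closed_segment E D"
     "z \<notin> path_image (graph_path c d P)"
    unfolding path_image_graph_path[OF cd] using x \<delta> h
    by (auto simp: z_def A_def D_def E_def T_def U_def closed_segment_same_Re closed_segment_same_Im)
  have rev: "W u v = - W v u" if "z \<notin> closed_segment v u" for u v
    unfolding W_def using winding_number_reversepath[of "linepath v u" z] that by simp
  have e: "pathstart (graph_path c d P) = A" "pathfinish (graph_path c d P) = D"
     "path (graph_path c d P)"
    using arc_imp_path[OF arc_graph_path] by (auto simp: ends A_def D_def Pc)
  let ?l = "graph_path c d P +++ (linepath D E +++ linepath E A)"
  have "winding_number ?l z = 0"
  proof (rule winding_number_zero_ray[where v = \<i>])
    fix s :: real assume "s \<ge> 0"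
    have "z + complex_of_real s * \<i> = Complex x s" by (simp add: complex_eq_iff z_def)
    moreover have "Complex x s \<notin> path_image ?l"
      using e x \<delta> \<open>s \<ge> 0\<close> by (simp add: path_image_join path_image_graph_path[OF cd])
        (auto simp: z_def A_def D_def E_def closed_segment_same_Re closed_segment_same_Im)
    ultimately show "z + complex_of_real s * \<i> \<notin> path_image ?l" by simp
  qed (use e in auto)
  moreover have "winding_number ?l z = winding_number (graph_path c d P) z + (W D E + W E A)"
    unfolding W_def using e notin by (simp add: winding_number_join path_image_join)
  moreover have "winding_number closed_loop z = winding_number (graph_path c d P) z + (W D T + W T U) + W U A"
    unfolding W_def graph_loop_def Pc D_def[symmetric] T_def[symmetric] U_def[symmetric] A_def[symmetric]
    using e notin by (simp add: winding_number_join path_image_join)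
  moreover have "W D E = - W E D" by (rule rev[OF notin(8)])
  moreover have "W E A = - W A E" by (rule rev[OF notin(7)])
  moreover have "W E T = W E D + W D T"
    unfolding W_def
    by (rule winding_number_split_linepath)
       (use notin Pd \<delta> Ph[of d] cd in \<open>auto simp: D_def E_def T_def closed_segment_same_Re closed_segment_eq_real_ivl\<close>)
  moreover have "winding_number (rectpath A T) z = 1"
    by (rule winding_number_rectpath) (use x \<delta> h in \<open>auto simp: in_box_complex_iff A_def T_def z_def\<close>)
  moreover have "rectpath A T = linepath A E +++ linepath E T +++ linepath T U +++ linepath U A"
    by (simp add: rectpath_def Let_def A_def E_def T_def U_def)
  then have "winding_number (rectpath A T) z = W A E + (W E T + (W T U + W U A))"
    unfolding W_def using notin by (simp add: winding_number_join path_image_join)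
  ultimately have w: "winding_number closed_loop z = 1" by algebra
  have "z \<notin> path_image (graph_loop c d P h)"
    unfolding image using x \<delta> h by (auto simp: z_def closed_segment_same_Re closed_segment_same_Im)
  then show ?thesis using w x unfolding loop_left_def ends z_def by auto
qed

end

text \<open>
Only the points between two abscissae \<open>c\<close> and \<open>d\<close> matter. A product of squares that vanishes
exactly at the points to be enclosed, lowered by a small \<open>\<delta>\<close>, is negative there and positive at
the points to be excluded.
\<close>

theorem left_loop_exists:
  assumes AB: "real_discrete A" "real_discrete B" "A \<inter> B = {}"
    and A: "\<And>p. p \<in> A \<Longrightarrow> Re p \<le> x1" and B: "\<And>q. q \<in> B \<Longrightarrow> x0 \<le> Re q"
  shows "\<exists>g. left_loop g \<and> A \<subseteq> loop_left g \<and> B \<subseteq> loop_right g"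
proof -
  define c d where "c = min x0 x1 - 1" and "d = max x0 x1 + 1"
  have cd: "c < d" by (simp add: c_def d_def)
  have fin: "finite {p \<in> S. c \<le> Re p \<and> Re p \<le> d}" if "real_discrete S" for S
  proof -
    have "{p \<in> S. c \<le> Re p \<and> Re p \<le> d} \<subseteq> S \<inter> cball 0 (max \<bar>c\<bar> \<bar>d\<bar>)"
      using that unfolding real_discrete_def by (auto simp: cmod_eq_Re)
    then show ?thesis using that finite_subset unfolding real_discrete_def by blast
  qed
  \<comment> \<open>The end \<open>c\<close> is treated as a point to be enclosed and \<open>d\<close> as one to be excluded, so that the graph
starts below the real axis and ends above it.\<close>
  define X where "X = insert c (Re ` {p \<in> A. c \<le> Re p \<and> Re p \<le> d})"
  define Y where "Y = insert d (Re ` {p \<in> B. c \<le> Re p \<and> Re p \<le> d})"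
  have finXY: "finite X" "finite Y" unfolding X_def Y_def using fin AB by auto
  have XY: "X \<inter> Y = {}"
  proof -
    have "Re p \<noteq> Re q" if "p \<in> A" "q \<in> B" for p q
      using that AB unfolding real_discrete_def by (metis IntI complex_eqI empty_iff)
    then show ?thesis using A B cd unfolding X_def Y_def c_def d_def by force
  qed
  define \<pi> where "\<pi> x = (\<Prod>a\<in>X. (x - a) ^ 2)" for x
  have \<pi>0: "\<pi> x = 0" if "x \<in> X" for x using that finXY unfolding \<pi>_def by auto
  have \<pi>1: "\<pi> y > 0" if "y \<in> Y" for y
    unfolding \<pi>_def using that XY by (intro prod_pos) auto
  define \<delta> where "\<delta> = Min (\<pi> ` Y) / 2"
  have "Min (\<pi> ` Y) \<in> \<pi> ` Y" using finXY by (intro Min_in) (auto simp: Y_def)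
  then have \<delta>: "\<delta> > 0" using \<pi>1 unfolding \<delta>_def by auto
  have \<delta>2: "\<pi> y > \<delta>" if "y \<in> Y" for y
  proof -
    have "Min (\<pi> ` Y) \<le> \<pi> y" using that finXY by simp
    then show ?thesis using \<delta> unfolding \<delta>_def by linarith
  qed
  define P where "P x = \<pi> x - \<delta>" for x
  have poly: "real_polynomial_function P"
    unfolding P_def \<pi>_def
    by (intro real_polynomial_function_diff real_polynomial_function_prod real_polynomial_function_power
         real_polynomial_function.intros bounded_linear_ident finXY)
  have "compact (P ` {c..d})"
    using continuous_real_polymonial_function[OF poly]
    by (intro compact_continuous_image continuous_at_imp_continuous_on) auto
  then obtain b where b: "\<forall>y\<in>P ` {c..d}. norm y \<le> b"
    using compact_imp_bounded[of "P ` {c..d}"] unfolding bounded_iff by blast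
  have h: "P x < b + 1" if "x \<in> {c..d}" for x
  proof -
    have "norm (P x) \<le> b" using b that by blast
    then show ?thesis by (simp add: abs_le_iff)
  qed
  interpret graph_loop_data c d "b + 1" \<delta> P
    by unfold_locales (use cd poly h \<delta> \<pi>0 \<delta>2 in \<open>auto simp: P_def X_def Y_def\<close>)
  have cplx: "p = Complex (Re p) 0" if "p \<in> A \<union> B" for p
    using that AB unfolding real_discrete_def by (auto simp: complex_eq_iff)
  have "p \<in> loop_left (graph_loop c d P (b + 1))" if "p \<in> A" for p
  proof (cases "Re p \<le> c")
    case True
    from mem_left_strip[OF this] show ?thesis using cplx that by auto
  next
    case False
    then have "Re p \<in> X" "Re p < d" using A[OF that] that unfolding X_def d_def by auto
    then show ?thesis using mem_left[of "Re p"] False \<pi>0 cplx that by (auto simp: P_def)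
  qed
  moreover have "p \<in> loop_right (graph_loop c d P (b + 1))" if "p \<in> B" for p
  proof -
    have "Re p > c" using B[OF that] by (simp add: c_def)
    moreover have "Re p \<le> d \<Longrightarrow> Re p \<in> Y" using that \<open>Re p > c\<close> unfolding Y_def by auto
    ultimately show ?thesis using mem_right[of "Re p"] \<delta>2 cplx that by (auto simp: P_def)
  qed
  ultimately show ?thesis using left_loop by blast
qed

section \<open>The dominant coefficient at a multiple pole\<close>

text \<open>
Comparing coefficients in \<open>E' = \<Lambda> * E\<close> gives a recursion with nonnegative terms whenever the
coefficients of the logarithmic derivative \<open>\<Lambda>\<close> are nonnegative. Keeping only the term with the constant
coefficient of \<open>\<Lambda>\<close> shows that the coefficients of \<open>E\<close> grow at least like those of an exponential
series with that rate.
\<close>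

lemma log_deriv_nth:
  fixes E \<Lambda> :: "complex fps"
  assumes "fps_deriv E = \<Lambda> * E"
  shows "of_nat (Suc j) * fps_nth E (Suc j) = (\<Sum>i\<le>j. fps_nth \<Lambda> i * fps_nth E (j - i))"
  using arg_cong[OF assms, of "\<lambda>F. fps_nth F j"] by (simp add: fps_mult_nth atLeast0AtMost)

lemma log_deriv_nonneg:
  fixes E \<Lambda> :: "complex fps"
  assumes E: "fps_deriv E = \<Lambda> * E" "fps_nth E 0 = 1" and \<Lambda>: "\<And>i. fps_nth \<Lambda> i \<in> \<real>\<^sub>\<ge>\<^sub>0"
  shows "fps_nth E j \<in> \<real>\<^sub>\<ge>\<^sub>0"
proof (induction j rule: less_induct)
  case (less j)
  show ?case
  proof (cases j)
    case (Suc i)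
    have "fps_nth E j = (\<Sum>l\<le>i. fps_nth \<Lambda> l * fps_nth E (i - l)) / of_nat (Suc i)"
      using log_deriv_nth[OF E(1), of i] Suc by (simp add: field_simps del: of_nat_Suc)
    also have "\<dots> \<in> \<real>\<^sub>\<ge>\<^sub>0"
    proof (intro nonneg_Reals_divide_I)
      have "(\<Sum>l\<in>S. fps_nth \<Lambda> l * fps_nth E (i - l)) \<in> \<real>\<^sub>\<ge>\<^sub>0" if "finite S" for S
        using that by (induction S) (use \<Lambda> less Suc in \<open>auto intro!: nonneg_Reals_add_I nonneg_Reals_mult_I\<close>)
      then show "(\<Sum>l\<le>i. fps_nth \<Lambda> l * fps_nth E (i - l)) \<in> \<real>\<^sub>\<ge>\<^sub>0" by blast
      show "complex_of_nat (Suc i) \<in> \<real>\<^sub>\<ge>\<^sub>0" by (simp add: complex_nonneg_Reals_iff)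
    qed
    finally show ?thesis .
  qed (use E in simp)
qed

lemma log_deriv_growth:
  fixes E \<Lambda> :: "complex fps"
  assumes E: "fps_deriv E = \<Lambda> * E" "fps_nth E 0 = 1" and \<Lambda>: "\<And>i. fps_nth \<Lambda> i \<in> \<real>\<^sub>\<ge>\<^sub>0"
  shows "Re (fps_nth \<Lambda> 0) * Re (fps_nth E j) \<le> real (Suc j) * Re (fps_nth E (Suc j))"
proof -
  have nn: "Re (fps_nth E i) \<ge> 0" "Im (fps_nth E i) = 0" "Re (fps_nth \<Lambda> i) \<ge> 0" "Im (fps_nth \<Lambda> i) = 0" for i
    using log_deriv_nonneg[OF assms, of i] \<Lambda>[of i] by (auto simp: complex_nonneg_Reals_iff)
  have "Re (fps_nth \<Lambda> 0) * Re (fps_nth E j) = Re (fps_nth \<Lambda> 0 * fps_nth E (j - 0))"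
    using nn by simp
  also have "\<dots> \<le> (\<Sum>i\<le>j. Re (fps_nth \<Lambda> i * fps_nth E (j - i)))"
    by (rule member_le_sum) (use nn in auto)
  also have "\<dots> = Re (of_nat (Suc j) * fps_nth E (Suc j))"
    unfolding log_deriv_nth[OF E(1)] by simp
  finally show ?thesis by simp
qed

text \<open>
If the rate \<open>S\<close> is large, each coefficient of \<open>E\<close> up to order \<open>r\<close> is smaller than the next one by a
factor of order \<open>1 / S\<close>. In the Cauchy product with the fixed series \<open>\<Psi>\<close> only the term with the
top coefficient of \<open>E\<close> survives.
\<close>

lemma top_coefficient_dominates:
  fixes E \<Lambda> \<Psi> :: "complex fps"
  assumes E: "fps_deriv E = \<Lambda> * E" "fps_nth E 0 = 1" and \<Lambda>: "\<And>i. fps_nth \<Lambda> i \<in> \<real>\<^sub>\<ge>\<^sub>0"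
    and S: "0 < S" "real r \<le> S" "S \<le> Re (fps_nth \<Lambda> 0)"
  shows "Re (fps_nth E r) \<ge> 1" "Im (fps_nth E r) = 0"
    "norm (fps_nth (\<Psi> * E) r - fps_nth \<Psi> 0 * fps_nth E r)
       \<le> (\<Sum>i\<le>r. norm (fps_nth \<Psi> i)) * real r / S * Re (fps_nth E r)"
proof -
  define e where "e j = Re (fps_nth E j)" for j
  have E_e: "fps_nth E j = of_real (e j)" "e j \<ge> 0" for j
    using log_deriv_nonneg[OF E \<Lambda>, of j] by (auto simp: complex_nonneg_Reals_iff complex_eq_iff e_def)
  have step: "e j \<le> real r / S * e (Suc j)" if "j < r" for j
  proof -
    have "S * e j \<le> Re (fps_nth \<Lambda> 0) * e j" by (rule mult_right_mono) (use S E_e in auto)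
    also have "\<dots> \<le> real (Suc j) * e (Suc j)" using log_deriv_growth[OF E \<Lambda>] by (simp add: e_def)
    also have "\<dots> \<le> real r * e (Suc j)" by (rule mult_right_mono) (use that E_e in auto)
    finally show ?thesis using S by (simp add: field_simps)
  qed
  have step': "e j \<le> e (Suc j)" if "j < r" for j
  proof -
    have "real r / S * e (Suc j) \<le> 1 * e (Suc j)" by (rule mult_right_mono) (use S E_e in auto)
    then show ?thesis using step[OF that] by simp
  qed
  have mono: "e j \<le> e r" if "j \<le> r" for j
    using that by (induction j rule: inc_induct) (use step' in \<open>auto intro: order_trans\<close>)
  have "e 0 = 1" using E by (simp add: e_def)
  then show "Re (fps_nth E r) \<ge> 1" using mono[of 0] by (simp add: e_def)
  show "Im (fps_nth E r) = 0" using E_e by simp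
  have small: "e j \<le> real r / S * e r" if "j < r" for j
    using step[OF that] mono[of "Suc j"] that S mult_left_mono[of "e (Suc j)" "e r" "real r / S"] by auto
  have "fps_nth (\<Psi> * E) r = (\<Sum>i\<in>insert 0 {1..r}. fps_nth \<Psi> i * fps_nth E (r - i))"
    unfolding fps_mult_nth by (rule sum.cong) auto
  then have "fps_nth (\<Psi> * E) r - fps_nth \<Psi> 0 * fps_nth E r = (\<Sum>i=1..r. fps_nth \<Psi> i * fps_nth E (r - i))"
    by simp
  also have "norm \<dots> \<le> (\<Sum>i=1..r. norm (fps_nth \<Psi> i) * (real r / S * e r))"
    by (rule sum_norm_le) (use small E_e in \<open>auto simp: norm_mult simp del: times_divide_eq_left times_divide_eq_right intro!: mult_left_mono\<close>)
  also have "\<dots> \<le> (\<Sum>i\<le>r. norm (fps_nth \<Psi> i) * (real r / S * e r))"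
    by (rule sum_mono2) (use E_e S in auto)
  also have "\<dots> = (\<Sum>i\<le>r. norm (fps_nth \<Psi> i)) * real r / S * e r"
    by (simp add: sum_distrib_right sum_divide_distrib mult.assoc)
  finally show "norm (fps_nth (\<Psi> * E) r - fps_nth \<Psi> 0 * fps_nth E r)
       \<le> (\<Sum>i\<le>r. norm (fps_nth \<Psi> i)) * real r / S * Re (fps_nth E r)" by (simp add: e_def)
qed

definition geometric_fps :: "'a::comm_ring_1 \<Rightarrow> 'a fps" where
  "geometric_fps c = Abs_fps (\<lambda>n. c ^ n)"

lemma geometric_fps_inverse:
  fixes c :: "'a::field"
  shows "geometric_fps c = inverse (1 - fps_const c * fps_X)"
proof -
  have "(1 - fps_const c * fps_X) * geometric_fps c = 1"
  proof (rule fps_ext)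
    fix n
    have "fps_nth ((1 - fps_const c * fps_X) * geometric_fps c) n =
       c ^ n - c * (if n = 0 then 0 else c ^ (n - 1))"
      by (simp add: algebra_simps geometric_fps_def)
    then show "fps_nth ((1 - fps_const c * fps_X) * geometric_fps c) n = fps_nth 1 n"
      by (cases n) auto
  qed
  then show ?thesis using fps_inverse_unique by metis
qed

lemma fps_deriv_geometric:
  fixes c :: "'a::field"
  shows "fps_deriv (geometric_fps c) = fps_const c * geometric_fps c * geometric_fps c"
  unfolding geometric_fps_inverse by (subst fps_inverse_deriv) (simp_all add: power2_eq_square)

lemma has_fps_expansion_geometric:
  fixes c :: complex
  shows "(\<lambda>v. 1 / (1 - v * c)) has_fps_expansion geometric_fps c"
proof -
  have "(\<lambda>v. inverse (1 - c * v)) has_fps_expansion inverse (1 - fps_const c * fps_X)"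
    by (intro fps_expansion_intros) auto
  then show ?thesis by (simp add: geometric_fps_inverse inverse_eq_divide mult.commute)
qed

text \<open>
The residue at a pole of order \<open>r + 1\<close> is the coefficient of order \<open>r\<close> of the product of the
expansion of \<open>\<psi>\<close> with a series whose logarithmic derivative is
\<open>T + (\<Sum>j<N. 1 / (q j - v))\<close>. All coefficients of the latter are nonnegative and its constant term is at
least \<open>S\<close>. The bound is uniform in \<open>T\<close>, which will be \<open>- ln t\<close>.
\<close>

theorem dominant_residue:
  fixes \<psi> :: "complex \<Rightarrow> complex" and q :: "nat \<Rightarrow> real"
  assumes "\<psi> analytic_on {0}" and q: "\<And>j. q j > (0::real)"
  obtains A where "A \<ge> 0" "\<And>N T S. T \<ge> 0 \<Longrightarrow> S = (\<Sum>j<N. 1 / q j) \<Longrightarrow> 0 < S \<Longrightarrow> real r \<le> S \<Longrightarrow>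
     \<exists>e\<ge>1. norm (residue (\<lambda>v. \<psi> v * (exp (of_real T * v) * (\<Prod>j<N. 1 / (1 - v / of_real (q j)))) / v ^ Suc r) 0
              - \<psi> 0 * of_real e) \<le> A / S * e"
proof -
  obtain \<Psi> where \<Psi>: "\<psi> has_fps_expansion \<Psi>"
    using assms analytic_at_imp_has_fps_expansion_0 by blast
  have \<Psi>0: "fps_nth \<Psi> 0 = \<psi> 0" using has_fps_expansion_imp_0_eq_fps_nth_0[OF \<Psi>] by simp
  show ?thesis
  proof
    show "(\<Sum>i\<le>r. norm (fps_nth \<Psi> i)) * real r \<ge> 0" by (intro mult_nonneg_nonneg sum_nonneg) auto
    fix N :: nat and T S :: real assume T: "T \<ge> 0" and S: "S = (\<Sum>j<N. 1 / q j)" "0 < S" "real r \<le> S"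
    define G where "G j = geometric_fps (1 / of_real (q j) :: complex)" for j
    define E where "E N = fps_exp (of_real T) * (\<Prod>j<N. G j)" for N
    define \<Lambda> where "\<Lambda> N = fps_const (of_real T) + (\<Sum>j<N. fps_const (1 / of_real (q j)) * G j)" for N
    have dE: "fps_deriv (E N) = \<Lambda> N * E N" for N
    proof (induction N)
      case (Suc N)
      have "E (Suc N) = E N * G N" "\<Lambda> (Suc N) = \<Lambda> N + fps_const (1 / of_real (q N)) * G N"
        by (auto simp: E_def \<Lambda>_def mult.assoc)
      then show ?case using Suc
        by (simp add: G_def fps_deriv_geometric algebra_simps)
    qed (simp add: E_def \<Lambda>_def)
    have E0: "fps_nth (E N) 0 = 1" for N
      by (induction N) (auto simp: E_def G_def geometric_fps_def)
    have \<Lambda>nn: "fps_nth (\<Lambda> N) i \<in> \<real>\<^sub>\<ge>\<^sub>0" for i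
    proof -
      have "fps_nth (\<Lambda> N) i = of_real ((if i = 0 then T else 0) + (\<Sum>j<N. 1 / q j * (1 / q j) ^ i))"
        by (simp add: \<Lambda>_def fps_sum_nth G_def geometric_fps_def)
      moreover have "(if i = 0 then T else 0) + (\<Sum>j<N. 1 / q j * (1 / q j) ^ i) \<ge> 0"
        using T q by (intro add_nonneg_nonneg sum_nonneg) (auto intro: less_imp_le)
      ultimately show ?thesis by (metis nonneg_Reals_of_real_iff)
    qed
    have "fps_nth (\<Lambda> N) 0 = of_real (T + S)"
      by (simp add: \<Lambda>_def fps_sum_nth G_def geometric_fps_def S(1))
    then have "S \<le> Re (fps_nth (\<Lambda> N) 0)" using T by simp
    note top = top_coefficient_dominates[OF dE E0 \<Lambda>nn S(2,3) this]
    have "(\<lambda>v. \<psi> v * (exp (of_real T * v) * (\<Prod>j<N. 1 / (1 - v * (1 / of_real (q j)))))) has_fps_expansion \<Psi> * E N"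
      unfolding E_def G_def
      by (intro fps_expansion_intros \<Psi> has_fps_expansion_geometric)
    then have "residue (\<lambda>v. \<psi> v * (exp (of_real T * v) * (\<Prod>j<N. 1 / (1 - v / of_real (q j)))) / v ^ Suc r) 0
        = fps_nth (\<Psi> * E N) r"
      using residue_fps_expansion_over_power_at_0 by simp
    moreover have "fps_nth (E N) r = of_real (Re (fps_nth (E N) r))"
      using top(2) by (simp add: complex_eq_iff)
    ultimately show "\<exists>e\<ge>1. norm (residue (\<lambda>v. \<psi> v * (exp (of_real T * v) * (\<Prod>j<N. 1 / (1 - v / of_real (q j)))) / v ^ Suc r) 0
              - \<psi> 0 * of_real e) \<le> (\<Sum>i\<le>r. norm (fps_nth \<Psi> i)) * real r / S * e"
      using top(1) top(3)[of \<Psi>] \<Psi>0 by metis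
  qed
qed

section \<open>Decay of quotients of Gamma functions\<close>

definition gamma_ratio :: "real ^ 'p \<Rightarrow> real ^ 'p \<Rightarrow> complex \<Rightarrow> complex" where
  "gamma_ratio a b u =
     (\<Prod>i\<in>UNIV. Gamma (of_real (a $ i) + u)) * (\<Prod>i\<in>UNIV. rGamma (of_real (b $ i) + u))"

definition left_poles :: "real ^ 'p \<Rightarrow> complex set" where
  "left_poles a = {- of_real (a $ j) - of_nat l | j l. True}"

text \<open>
All natural numbers are counted as poles on the right, although the denominator
\<open>pochhammer (- u) n\<close> vanishes only at those below \<open>n\<close>: at the others the product
\<open>Gamma (- u) * rGamma (n - u)\<close> evaluates to 0 instead of the value that continuity requires.
\<close>

definition all_poles :: "real ^ 'p \<Rightarrow> complex set" where
  "all_poles a = left_poles a \<union> range of_nat"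

text \<open>
The integrand of the Meijer function in the variable \<open>u = s + n - 1\<close>, up to the factor
\<open>t ^ (n - 1)\<close>. In this variable the left poles do not move with \<open>n\<close>.
\<close>

definition mellin_factor :: "real ^ 'p \<Rightarrow> real ^ 'p \<Rightarrow> nat \<Rightarrow> real \<Rightarrow> complex \<Rightarrow> complex" where
  "mellin_factor a b n t u = gamma_ratio a b u * of_real t powr (- u) / pochhammer (- u) n"

lemma in_left_poles_iff: "u \<in> left_poles a \<longleftrightarrow> (\<exists>j. of_real (a $ j) + u \<in> \<int>\<^sub>\<le>\<^sub>0)"
proof
  assume "u \<in> left_poles a"
  then obtain j l where "u = - of_real (a $ j) - of_nat l"
    unfolding left_poles_def by blast
  then have "of_real (a $ j) + u = - of_nat l" by simp
  then show "\<exists>j. of_real (a $ j) + u \<in> \<int>\<^sub>\<le>\<^sub>0"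
    by (metis minus_of_nat_in_nonpos_Ints)
next
  assume "\<exists>j. of_real (a $ j) + u \<in> \<int>\<^sub>\<le>\<^sub>0"
  then obtain j l where l: "of_real (a $ j) + u = - of_nat l" by (auto elim: nonpos_Ints_cases')
  have "u = (of_real (a $ j) + u) - of_real (a $ j)" by simp
  then have "u = - of_real (a $ j) - of_nat l" unfolding l by simp
  then show "u \<in> left_poles a" unfolding left_poles_def by blast
qed

lemma real_discrete_Un: "real_discrete A \<Longrightarrow> real_discrete B \<Longrightarrow> real_discrete (A \<union> B)"
  unfolding real_discrete_def by (auto simp: Int_Un_distrib2)

lemma real_discrete_progression: "real_discrete (range (\<lambda>l::nat. of_real (x + s * real l)))"
  if "\<bar>s\<bar> = 1"
  unfolding real_discrete_def
proof (intro conjI ballI allI)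
  fix r
  have "range (\<lambda>l::nat. complex_of_real (x + s * real l)) \<inter> cball 0 r \<subseteq> (\<lambda>l. of_real (x + s * real l)) ` {..nat \<lceil>r + \<bar>x\<bar>\<rceil>}"
  proof
    fix z assume "z \<in> range (\<lambda>l::nat. complex_of_real (x + s * real l)) \<inter> cball 0 r"
    then obtain l where l: "z = of_real (x + s * real l)" and "norm z \<le> r"
      by (auto simp: dist_norm)
    then have "\<bar>x + s * real l\<bar> \<le> r" by (simp only: norm_of_real)
    then have "real l \<le> r + \<bar>x\<bar>" using that by (cases "s \<ge> 0") (auto simp: abs_if split: if_splits)
    then have "l \<le> nat \<lceil>r + \<bar>x\<bar>\<rceil>" by linarith
    then show "z \<in> (\<lambda>l. of_real (x + s * real l)) ` {..nat \<lceil>r + \<bar>x\<bar>\<rceil>}" using l by blast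
  qed
  then show "finite (range (\<lambda>l::nat. complex_of_real (x + s * real l)) \<inter> cball 0 r)"
    by (rule finite_subset) simp
qed auto

lemma real_discrete_left_poles: "real_discrete (left_poles a)"
proof -
  have "real_discrete (\<Union>j\<in>J. range (\<lambda>l::nat. complex_of_real (- (a $ j) + (-1) * real l)))" if "finite J" for J
    using that
  proof (induction J)
    case (insert j J)
    then show ?case
      by (simp only: UN_insert) (intro real_discrete_Un real_discrete_progression, auto)
  qed (simp add: real_discrete_def)
  from this[of UNIV] have "real_discrete (\<Union>j. range (\<lambda>l::nat. complex_of_real (- (a $ j) + (-1) * real l)))"
    by simp
  also have "(\<Union>j. range (\<lambda>l::nat. complex_of_real (- (a $ j) + (-1) * real l))) = left_poles a"
    unfolding left_poles_def by (auto simp: image_iff)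
  finally show ?thesis .
qed

lemma real_discrete_all_poles: "real_discrete (all_poles a)"
  unfolding all_poles_def
  using real_discrete_Un[OF real_discrete_left_poles real_discrete_progression[of 1 0]] by simp

lemma holomorphic_gamma_ratio: "gamma_ratio a b holomorphic_on - left_poles a"
  unfolding gamma_ratio_def
  by (intro holomorphic_intros) (auto simp: in_left_poles_iff)

lemma pochhammer_prod_lessThan: "pochhammer z n = (\<Prod>j<n. z + of_nat j)"
  by (simp add: pochhammer_prod atLeast0LessThan)

lemma pochhammer_nonzero_off_nat:
  fixes u :: complex
  assumes "u \<notin> range of_nat"
  shows "pochhammer (- u) n \<noteq> 0"
  using assms unfolding pochhammer_eq_0_iff by auto

lemma holomorphic_pochhammer: "f holomorphic_on A \<Longrightarrow> (\<lambda>u. pochhammer (f u) n) holomorphic_on A"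
  unfolding pochhammer_prod_lessThan by (intro holomorphic_intros)

lemma holomorphic_mellin_factor:
  assumes "t > 0"
  shows "mellin_factor a b n t holomorphic_on - all_poles a"
  unfolding mellin_factor_def
  by (intro holomorphic_intros holomorphic_pochhammer holomorphic_on_subset[OF holomorphic_gamma_ratio])
     (use assms pochhammer_nonzero_off_nat in \<open>auto simp: all_poles_def\<close>)

lemma gamma_ratio_step:
  assumes "w - 1 \<notin> left_poles a"
  shows "gamma_ratio a b (w - 1) =
     gamma_ratio a b w * (\<Prod>i\<in>UNIV. (of_real (b $ i) + w - 1) / (of_real (a $ i) + w - 1))"
proof -
  have A: "Gamma (of_real (a $ i) + (w - 1)) = Gamma (of_real (a $ i) + w) / (of_real (a $ i) + w - 1)" for i
  proof -
    have n: "of_real (a $ i) + w - 1 \<notin> \<int>\<^sub>\<le>\<^sub>0"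
      using assms unfolding in_left_poles_iff by (simp add: algebra_simps)
    then have "of_real (a $ i) + w - 1 \<noteq> 0" by auto
    then show ?thesis using Gamma_plus1[OF n] by (simp add: field_simps)
  qed
  have B: "rGamma (of_real (b $ i) + (w - 1)) = rGamma (of_real (b $ i) + w) * (of_real (b $ i) + w - 1)" for i
    using rGamma_plus1[of "of_real (b $ i) + w - 1"] by (simp add: algebra_simps)
  show ?thesis unfolding gamma_ratio_def A B
    by (simp add: prod.distrib prod_dividef)
qed

lemma shifted_compact_bound:
  assumes C: "compact C" "\<And>u k. u \<in> C \<Longrightarrow> u - of_nat k \<notin> P" and f: "continuous_on (-P) f"
  obtains B where "B \<ge> 0" "\<And>u k. u \<in> C \<Longrightarrow> k \<le> k0 \<Longrightarrow> norm (f (u - of_nat k :: complex)) \<le> B"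
proof -
  have "compact (\<Union>k\<le>k0. (\<lambda>u. u - of_nat k) ` C)"
    using C(1) by (intro compact_UN compact_continuous_image continuous_intros) auto
  moreover have "continuous_on (\<Union>k\<le>k0. (\<lambda>u. u - of_nat k) ` C) f"
    by (rule continuous_on_subset[OF f]) (use C in auto)
  ultimately have "bounded (f ` (\<Union>k\<le>k0. (\<lambda>u. u - of_nat k) ` C))"
    using compact_continuous_image compact_imp_bounded by blast
  then obtain B where B: "\<forall>x\<in>f ` (\<Union>k\<le>k0. (\<lambda>u. u - of_nat k) ` C). norm x \<le> B"
    unfolding bounded_iff by blast
  show ?thesis
  proof
    show "max B 0 \<ge> 0" by simp
    fix u k assume "u \<in> C" "k \<le> k0"
    then have "f (u - of_nat k) \<in> f ` (\<Union>k\<le>k0. (\<lambda>u. u - of_nat k) ` C)" by blast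
    then have "norm (f (u - of_nat k)) \<le> B" using B by blast
    then show "norm (f (u - of_nat k)) \<le> max B 0" by simp
  qed
qed

text \<open>
One step to the left multiplies the quotient by factors \<open>1 + (b$i - a$i) / (a$i + w - 1)\<close>. After
\<open>k\<close> steps their denominators are comparable to \<open>k\<close>, so the product over all steps grows at most
polynomially. No asymptotics of the Gamma function enters.
\<close>

lemma gamma_ratio_growth:
  fixes a b :: "real ^ 'p"
  obtains D :: nat where "\<And>C. compact C \<Longrightarrow> (\<And>u k. u \<in> C \<Longrightarrow> u - of_nat k \<notin> left_poles a) \<Longrightarrow>
     \<exists>B\<ge>0. \<forall>u\<in>C. \<forall>k. norm (gamma_ratio a b (u - of_nat k)) \<le> B * (real k + 1) ^ D"
proof -
  define \<delta> where "\<delta> = (\<Sum>i\<in>UNIV. \<bar>b $ i - a $ i\<bar>)"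
  define D1 where "D1 = nat \<lceil>2 * \<delta>\<rceil>"
  define D where "D = D1 * CARD('p)"
  have \<delta>: "\<bar>b $ i - a $ i\<bar> \<le> \<delta>" for i
    unfolding \<delta>_def by (rule member_le_sum) auto
  have D1: "2 * \<delta> \<le> real D1" unfolding D1_def by linarith
  have "\<exists>B\<ge>0. \<forall>u\<in>C. \<forall>k. norm (gamma_ratio a b (u - of_nat k)) \<le> B * (real k + 1) ^ D"
    if C: "compact C" "\<And>u k. u \<in> C \<Longrightarrow> u - of_nat k \<notin> left_poles a" for C
  proof -
    obtain R where R: "\<And>u. u \<in> C \<Longrightarrow> norm u \<le> R"
      using compact_imp_bounded[OF C(1)] unfolding bounded_iff by blast
    define k0 where "k0 = nat \<lceil>2 * (\<bar>R\<bar> + (\<Sum>i\<in>UNIV. \<bar>a $ i\<bar>))\<rceil>"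
    have k0: "2 * (\<bar>R\<bar> + \<bar>a $ i\<bar>) \<le> real k0" for i
    proof -
      have "\<bar>a $ i\<bar> \<le> (\<Sum>i\<in>UNIV. \<bar>a $ i\<bar>)" by (rule member_le_sum) auto
      then show ?thesis
        unfolding k0_def by (intro order_trans[OF _ real_nat_ceiling_ge]) simp
    qed
    obtain B where B: "B \<ge> 0" "\<And>u k. u \<in> C \<Longrightarrow> k \<le> k0 \<Longrightarrow> norm (gamma_ratio a b (u - of_nat k)) \<le> B"
      using shifted_compact_bound[OF C holomorphic_on_imp_continuous_on[OF holomorphic_gamma_ratio]] by blast
    have step: "norm (gamma_ratio a b (u - of_nat (Suc k))) \<le>
        norm (gamma_ratio a b (u - of_nat k)) * ((real k + 2) / (real k + 1)) ^ D"
      if u: "u \<in> C" and k: "k \<ge> k0" for u k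
    proof -
      \<comment> \<open>Bernoulli's inequality turns the bound into a power of \<open>(k + 2) / (k + 1)\<close>, which telescopes.\<close>
      have fac: "norm ((of_real (b $ i) + (u - of_nat k) - 1) / (of_real (a $ i) + (u - of_nat k) - 1))
           \<le> ((real k + 2) / (real k + 1)) ^ D1" for i
      proof -
        let ?A = "of_real (a $ i) + (u - of_nat k) - 1 :: complex"
        have "real k + 1 - norm (of_real (a $ i) + u) \<le> norm ?A"
          using norm_triangle_ineq2[of "of_nat (Suc k)" "of_real (a $ i) + u"]
          by (simp add: norm_minus_commute algebra_simps del: of_nat_Suc) (simp add: algebra_simps)
        moreover have "norm (of_real (a $ i) + u) \<le> \<bar>a $ i\<bar> + \<bar>R\<bar>"
          using norm_triangle_ineq[of "of_real (a $ i)" u] R[OF u] by simp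
        ultimately have A: "norm ?A \<ge> (real k + 1) / 2"
          using k0[of i] k by (simp add: field_simps)
        then have A0: "norm ?A > 0" by (smt (verit) divide_pos_pos of_nat_0_le_iff)
        have eq: "of_real (b $ i) + (u - of_nat k) - 1 = ?A + of_real (b $ i - a $ i)" by simp
        have "norm ((of_real (b $ i) + (u - of_nat k) - 1) / ?A) = norm (?A + of_real (b $ i - a $ i)) / norm ?A"
          by (simp only: eq norm_divide)
        also have "\<dots> \<le> (norm ?A + \<bar>b $ i - a $ i\<bar>) / norm ?A"
          by (rule divide_right_mono[OF order_trans[OF norm_triangle_ineq]]) auto
        also have "\<dots> = 1 + \<bar>b $ i - a $ i\<bar> / norm ?A" using A0 by (simp add: field_simps)
        also have "\<bar>b $ i - a $ i\<bar> / norm ?A \<le> (real D1 / 2) / ((real k + 1) / 2)"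
          by (rule frac_le) (use A \<delta>[of i] D1 in auto)
        also have "(real D1 / 2) / ((real k + 1) / 2) = real D1 * (1 / (real k + 1))" by simp
        also have "1 + real D1 * (1 / (real k + 1)) \<le> (1 + 1 / (real k + 1)) ^ D1"
        proof (rule Bernoulli_inequality)
          have "0 \<le> 1 / (real k + 1)" by simp
          then show "-1 \<le> 1 / (real k + 1)" by linarith
        qed
        also have "1 + 1 / (real k + 1) = (real k + 2) / (real k + 1)" by (simp add: field_simps)
        finally show ?thesis by simp
      qed
      have "u - of_nat k - 1 \<notin> left_poles a" using C(2)[OF u, of "Suc k"] by (simp add: algebra_simps)
      from gamma_ratio_step[OF this, of b]
      have "norm (gamma_ratio a b (u - of_nat (Suc k))) = norm (gamma_ratio a b (u - of_nat k)) *
          (\<Prod>i\<in>UNIV. norm ((of_real (b $ i) + (u - of_nat k) - 1) / (of_real (a $ i) + (u - of_nat k) - 1)))"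
        by (simp add: norm_mult prod_norm algebra_simps)
      also have "\<dots> \<le> norm (gamma_ratio a b (u - of_nat k)) * (\<Prod>i\<in>(UNIV::'p set). ((real k + 2) / (real k + 1)) ^ D1)"
        by (intro mult_left_mono prod_mono) (use fac in auto)
      also have "(\<Prod>i\<in>(UNIV::'p set). ((real k + 2) / (real k + 1)) ^ D1) = ((real k + 2) / (real k + 1)) ^ D"
        by (simp add: D_def power_mult)
      finally show ?thesis .
    qed
    have "norm (gamma_ratio a b (u - of_nat k)) \<le> B * (real k + 1) ^ D" if u: "u \<in> C" for u k
    proof (induction k)
      case 0
      then show ?case using B(2)[OF u, of 0] by simp
    next
      case (Suc k)
      show ?case
      proof (cases "Suc k \<le> k0")
        case True
        have "B * 1 \<le> B * (real (Suc k) + 1) ^ D" by (rule mult_left_mono) (use B in auto)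
        then show ?thesis using B(2)[OF u True] by simp
      next
        case False
        then have "norm (gamma_ratio a b (u - of_nat (Suc k))) \<le>
          norm (gamma_ratio a b (u - of_nat k)) * ((real k + 2) / (real k + 1)) ^ D"
          by (intro step u) simp
        also have "\<dots> \<le> B * (real k + 1) ^ D * ((real k + 2) / (real k + 1)) ^ D"
          by (rule mult_right_mono[OF Suc]) simp
        also have "\<dots> = B * (real (Suc k) + 1) ^ D" by (simp add: power_divide add.commute)
        finally show ?thesis .
      qed
    qed
    then show ?thesis using B(1) by blast
  qed
  then show ?thesis using that by blast
qed

text \<open>
From some \<open>k\<close> on, each of the \<open>n\<close> factors has modulus at least \<open>(k + 1) / 2\<close>; the finitely many
remaining translates of \<open>C\<close> form a compact set.
\<close>

lemma inverse_pochhammer_decay: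
  assumes C: "compact C" "\<And>u k. u \<in> C \<Longrightarrow> u - of_nat k \<notin> range of_nat"
  shows "\<exists>B\<ge>0. \<forall>u\<in>C. \<forall>k. norm (1 / pochhammer (- (u - of_nat k)) n :: complex) \<le> B / (real k + 1) ^ n"
proof -
  obtain R where R: "\<And>u. u \<in> C \<Longrightarrow> norm u \<le> R"
    using compact_imp_bounded[OF C(1)] unfolding bounded_iff by blast
  define k0 where "k0 = nat \<lceil>2 * \<bar>R\<bar> + 1\<rceil>"
  have k0: "2 * \<bar>R\<bar> + 1 \<le> real k0" unfolding k0_def by linarith
  have "continuous_on (- range of_nat) (\<lambda>u::complex. 1 / pochhammer (- u) n)"
    by (intro holomorphic_on_imp_continuous_on holomorphic_intros holomorphic_pochhammer)
       (use pochhammer_nonzero_off_nat in auto)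
  then obtain B where B: "B \<ge> 0" "\<And>u k. u \<in> C \<Longrightarrow> k \<le> k0 \<Longrightarrow> norm (1 / pochhammer (- (u - of_nat k)) n :: complex) \<le> B"
    using shifted_compact_bound[OF C] by blast
  have "norm (1 / pochhammer (- (u - of_nat k)) n :: complex) \<le> (B * (real k0 + 1) ^ n + 2 ^ n) / (real k + 1) ^ n"
    if u: "u \<in> C" for u k
  proof (cases "k \<le> k0")
    case True
    have "B * (real k + 1) ^ n \<le> B * (real k0 + 1) ^ n"
      by (intro mult_left_mono power_mono B) (use True in auto)
    then have "B \<le> (B * (real k0 + 1) ^ n + 2 ^ n) / (real k + 1) ^ n"
      by (simp add: le_divide_eq) (smt (verit) zero_le_power)
    then show ?thesis using B(2)[OF u True] by linarith
  next
    case False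
    have "(\<Prod>j<n. (real k + 1) / 2) \<le> (\<Prod>j<n. norm (- (u - of_nat k) + of_nat j))"
    proof (intro prod_mono conjI)
      fix j
      have eq: "of_nat (k + j) - u = - (u - of_nat k) + of_nat j" by simp
      have "real (k + j) - norm u \<le> norm (- (u - of_nat k) + of_nat j)"
        using norm_triangle_ineq2[of "of_nat (k + j)" u] by (simp only: norm_of_nat eq)
      then show "(real k + 1) / 2 \<le> norm (- (u - of_nat k) + of_nat j)"
        using R[OF u] k0 False by simp
    qed auto
    then have le: "((real k + 1) / 2) ^ n \<le> norm (pochhammer (- (u - of_nat k)) n)"
      unfolding pochhammer_prod_lessThan prod_norm[symmetric] by simp
    have pos: "((real k + 1) / 2) ^ n > 0" by simp
    have "norm (1 / pochhammer (- (u - of_nat k)) n) \<le> 1 / ((real k + 1) / 2) ^ n"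
      unfolding norm_divide norm_one using le pos
      by (intro divide_left_mono mult_pos_pos) linarith+
    also have "\<dots> = 2 ^ n / (real k + 1) ^ n" by (simp add: power_divide)
    also have "\<dots> \<le> (B * (real k0 + 1) ^ n + 2 ^ n) / (real k + 1) ^ n"
      by (rule divide_right_mono) (use B in auto)
    finally show ?thesis .
  qed
  moreover have "B * (real k0 + 1) ^ n + 2 ^ n \<ge> 0" using B by simp
  ultimately show ?thesis by blast
qed

text \<open>
The polynomial growth of the Gamma quotient is beaten by the denominator once \<open>n\<close> exceeds its degree
by 2. The power of \<open>t\<close> is bounded on the translates because \<open>t \<le> 1\<close>; the value \<open>t = 1\<close> is
included, which will give the limit of the Meijer function there.
\<close>

theorem decays_left_mellin_factor:
  fixes a b :: "real ^ 'p"
  obtains K where "\<And>n t. n \<ge> K \<Longrightarrow> 0 < t \<Longrightarrow> t \<le> 1 \<Longrightarrow> decays_left (all_poles a) (mellin_factor a b n t)"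
proof -
  obtain D where D: "\<And>C. compact C \<Longrightarrow> (\<And>u k. u \<in> C \<Longrightarrow> u - of_nat k \<notin> left_poles a) \<Longrightarrow>
     \<exists>B\<ge>0. \<forall>u\<in>C. \<forall>k. norm (gamma_ratio a b (u - of_nat k)) \<le> B * (real k + 1) ^ D"
    using gamma_ratio_growth[of a b] by blast
  have "decays_left (all_poles a) (mellin_factor a b n t)" if n: "n \<ge> D + 2" and t: "0 < t" "t \<le> 1" for n t
    unfolding decays_left_def
  proof (intro allI impI, elim conjE)
    fix C assume C: "compact C" "\<forall>u\<in>C. \<forall>k. u - of_nat k \<notin> all_poles a"
    obtain B1 where B1: "B1 \<ge> 0" "\<forall>u\<in>C. \<forall>k. norm (gamma_ratio a b (u - of_nat k)) \<le> B1 * (real k + 1) ^ D"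
      using D[OF C(1)] C(2) unfolding all_poles_def by auto
    obtain B2 where B2: "B2 \<ge> 0" "\<forall>u\<in>C. \<forall>k. norm (1 / pochhammer (- (u - of_nat k)) n) \<le> B2 / (real k + 1) ^ n"
      using inverse_pochhammer_decay[OF C(1), of n] C(2) unfolding all_poles_def by auto
    obtain R where R: "\<And>u. u \<in> C \<Longrightarrow> norm u \<le> R"
      using compact_imp_bounded[OF C(1)] unfolding bounded_iff by blast
    define B where "B = B1 * (t powr (- R)) * B2"
    have "norm (mellin_factor a b n t (u - of_nat k)) \<le> B / (real k + 1) ^ 2" if u: "u \<in> C" for u k
    proof -
      have "norm (complex_of_real t powr (- (u - of_nat k))) = t powr (real k - Re u)"
        using t by (simp add: norm_powr_real_powr)
      also have "\<dots> \<le> t powr (- R)"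
        by (rule powr_mono') (use t R[OF u] abs_Re_le_cmod[of u] in auto)
      finally have T: "norm (complex_of_real t powr (- (u - of_nat k))) \<le> t powr (- R)" .
      have "mellin_factor a b n t (u - of_nat k) = gamma_ratio a b (u - of_nat k) *
          complex_of_real t powr (- (u - of_nat k)) * (1 / pochhammer (- (u - of_nat k)) n)"
        by (simp add: mellin_factor_def)
      then have "norm (mellin_factor a b n t (u - of_nat k)) \<le>
           B1 * (real k + 1) ^ D * (t powr (- R)) * (B2 / (real k + 1) ^ n)"
        unfolding norm_mult using B1 B2 T u
        by (auto simp only: norm_mult intro!: mult_mono mult_nonneg_nonneg) auto
      also have "\<dots> = B * ((real k + 1) ^ D / (real k + 1) ^ n)"
        by (simp add: B_def)
      also have "\<dots> \<le> B * (1 / (real k + 1) ^ 2)"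
      proof (rule mult_left_mono)
        have "(real k + 1) ^ D * (real k + 1) ^ 2 \<le> (real k + 1) ^ n"
          unfolding power_add[symmetric] by (rule power_increasing) (use n in auto)
        then show "(real k + 1) ^ D / (real k + 1) ^ n \<le> 1 / (real k + 1) ^ 2"
          by (simp add: divide_simps)
        show "0 \<le> B" unfolding B_def using B1 B2 by simp
      qed
      finally show ?thesis by simp
    qed
    moreover have "B \<ge> 0" unfolding B_def using B1 B2 by simp
    ultimately show "\<exists>B\<ge>0. \<forall>u\<in>C. \<forall>k. norm (mellin_factor a b n t (u - of_nat k)) \<le> B / (real k + 1) ^ 2" by blast
  qed
  then show ?thesis using that by blast
qed

section \<open>The Meijer function as a limit of sums of residues\<close>

lemma real_discrete_translate:
  assumes "real_discrete P"
  shows "real_discrete ((\<lambda>p. p - of_real d) ` P)"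
  unfolding real_discrete_def
proof (intro conjI ballI allI)
  fix r
  have "(\<lambda>p. p - complex_of_real d) ` P \<inter> cball 0 r \<subseteq> (\<lambda>p. p - of_real d) ` (P \<inter> cball 0 (r + \<bar>d\<bar>))"
  proof
    fix z assume "z \<in> (\<lambda>p. p - complex_of_real d) ` P \<inter> cball 0 r"
    then obtain p where p: "p \<in> P" "z = p - of_real d" "norm (p - of_real d) \<le> r"
      by (auto simp: dist_norm)
    have "norm p \<le> norm (p - of_real d) + norm (complex_of_real d)" using norm_triangle_sub[of p "of_real d"] by simp
    then have "p \<in> P \<inter> cball 0 (r + \<bar>d\<bar>)" using p by simp
    then show "z \<in> (\<lambda>p. p - of_real d) ` (P \<inter> cball 0 (r + \<bar>d\<bar>))" using p by blast
  qed
  then show "finite ((\<lambda>p. p - complex_of_real d) ` P \<inter> cball 0 r)"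
    by (rule finite_subset) (use assms in \<open>simp add: real_discrete_def\<close>)
qed (use assms in \<open>auto simp: real_discrete_def\<close>)

lemma decays_left_translate:
  assumes "decays_left P f"
  shows "decays_left ((\<lambda>p. p - of_real d) ` P) (\<lambda>s. f (s + of_real d))"
  unfolding decays_left_def
proof (intro allI impI, elim conjE)
  fix C assume C: "compact C" "\<forall>u\<in>C. \<forall>k. u - of_nat k \<notin> (\<lambda>p. p - complex_of_real d) ` P"
  obtain B where B: "B \<ge> 0" "\<And>u k. u \<in> (\<lambda>s. s + of_real d) ` C \<Longrightarrow> norm (f (u - of_nat k)) \<le> B / (real k + 1) ^ 2"
  proof (rule decays_leftE[OF assms])
    show "compact ((\<lambda>s. s + complex_of_real d) ` C)"
      by (intro compact_continuous_image continuous_intros C)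
    show "u - of_nat k \<notin> P" if u: "u \<in> (\<lambda>s. s + complex_of_real d) ` C" for u k
    proof
      assume P: "u - of_nat k \<in> P"
      obtain s where s: "s \<in> C" "u = s + of_real d" using u by blast
      have "s - of_nat k \<in> (\<lambda>p. p - complex_of_real d) ` P"
        by (rule image_eqI[OF _ P]) (simp add: s)
      then show False using C(2) s by blast
    qed
  qed blast
  have "norm (f (u - of_nat k + of_real d)) \<le> B / (real k + 1) ^ 2" if "u \<in> C" for u k
    using B(2)[OF imageI[OF that], of k] by (simp add: algebra_simps)
  then show "\<exists>B\<ge>0. \<forall>u\<in>C. \<forall>k. norm (f (u - of_nat k + of_real d)) \<le> B / (real k + 1) ^ 2"
    using B(1) by blast
qed

text \<open>
The loops are given in the variable \<open>s\<close>, while the poles are fixed in the variable \<open>s + d\<close>.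
\<close>

lemma left_loop_integral_residues_translated:
  assumes g: "left_loop g" and L: "(\<lambda>p. p - of_real d) ` L \<subseteq> loop_left g"
    and Q: "(\<lambda>p. p - of_real d) ` Q \<subseteq> loop_right g"
    and P: "real_discrete P" "P = L \<union> Q"
    and unb: "\<And>x. \<exists>p\<in>L. Re p \<le> x"
    and holo: "f holomorphic_on -P" and dec: "decays_left P f"
    and c: "\<And>p k. p \<in> P \<Longrightarrow> Re p \<noteq> c - real k"
  shows "\<exists>w. has_left_loop_integral (\<lambda>s. f (s + of_real d)) w g \<and>
     (\<lambda>k. 2 * pi * \<i> * (\<Sum>p | p \<in> L \<and> Re p > c - real k. residue f p)) \<longlonglongrightarrow> w"
proof -
  let ?h = "\<lambda>p. p - complex_of_real d" and ?f = "\<lambda>s. f (s + of_real d)"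
  have "\<exists>w. has_left_loop_integral ?f w g \<and>
     (\<lambda>k. 2 * pi * \<i> * (\<Sum>p | p \<in> ?h ` L \<and> Re p > c - d - real k. residue ?f p)) \<longlonglongrightarrow> w"
  proof (rule left_loop_integral_residues[OF g L Q real_discrete_translate[OF P(1)]])
    show "?h ` P = ?h ` L \<union> ?h ` Q" using P by blast
    show "\<exists>p\<in>?h ` L. Re p \<le> x" for x using unb[of "x + d"] by force
    have "s + of_real d \<in> - P" if "s \<in> - ?h ` P" for s
      using that imageI[of "s + of_real d" P ?h] by auto
    then show "?f holomorphic_on - ?h ` P"
      by (intro holomorphic_on_compose_gen[OF _ holo, of "\<lambda>s. s + of_real d", unfolded o_def])
         (auto intro!: holomorphic_intros)
    show "decays_left (?h ` P) ?f" by (rule decays_left_translate[OF dec])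
    show "Re p \<noteq> c - d - real k" if "p \<in> ?h ` P" for p k
      using that c[of _ k] by auto
  qed
  moreover have "(\<Sum>p | p \<in> ?h ` L \<and> Re p > c - d - real k. residue ?f p) =
      (\<Sum>p | p \<in> L \<and> Re p > c - real k. residue f p)" for k
  proof (rule sum.reindex_bij_witness[of _ ?h "\<lambda>p. p + of_real d"])
    fix p assume "p \<in> {p. p \<in> ?h ` L \<and> c - d - real k < Re p}"
    show "residue f (p + of_real d) = residue ?f p"
      using residue_shift_0[of f "p + of_real d"] residue_shift_0[of ?f p] by (simp add: add_ac)
  qed auto
  ultimately show ?thesis by simp
qed

lemma has_left_loop_integral_scale:
  assumes f: "has_left_loop_integral f w g" and "left_loop g"
    and eq: "\<And>s R. R > 0 \<Longrightarrow> s \<in> path_image (loop_truncation g R) \<Longrightarrow> h s = \<kappa> * f s"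
  shows "has_left_loop_integral h (\<kappa> * w) g"
  unfolding has_left_loop_integral_def
proof (intro conjI allI impI)
  have i: "(\<lambda>s. \<kappa> * f s) contour_integrable_on loop_truncation g R" if "R > 0" for R
    using f that unfolding has_left_loop_integral_def by (intro contour_integrable_lmul) auto
  show "h contour_integrable_on loop_truncation g R" if "R > 0" for R
    by (rule contour_integrable_eq[OF i[OF that]]) (use eq[OF that] in auto)
  have eqR: "contour_integral (loop_truncation g R) h = \<kappa> * contour_integral (loop_truncation g R) f" if "R > 0" for R
  proof -
    have "contour_integral (loop_truncation g R) h = contour_integral (loop_truncation g R) (\<lambda>s. \<kappa> * f s)"
      by (rule contour_integral_eq) (use eq[OF that] in auto)
    also have "\<dots> = \<kappa> * contour_integral (loop_truncation g R) f"
      using f that unfolding has_left_loop_integral_def by (intro contour_integral_lmul) auto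
    finally show ?thesis .
  qed
  have "((\<lambda>R. \<kappa> * contour_integral (loop_truncation g R) f) \<longlongrightarrow> \<kappa> * w) at_top"
    using f unfolding has_left_loop_integral_def by (intro tendsto_intros) auto
  then show "((\<lambda>R. contour_integral (loop_truncation g R) h) \<longlongrightarrow> \<kappa> * w) at_top"
    by (rule Lim_transform_eventually)
       (rule eventually_mono[OF eventually_gt_at_top[of 0]], simp add: eqR)
qed

lemma Ghat_integrand_eq_mellin_factor:
  assumes t: "t > 0" and n: "n \<ge> 1" and s: "s \<notin> (\<lambda>p. p - of_real (real n - 1)) ` all_poles a"
  shows "Ghat_integrand a b n t s = of_real (t ^ (n - 1)) * mellin_factor a b n t (s + of_real (real n - 1))"
proof -
  define u where "u = s + of_real (real n - 1)"
  have su: "s = u - of_real (real n - 1)" by (simp add: u_def)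
  then have "u \<notin> all_poles a" using s imageI[of u "all_poles a" "\<lambda>p. p - of_real (real n - 1)"] by auto
  then have "u \<notin> range of_nat" by (auto simp: all_poles_def)
  have nn: "- u \<notin> \<int>\<^sub>\<le>\<^sub>0"
  proof
    assume "- u \<in> \<int>\<^sub>\<le>\<^sub>0"
    then obtain k where "- u = - of_nat k" by (auto elim: nonpos_Ints_cases')
    then show False using \<open>u \<notin> range of_nat\<close> by auto
  qed
  have args: "of_real x + of_nat n - 1 + s = of_real x + u" "1 - of_nat n - s = - u" "1 - s = - u + of_nat n" for x
    by (auto simp: su)
  have G: "Gamma (- u) * rGamma (- u + of_nat n) = 1 / pochhammer (- u) n"
    unfolding pochhammer_Gamma[OF nn] by (simp add: rGamma_inverse_Gamma field_simps)
  have ms: "- s = of_nat (n - 1) + (- u)" using n by (simp add: su of_nat_diff)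
  have T: "of_real t powr (- s) = of_real (t ^ (n - 1)) * of_real t powr (- u)"
    unfolding ms powr_add using t by simp
  have "Ghat_integrand a b n t s = gamma_ratio a b u * (Gamma (- u) * rGamma (- u + of_nat n)) * of_real t powr (- s)"
    unfolding Ghat_integrand_def gamma_ratio_def args by (simp only: mult_ac)
  then show ?thesis unfolding G T mellin_factor_def u_def[symmetric] by simp
qed

lemma min_comp_le: "min_comp a \<le> a $ i"
  unfolding min_comp_def by (rule Min_le) auto

lemma min_comp_attained: "\<exists>i. a $ i = min_comp a"
proof -
  have "min_comp a \<in> range (\<lambda>i. a $ i)" unfolding min_comp_def by (rule Min_in) auto
  then show ?thesis by (metis imageE)
qed

lemma Re_left_pole_le:
  assumes "p \<in> left_poles a"
  shows "Re p \<le> - min_comp a"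
proof -
  obtain j l where "p = - of_real (a $ j) - of_nat l" using assms unfolding left_poles_def by blast
  then show ?thesis using min_comp_le[of a j] by simp
qed

text \<open>
The vertical line at \<open>- min_comp a - \<epsilon>\<close> separates the rightmost left pole from the other left poles, and
no pole lies on it or on its translates by integers. \<open>K\<close> is the number of factors of
\<open>pochhammer (- u) n\<close> that are kept together with the Gamma quotient: enough for decay, and enough for the
remaining factors \<open>K + j - u\<close> to have positive real part at the rightmost left pole.
\<close>

locale separated_params =
  fixes a b :: "real ^ 'p" and \<epsilon> :: real and K :: nat
  assumes normal: "normal_params a b" and nonpole: "\<And>i. - (a $ i) \<notin> \<nat>"
    and eps: "0 < \<epsilon>" "\<epsilon> < 1"
    and gap: "\<And>p. p \<in> left_poles a \<Longrightarrow> p \<noteq> - of_real (min_comp a) \<Longrightarrow> Re p < - min_comp a - \<epsilon>"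
    and generic: "\<And>p z. p \<in> all_poles a \<Longrightarrow> Re p \<noteq> - min_comp a - \<epsilon> + of_int z"
    and K: "real K \<ge> 2 - min_comp a" "K \<ge> 1"
    and decay: "\<And>n t. n \<ge> K \<Longrightarrow> 0 < t \<Longrightarrow> t \<le> 1 \<Longrightarrow> decays_left (all_poles a) (mellin_factor a b n t)"
begin

abbreviation \<alpha> where "\<alpha> \<equiv> min_comp a"
definition c where "c = - \<alpha> - \<epsilon>"

lemma generic_c: "p \<in> all_poles a \<Longrightarrow> Re p \<noteq> c - real k" "p \<in> all_poles a \<Longrightarrow> Re p \<noteq> c + 1 - real k"
  using generic[of p "- int k"] generic[of p "1 - int k"] by (auto simp: c_def)

lemma disjoint: "left_poles a \<inter> range of_nat = {}"
proof -
  have False if "- of_real (a $ j) - of_nat l = complex_of_nat k" for j l k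
  proof -
    have "- (a $ j) = real (k + l)" using arg_cong[OF that, of Re] by simp
    then show False using nonpole[of j] by (metis of_nat_in_Nats)
  qed
  then have False if "z \<in> left_poles a" "z \<in> range of_nat" for z
    using that unfolding left_poles_def by blast
  then show ?thesis by blast
qed

lemma main_pole: "- of_real \<alpha> \<in> left_poles a"
proof -
  obtain i where "a $ i = \<alpha>" using min_comp_attained[of a] by blast
  then have "- of_real \<alpha> = - complex_of_real (a $ i) - of_nat 0" by simp
  then show ?thesis unfolding left_poles_def by blast
qed

lemma left_poles_unbounded: "\<exists>p\<in>left_poles a. Re p \<le> x"
proof -
  obtain i where i: "a $ i = \<alpha>" using min_comp_attained[of a] by blast
  have "- complex_of_real (a $ i) - of_nat (nat \<lceil>- \<alpha> - x\<rceil>) \<in> left_poles a"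
    unfolding left_poles_def by blast
  moreover have "Re (- complex_of_real (a $ i) - of_nat (nat \<lceil>- \<alpha> - x\<rceil>)) \<le> x"
    using real_nat_ceiling_ge[of "- \<alpha> - x"] by (simp add: i)
  ultimately show ?thesis by blast
qed

text \<open>
The limit of the partial sums of residues exists because an admissible loop exists, and it is what all
admissible loops compute. Up to the factor \<open>t ^ (n - 1)\<close> this limit is the Meijer function.
\<close>

definition partial :: "(complex \<Rightarrow> complex) \<Rightarrow> nat \<Rightarrow> complex" where
  "partial f k = (\<Sum>p | p \<in> left_poles a \<and> Re p > c - real k. residue f p)"

definition W :: "nat \<Rightarrow> real \<Rightarrow> complex" where
  "W n t = lim (partial (mellin_factor a b n t))"

lemma loop_points:
  assumes "Ghat_loop a n g"
  shows "left_loop g" "(\<lambda>p. p - of_real (real n - 1)) ` left_poles a \<subseteq> loop_left g"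
    "(\<lambda>p. p - of_real (real n - 1)) ` range of_nat \<subseteq> loop_right g"
proof -
  have "- of_real (a $ j) - of_nat l - of_real (real n - 1) = 1 - complex_of_real (a $ j) - of_nat n - of_nat l" for j l
    by simp
  then show "left_loop g" "(\<lambda>p. p - of_real (real n - 1)) ` left_poles a \<subseteq> loop_left g"
    using assms unfolding Ghat_loop_def left_poles_def by (auto simp only:)
  have "of_nat k - of_real (real n - 1) = 1 - complex_of_nat n + of_nat k" for k
    by simp
  then show "(\<lambda>p. p - of_real (real n - 1)) ` range of_nat \<subseteq> loop_right g"
    using assms unfolding Ghat_loop_def by (auto simp only:)
qed

lemma Ghat_loop_exists: "\<exists>g. Ghat_loop a n g"
proof -
  let ?h = "\<lambda>p. p - complex_of_real (real n - 1)"
  have "\<exists>g. left_loop g \<and> ?h ` left_poles a \<subseteq> loop_left g \<and> ?h ` range of_nat \<subseteq> loop_right g"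
  proof (rule left_loop_exists)
    show "real_discrete (?h ` left_poles a)" "real_discrete (?h ` range of_nat)"
      by (rule real_discrete_translate[OF real_discrete_subset[OF real_discrete_all_poles[of a]]],
          simp add: all_poles_def)+
    show "?h ` left_poles a \<inter> ?h ` range of_nat = {}"
      using disjoint by (auto simp: image_iff)
    show "Re p \<le> - \<alpha> - (real n - 1)" if "p \<in> ?h ` left_poles a" for p
      using that Re_left_pole_le by auto
    show "- (real n - 1) \<le> Re p" if "p \<in> ?h ` range of_nat" for p
      using that by auto
  qed
  then obtain g where g: "left_loop g" "?h ` left_poles a \<subseteq> loop_left g" "?h ` range of_nat \<subseteq> loop_right g"
    by blast
  have "1 - of_real (a $ j) - of_nat n - of_nat l \<in> loop_left g" for j l
  proof -
    have "- of_real (a $ j) - of_nat l \<in> left_poles a" unfolding left_poles_def by blast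
    then have "?h (- of_real (a $ j) - of_nat l) \<in> loop_left g" using g(2) by blast
    then show ?thesis by (simp add: algebra_simps)
  qed
  moreover have "1 - of_nat n + of_nat k \<in> loop_right g" for k
  proof -
    have "?h (of_nat k) \<in> loop_right g" using g(3) by blast
    then show ?thesis by (simp add: algebra_simps)
  qed
  ultimately show ?thesis using g(1) unfolding Ghat_loop_def by blast
qed

lemma loop_integral:
  assumes n: "n \<ge> K" and t: "0 < t" "t \<le> 1" and g: "Ghat_loop a n g"
  shows "partial (mellin_factor a b n t) \<longlonglongrightarrow> W n t"
    and "has_left_loop_integral (Ghat_integrand a b n t) (of_real (t ^ (n - 1)) * (2 * pi * \<i> * W n t)) g"
proof -
  note lp = loop_points[OF g]
  obtain w where w: "has_left_loop_integral (\<lambda>s. mellin_factor a b n t (s + of_real (real n - 1))) w g"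
     "(\<lambda>k. 2 * pi * \<i> * partial (mellin_factor a b n t) k) \<longlonglongrightarrow> w"
    using left_loop_integral_residues_translated[OF lp real_discrete_all_poles all_poles_def left_poles_unbounded
      holomorphic_mellin_factor[OF t(1)] decay[OF n t] generic_c(1)]
    unfolding partial_def by blast
  have "(\<lambda>k. (2 * pi * \<i> * partial (mellin_factor a b n t) k) / (2 * pi * \<i>)) \<longlonglongrightarrow> w / (2 * pi * \<i>)"
    by (intro tendsto_intros w) auto
  then have lim: "partial (mellin_factor a b n t) \<longlonglongrightarrow> w / (2 * pi * \<i>)" by simp
  then have W: "W n t = w / (2 * pi * \<i>)" unfolding W_def by (rule limI)
  then show "partial (mellin_factor a b n t) \<longlonglongrightarrow> W n t" using lim by simp
  have "w = 2 * pi * \<i> * W n t" by (simp add: W)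
  moreover have "has_left_loop_integral (Ghat_integrand a b n t) (of_real (t ^ (n - 1)) * w) g"
  proof (rule has_left_loop_integral_scale[OF w(1) lp(1)])
    fix s R assume "(R::real) > 0" "s \<in> path_image (loop_truncation g R)"
    then have "s \<notin> loop_left g \<union> loop_right g"
      using loop_left_right_notin_rays[OF lp(1)] by blast
    then have "s \<notin> (\<lambda>p. p - of_real (real n - 1)) ` all_poles a"
      using lp unfolding all_poles_def by blast
    then show "Ghat_integrand a b n t s = of_real (t ^ (n - 1)) * mellin_factor a b n t (s + of_real (real n - 1))"
      by (rule Ghat_integrand_eq_mellin_factor[OF t(1) order_trans[OF K(2) n]])
  qed
  ultimately show "has_left_loop_integral (Ghat_integrand a b n t) (of_real (t ^ (n - 1)) * (2 * pi * \<i> * W n t)) g"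
    by simp
qed

lemma partial_tendsto:
  assumes "n \<ge> K" "0 < t" "t \<le> 1"
  shows "partial (mellin_factor a b n t) \<longlonglongrightarrow> W n t"
  using loop_integral(1)[OF assms] Ghat_loop_exists by blast

lemma Ghat_eq:
  assumes "n \<ge> K" "0 < t" "t \<le> 1"
  shows "Ghat a b n t = of_real (t ^ (n - 1)) * W n t"
proof -
  let ?w = "of_real (t ^ (n - 1)) * (2 * pi * \<i> * W n t)"
  have "(THE w. \<forall>g. Ghat_loop a n g \<longrightarrow> has_left_loop_integral (Ghat_integrand a b n t) w g) = ?w"
  proof (rule the_equality)
    show "\<forall>g. Ghat_loop a n g \<longrightarrow> has_left_loop_integral (Ghat_integrand a b n t) ?w g"
      using loop_integral(2)[OF assms] by blast
    fix w assume w: "\<forall>g. Ghat_loop a n g \<longrightarrow> has_left_loop_integral (Ghat_integrand a b n t) w g"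
    obtain g where "Ghat_loop a n g" using Ghat_loop_exists by blast
    then have "has_left_loop_integral (Ghat_integrand a b n t) w g"
       "has_left_loop_integral (Ghat_integrand a b n t) ?w g"
      using w loop_integral(2)[OF assms] by auto
    then show "w = ?w" unfolding has_left_loop_integral_def
      using tendsto_unique[OF trivial_limit_at_top_linorder] by blast
  qed
  moreover have "1 / z * (x * (z * y)) = x * y" if "z \<noteq> 0" for x y z :: complex
    using that by simp
  from this[of "2 * of_real pi * \<i>" "of_real (t ^ (n - 1))" "W n t"]
  have "1 / (2 * of_real pi * \<i>) * ?w = of_real (t ^ (n - 1)) * W n t" by simp
  ultimately show ?thesis unfolding Ghat_def by (simp only:)
qed

lemma W_real:
  assumes "n \<ge> K" "0 < t" "t \<le> 1"
  shows "W n t \<in> \<real>"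
proof (rule closed_sequentially[OF closed_complex_Reals _ partial_tendsto[OF assms]])
  fix k
  show "partial (mellin_factor a b n t) k \<in> \<real>"
    unfolding partial_def
  proof (rule sum_in_Reals)
    fix p assume "p \<in> {p. p \<in> left_poles a \<and> c - real k < Re p}"
    then have p: "p \<in> all_poles a" by (auto simp: all_poles_def)
    show "residue (mellin_factor a b n t) p \<in> \<real>"
    proof (rule residue_in_Reals[where S = "- (all_poles a - {p})"])
      show "open (- (all_poles a - {p}))"
        by (rule open_Compl[OF real_discrete_closed[OF real_discrete_subset[OF real_discrete_all_poles]]]) blast
      show "Im p = 0" using p real_discrete_all_poles unfolding real_discrete_def by blast
      show "mellin_factor a b n t holomorphic_on - (all_poles a - {p}) - {p}"
        by (rule holomorphic_on_subset[OF holomorphic_mellin_factor[OF assms(2)]]) auto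
      fix u
      show "mellin_factor a b n t (cnj u) = cnj (mellin_factor a b n t u)"
        unfolding mellin_factor_def gamma_ratio_def pochhammer_prod_lessThan
        using assms by (simp add: cnj_Gamma cnj_rGamma cnj_powr)
    qed (use p in auto)
  qed
qed

end

section \<open>The contribution of the poles other than the rightmost one\<close>

text \<open>
On the segment from 0 to \<open>z\<close> the derivative of the exponential function has modulus at most
\<open>exp (max 0 (Re z))\<close>.
\<close>

lemma norm_exp_minus_one_le: "norm (exp z - 1) \<le> norm z * exp (max 0 (Re z))" for z :: complex
proof -
  have "norm (exp z - exp 0) \<le> exp (max 0 (Re z)) * norm (z - 0)"
  proof (rule field_differentiable_bound[of "closed_segment 0 z"])
    fix x assume "x \<in> closed_segment 0 z"
    then obtain u where u: "x = of_real u * z" "0 \<le> u" "u \<le> 1"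
      by (auto simp: in_segment scaleR_conv_of_real)
    have "u * Re z \<le> max 0 (Re z)"
      using u mult_left_le_one_le[of "Re z" u] mult_nonneg_nonpos[of u "Re z"] by (cases "Re z \<ge> 0") auto
    then show "norm (exp x) \<le> exp (max 0 (Re z))" using u by simp
  qed (auto intro!: derivative_eq_intros)
  then show ?thesis by (simp add: mult.commute)
qed

lemma pochhammer_norm_ge:
  fixes z :: complex
  assumes "0 \<le> x" "x \<le> Re z"
  shows "pochhammer x n \<le> norm (pochhammer z n)"
  unfolding pochhammer_prod_lessThan prod_norm[symmetric]
proof (intro prod_mono conjI)
  fix j
  have "x + real j \<le> Re (z + of_nat j)" using assms by simp
  then show "x + real j \<le> norm (z + of_nat j)" using complex_Re_le_cmod order_trans by blast
qed (use assms in auto)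

text \<open>
Comparison with the harmonic series: \<open>x + j \<le> (x + 1) * (j + 1)\<close>.
\<close>

lemma sum_inverse_at_top:
  assumes "(x::real) > 0"
  shows "filterlim (\<lambda>N. \<Sum>j<N. 1 / (x + real j)) at_top sequentially"
proof (rule filterlim_at_top_mono)
  show "filterlim (\<lambda>N. 1 / (x + 1) * harm N) at_top sequentially"
    by (rule filterlim_tendsto_pos_mult_at_top[OF tendsto_const _ harm_at_top]) (use assms in auto)
  have "1 / (x + 1) * harm N \<le> (\<Sum>j<N. 1 / (x + real j))" for N
  proof -
    have "harm N = (\<Sum>j<N. 1 / (real j + 1))"
      unfolding harm_def by (rule sum.reindex_bij_witness[of _ Suc "\<lambda>k. k - 1"]) (auto simp: inverse_eq_divide add.commute)
    then have "1 / (x + 1) * harm N = (\<Sum>j<N. 1 / (x + 1) * (1 / (real j + 1)))"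
      by (simp only: sum_distrib_left)
    also have "\<dots> \<le> (\<Sum>j<N. 1 / (x + real j))"
    proof (rule sum_mono)
      fix j
      have "x + real j \<le> (x + 1) * (real j + 1)" using assms by (simp add: algebra_simps)
      then have "1 / ((x + 1) * (real j + 1)) \<le> 1 / (x + real j)"
        by (intro divide_left_mono mult_pos_pos) (use assms in auto)
      then show "1 / (x + 1) * (1 / (real j + 1)) \<le> 1 / (x + real j)" by simp
    qed
    finally show ?thesis .
  qed
  then show "\<forall>\<^sub>F N in sequentially. 1 / (x + 1) * harm N \<le> (\<Sum>j<N. 1 / (x + real j))" by simp
qed

text \<open>
Each factor is \<open>1 - \<epsilon> / (x + \<epsilon> + j) \<le> exp (- \<epsilon> / (x + \<epsilon> + j))\<close>, and the sum of the exponents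
diverges.
\<close>

lemma pochhammer_quotient_tendsto_0:
  assumes "(x::real) > 0" "\<epsilon> > 0"
  shows "(\<lambda>N. pochhammer x N / pochhammer (x + \<epsilon>) N) \<longlonglongrightarrow> 0"
proof (rule tendsto_sandwich[OF _ _ tendsto_const])
  show "\<forall>\<^sub>F N in sequentially. 0 \<le> pochhammer x N / pochhammer (x + \<epsilon>) N"
    using assms by (auto intro!: always_eventually divide_nonneg_pos pochhammer_nonneg pochhammer_pos)
  have "pochhammer x N / pochhammer (x + \<epsilon>) N \<le> exp (- \<epsilon> * (\<Sum>j<N. 1 / (x + \<epsilon> + real j)))" for N
  proof -
    have "pochhammer x N / pochhammer (x + \<epsilon>) N = (\<Prod>j<N. (x + real j) / (x + \<epsilon> + real j))"
      by (simp add: pochhammer_prod_lessThan prod_dividef)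
    also have "\<dots> \<le> (\<Prod>j<N. exp (- \<epsilon> * (1 / (x + \<epsilon> + real j))))"
    proof (intro prod_mono conjI)
      fix j
      have "(x + real j) / (x + \<epsilon> + real j) = 1 + (- \<epsilon> * (1 / (x + \<epsilon> + real j)))"
        using assms by (simp add: field_simps)
      then show "(x + real j) / (x + \<epsilon> + real j) \<le> exp (- \<epsilon> * (1 / (x + \<epsilon> + real j)))"
        using exp_ge_add_one_self by metis
    qed (use assms in auto)
    also have "\<dots> = exp (- \<epsilon> * (\<Sum>j<N. 1 / (x + \<epsilon> + real j)))"
      by (simp only: exp_sum[symmetric] finite_lessThan sum_distrib_left)
    finally show ?thesis .
  qed
  then show "\<forall>\<^sub>F N in sequentially. pochhammer x N / pochhammer (x + \<epsilon>) N \<le> exp (- \<epsilon> * (\<Sum>j<N. 1 / (x + \<epsilon> + real j)))"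
    by simp
  have "filterlim (\<lambda>N. \<epsilon> * (\<Sum>j<N. 1 / (x + \<epsilon> + real j))) at_top sequentially"
    by (rule filterlim_tendsto_pos_mult_at_top[OF tendsto_const]) (use assms sum_inverse_at_top[of "x + \<epsilon>"] in auto)
  then have "filterlim (\<lambda>N. - (\<epsilon> * (\<Sum>j<N. 1 / (x + \<epsilon> + real j)))) at_bot sequentially"
    by (simp add: filterlim_uminus_at_bot)
  from filterlim_compose[OF exp_at_bot this]
  show "(\<lambda>N. exp (- \<epsilon> * (\<Sum>j<N. 1 / (x + \<epsilon> + real j)))) \<longlonglongrightarrow> 0" by simp
qed

context separated_params
begin

text \<open>
Splitting off the first \<open>K\<close> factors of the Pochhammer symbol leaves a function that does not depend
on \<open>n\<close> and \<open>t\<close> and still decays to the left (the argument 1 of \<open>base\<close> removes the power of \<open>t\<close>), times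
this multiplier, whose modulus on a half-plane
\<open>Re u \<le> x\<close> is largest at the real point \<open>x\<close>.
\<close>

definition multiplier :: "nat \<Rightarrow> real \<Rightarrow> complex \<Rightarrow> complex" where
  "multiplier n t u = of_real t powr (- u) / pochhammer (- u + of_nat K) (n - K)"

abbreviation base where "base \<equiv> mellin_factor a b K 1"

lemma mellin_factor_split:
  assumes "n \<ge> K"
  shows "mellin_factor a b n t = (\<lambda>u. base u * multiplier n t u)"
  unfolding mellin_factor_def multiplier_def
  by (simp add: pochhammer_product[OF assms] fun_eq_iff)

lemma holomorphic_multiplier:
  assumes "t > 0"
  shows "multiplier n t holomorphic_on - all_poles a"
proof -
  have "pochhammer (- u + of_nat K) m \<noteq> 0" if "u \<notin> range of_nat" for u :: complex and m
  proof
    assume "pochhammer (- u + of_nat K) m = 0"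
    then obtain k where "- u + of_nat K = - of_nat k" unfolding pochhammer_eq_0_iff by blast
    then have "u = of_nat (K + k)" by (simp add: algebra_simps)
    then show False using that by blast
  qed
  then show ?thesis unfolding multiplier_def
    by (intro holomorphic_intros holomorphic_pochhammer) (use assms in \<open>auto simp: all_poles_def\<close>)
qed

lemma multiplier_bound:
  assumes t: "0 < t" "t \<le> 1" and x: "Re u \<le> x" "x < real K"
  shows "norm (multiplier n t u) \<le> t powr (- x) / pochhammer (real K - x) (n - K)"
proof -
  have "norm (multiplier n t u) = t powr (- Re u) / norm (pochhammer (- u + of_nat K) (n - K))"
    using t by (simp add: multiplier_def norm_divide norm_powr_real_powr)
  also have "\<dots> \<le> t powr (- x) / pochhammer (real K - x) (n - K)"
  proof (rule frac_le)
    show "t powr (- Re u) \<le> t powr (- x)" by (rule powr_mono') (use t x in auto)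
    show "0 < pochhammer (real K - x) (n - K)" by (rule pochhammer_pos) (use x in auto)
    show "pochhammer (real K - x) (n - K) \<le> norm (pochhammer (- u + of_nat K) (n - K))"
      by (rule pochhammer_norm_ge) (use x in auto)
  qed auto
  finally show ?thesis .
qed

lemma c_less_K: "c < real K" "c + 1 < real K"
  using K eps by (auto simp: c_def)

lemma finite_left_strip: "finite {p \<in> left_poles a. x < Re p \<and> Re p < y}"
  by (rule real_discrete_finite_strip[OF real_discrete_left_poles])

lemma partial_split:
  "partial f k = residue f (- of_real \<alpha>) +
     (\<Sum>p | p \<in> left_poles a \<and> c - real k < Re p \<and> Re p < c. residue f p)"
proof -
  have "{p. p \<in> left_poles a \<and> Re p > c - real k} =
      insert (- of_real \<alpha>) {p. p \<in> left_poles a \<and> c - real k < Re p \<and> Re p < c}"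
    using main_pole gap eps unfolding c_def by (auto intro: less_trans)
  moreover have "- of_real \<alpha> \<notin> {p. p \<in> left_poles a \<and> c - real k < Re p \<and> Re p < c}"
    using eps by (auto simp: c_def)
  ultimately show ?thesis unfolding partial_def using finite_left_strip by simp
qed

lemma partial_alt:
  "partial f k = (\<Sum>p | p \<in> left_poles a \<and> c + 1 - real (Suc k) < Re p \<and> Re p < c + 1. residue f p)"
  unfolding partial_def by (rule sum.cong) (use Re_left_pole_le eps in \<open>force simp: c_def\<close>)+

lemma nat_poles_nonneg: "q \<in> range complex_of_nat \<Longrightarrow> Re q \<ge> 0"
  by auto

text \<open>
All left poles other than the rightmost one lie to the left of \<open>c\<close>, where the multiplier is at most
its value at \<open>c\<close>.
\<close>

lemma W_minus_main_residue:
  obtains M where "M \<ge> 0" "\<And>n t. n \<ge> K \<Longrightarrow> 0 < t \<Longrightarrow> t \<le> 1 \<Longrightarrow>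
     norm (W n t - residue (mellin_factor a b n t) (- of_real \<alpha>))
       \<le> M * (t powr (- c) / pochhammer (real K - c) (n - K))"
proof -
  obtain M where M: "M \<ge> 0" "\<And>m \<mu> k. m holomorphic_on - all_poles a \<Longrightarrow>
     (\<And>u. Re u \<le> c \<Longrightarrow> u \<notin> all_poles a \<Longrightarrow> norm (m u) \<le> \<mu>) \<Longrightarrow> c - real k < 0 \<Longrightarrow>
     norm (\<Sum>p | p \<in> left_poles a \<and> c - real k < Re p \<and> Re p < c. residue (\<lambda>u. base u * m u) p) \<le> M * \<mu>"
    by (rule multiplier_residue_sum_bound[OF real_discrete_all_poles all_poles_def disjoint
          holomorphic_mellin_factor[of 1] decay[of K 1] generic_c(1) nat_poles_nonneg]) auto
  have "norm (W n t - residue (mellin_factor a b n t) (- of_real \<alpha>))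
       \<le> M * (t powr (- c) / pochhammer (real K - c) (n - K))" (is "_ \<le> M * ?\<mu>")
    if n: "n \<ge> K" and t: "0 < t" "t \<le> 1" for n t
  proof (rule Lim_norm_ubound[OF sequentially_bot])
    let ?f = "mellin_factor a b n t"
    show "(\<lambda>k. partial ?f k - residue ?f (- of_real \<alpha>)) \<longlonglongrightarrow> W n t - residue ?f (- of_real \<alpha>)"
      by (intro tendsto_intros partial_tendsto n t)
    have "\<forall>\<^sub>F k in sequentially. c < real k"
      using filterlim_real_sequentially by (auto simp: filterlim_at_top_dense)
    then show "\<forall>\<^sub>F k in sequentially. norm (partial ?f k - residue ?f (- of_real \<alpha>)) \<le> M * ?\<mu>"
    proof eventually_elim
      case (elim k)
      have "norm (\<Sum>p | p \<in> left_poles a \<and> c - real k < Re p \<and> Re p < c. residue ?f p) \<le> M * ?\<mu>"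
        unfolding mellin_factor_split[OF n]
        by (rule M(2)[OF holomorphic_multiplier[OF t(1)]]) (use multiplier_bound[OF t _ c_less_K(1)] elim in auto)
      then show ?case unfolding partial_split by simp
    qed
  qed
  then show ?thesis using that M(1) by blast
qed

text \<open>
The difference \<open>t powr (- u) - 1\<close> is of order \<open>\<bar>u\<bar> * \<bar>ln t\<bar>\<close> and thus not bounded on the half-plane; one
factor of the Pochhammer symbol, of size \<open>\<bar>K - u\<bar>\<close>, compensates the growth in \<open>u\<close>.
\<close>

lemma multiplier_diff_bound:
  assumes n: "n \<ge> K + 1" and t: "1/2 \<le> t" "t \<le> 1" and u: "Re u \<le> c + 1"
  shows "norm (multiplier n t u - multiplier n 1 u) \<le>
     (1 + real K / (real K - (c + 1))) * exp \<bar>c + 1\<bar> * \<bar>ln t\<bar>"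
proof -
  define z where "z = of_nat K - u"
  have Kc: "real K - (c + 1) > 0" using c_less_K by simp
  have z: "norm z \<ge> real K - (c + 1)"
    using complex_Re_le_cmod[of z] u by (simp add: z_def)
  have lnt: "ln t \<le> 0" using t by simp
  have "ln (1/2) \<le> ln t" using t by simp
  moreover have "ln (1/2::real) \<ge> -1" using ln_2_less_1 by (simp add: ln_div)
  ultimately have lnt1: "- ln t \<le> 1" by simp
  have "of_real t powr (- u) = exp (- u * of_real (ln t))"
    using t by (simp add: powr_def Ln_of_real)
  then have "norm (of_real t powr (- u) - 1) \<le> norm (- u * of_real (ln t)) * exp (max 0 (Re (- u * of_real (ln t))))"
    by (simp only: norm_exp_minus_one_le)
  also have "\<dots> \<le> norm u * \<bar>ln t\<bar> * exp \<bar>c + 1\<bar>"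
  proof (intro mult_mono)
    have "Re u * (- ln t) \<le> \<bar>c + 1\<bar>"
    proof (cases "Re u \<ge> 0")
      case True
      have "Re u * (- ln t) \<le> \<bar>c + 1\<bar> * 1" by (rule mult_mono) (use True u lnt lnt1 in auto)
      then show ?thesis by simp
    next
      case False
      then have "Re u * (- ln t) \<le> 0" using lnt by (intro mult_nonpos_nonneg) auto
      then show ?thesis by linarith
    qed
    then show "exp (max 0 (Re (- u * of_real (ln t)))) \<le> exp \<bar>c + 1\<bar>" by simp
  qed (auto simp: norm_mult)
  finally have 1: "norm (of_real t powr (- u) - 1) \<le> norm u * \<bar>ln t\<bar> * exp \<bar>c + 1\<bar>" .
  obtain m where m: "n - K = Suc m" using n by (metis Suc_diff_Suc Suc_eq_plus1 Suc_le_lessD diff_Suc_1)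
  have "pochhammer 1 m \<le> norm (pochhammer (z + 1) m)"
    by (rule pochhammer_norm_ge) (use u Kc in \<open>auto simp: z_def\<close>)
  moreover have "pochhammer (1::real) m \<ge> 1" unfolding pochhammer_fact[symmetric] by (rule fact_ge_1)
  ultimately have "1 \<le> norm (pochhammer (z + 1) m)" by linarith
  then have 2: "norm z \<le> norm (pochhammer z (n - K))"
    unfolding m pochhammer_rec norm_mult by (simp add: mult_left_le mult_le_cancel_left1)
  have "norm u \<le> norm z + real K"
    using norm_triangle_ineq4[of "of_nat K" z] by (simp add: z_def)
  also have "real K = real K / (real K - (c + 1)) * (real K - (c + 1))" using Kc by simp
  also have "\<dots> \<le> real K / (real K - (c + 1)) * norm z"
    by (rule mult_left_mono[OF z]) (use Kc in simp)
  finally have 3: "norm u \<le> (1 + real K / (real K - (c + 1))) * norm z" by (simp add: distrib_right)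
  have "multiplier n t u - multiplier n 1 u = (of_real t powr (- u) - 1) / pochhammer z (n - K)"
    by (simp add: multiplier_def z_def diff_divide_distrib)
  then have "norm (multiplier n t u - multiplier n 1 u) = norm (of_real t powr (- u) - 1) / norm (pochhammer z (n - K))"
    by (simp add: norm_divide)
  also have "\<dots> \<le> (norm u * \<bar>ln t\<bar> * exp \<bar>c + 1\<bar>) / norm z"
    by (rule frac_le[OF _ 1 _ 2]) (use z Kc in auto)
  also have "\<dots> \<le> ((1 + real K / (real K - (c + 1))) * norm z * \<bar>ln t\<bar> * exp \<bar>c + 1\<bar>) / norm z"
    by (intro divide_right_mono mult_right_mono 3) auto
  also have "\<dots> = (1 + real K / (real K - (c + 1))) * exp \<bar>c + 1\<bar> * \<bar>ln t\<bar>"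
  proof -
    have "norm z \<noteq> 0" using z Kc by linarith
    then show ?thesis by simp
  qed
  finally show ?thesis .
qed

text \<open>
Now the bounding line is taken at \<open>c + 1\<close>, to the right of all left poles, so that the bound covers
the complete sum of residues of the difference.
\<close>

lemma W_Lipschitz_at_1:
  assumes n: "n \<ge> K + 1"
  obtains C where "\<And>t. 1/2 \<le> t \<Longrightarrow> t \<le> 1 \<Longrightarrow> norm (W n t - W n 1) \<le> C * \<bar>ln t\<bar>"
proof -
  have nK: "n \<ge> K" using n by simp
  obtain M where M: "M \<ge> 0" "\<And>m \<mu> k. m holomorphic_on - all_poles a \<Longrightarrow>
     (\<And>u. Re u \<le> c + 1 \<Longrightarrow> u \<notin> all_poles a \<Longrightarrow> norm (m u) \<le> \<mu>) \<Longrightarrow> c + 1 - real k < 0 \<Longrightarrow>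
     norm (\<Sum>p | p \<in> left_poles a \<and> c + 1 - real k < Re p \<and> Re p < c + 1. residue (\<lambda>u. base u * m u) p) \<le> M * \<mu>"
    by (rule multiplier_residue_sum_bound[OF real_discrete_all_poles all_poles_def disjoint
          holomorphic_mellin_factor[of 1] decay[of K 1] generic_c(2) nat_poles_nonneg]) auto
  let ?C = "(1 + real K / (real K - (c + 1))) * exp \<bar>c + 1\<bar>"
  have "norm (W n t - W n 1) \<le> M * (?C * \<bar>ln t\<bar>)" if t: "1/2 \<le> t" "t \<le> 1" for t
  proof (rule Lim_norm_ubound[OF sequentially_bot])
    have t0: "t > 0" using t by simp
    let ?f = "mellin_factor a b n t" and ?g = "mellin_factor a b n 1"
    show "(\<lambda>k. partial ?f k - partial ?g k) \<longlonglongrightarrow> W n t - W n 1"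
      by (intro tendsto_intros partial_tendsto nK t t0) auto
    have "\<forall>\<^sub>F k in sequentially. c < real k"
      using filterlim_real_sequentially by (auto simp: filterlim_at_top_dense)
    then show "\<forall>\<^sub>F k in sequentially. norm (partial ?f k - partial ?g k) \<le> M * (?C * \<bar>ln t\<bar>)"
    proof eventually_elim
      case (elim k)
      have "partial ?f k - partial ?g k =
          (\<Sum>p | p \<in> left_poles a \<and> c + 1 - real (Suc k) < Re p \<and> Re p < c + 1. residue ?f p - residue ?g p)"
        unfolding partial_alt by (rule sum_subtractf[symmetric])
      also have "\<dots> = (\<Sum>p | p \<in> left_poles a \<and> c + 1 - real (Suc k) < Re p \<and> Re p < c + 1.
          residue (\<lambda>u. base u * (multiplier n t u - multiplier n 1 u)) p)"
      proof (rule sum.cong[OF refl])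
        fix p assume "p \<in> {p. p \<in> left_poles a \<and> c + 1 - real (Suc k) < Re p \<and> Re p < c + 1}"
        then have p: "p \<in> all_poles a" by (auto simp: all_poles_def)
        have "residue (\<lambda>u. ?f u - ?g u) p = residue ?f p - residue ?g p"
        proof (rule residue_diff)
          show "open (- (all_poles a - {p}))"
            by (rule open_Compl[OF real_discrete_closed[OF real_discrete_subset[OF real_discrete_all_poles]]]) blast
          have sub: "- (all_poles a - {p}) - {p} \<subseteq> - all_poles a" by blast
          show "?f holomorphic_on - (all_poles a - {p}) - {p}" "?g holomorphic_on - (all_poles a - {p}) - {p}"
            using holomorphic_on_subset[OF holomorphic_mellin_factor sub] t0 by auto
        qed simp
        then show "residue ?f p - residue ?g p = residue (\<lambda>u. base u * (multiplier n t u - multiplier n 1 u)) p"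
          by (simp add: mellin_factor_split[OF nK] right_diff_distrib)
      qed
      also have "norm \<dots> \<le> M * (?C * \<bar>ln t\<bar>)"
      proof (rule M(2))
        show "(\<lambda>u. multiplier n t u - multiplier n 1 u) holomorphic_on - all_poles a"
          by (intro holomorphic_intros holomorphic_multiplier t0) simp
        show "norm (multiplier n t u - multiplier n 1 u) \<le> ?C * \<bar>ln t\<bar>" if "Re u \<le> c + 1" for u
          using multiplier_diff_bound[OF n t that] .
      qed (use elim in simp)
      finally show ?case .
    qed
  qed
  then show ?thesis using that[of "M * ?C"] by (simp add: mult.assoc)
qed

lemma W_tendsto_1:
  assumes n: "n \<ge> K + 1"
  shows "((\<lambda>t. W n t) \<longlongrightarrow> W n 1) (at_left 1)"
proof -
  obtain C where C: "\<And>t. 1/2 \<le> t \<Longrightarrow> t \<le> 1 \<Longrightarrow> norm (W n t - W n 1) \<le> C * \<bar>ln t\<bar>"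
    using W_Lipschitz_at_1[OF n] by blast
  have "((\<lambda>t. W n t - W n 1) \<longlongrightarrow> 0) (at_left 1)"
  proof (rule Lim_null_comparison)
    have "((\<lambda>t::real. C * \<bar>ln t\<bar>) \<longlongrightarrow> C * \<bar>ln 1\<bar>) (at_left 1)"
      by (intro tendsto_intros) auto
    then show "((\<lambda>t::real. C * \<bar>ln t\<bar>) \<longlongrightarrow> 0) (at_left 1)" by simp
    have "\<forall>\<^sub>F t in at_left (1::real). t \<in> {1/2<..<1}"
      by (rule eventually_at_leftI[of "1/2"]) auto
    then show "\<forall>\<^sub>F t in at_left 1. norm (W n t - W n 1) \<le> C * \<bar>ln t\<bar>"
      by eventually_elim (use C in auto)
  qed
  then show ?thesis by (simp add: LIM_zero_iff)
qed

end

section \<open>The residue at the rightmost left pole\<close>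

context separated_params
begin

definition shift :: real where "shift = \<alpha> + real K"

lemma shift_pos: "shift > 0" using K by (simp add: shift_def)

lemma pochhammer_min_nonzero: "pochhammer \<alpha> n \<noteq> 0"
proof
  assume "pochhammer \<alpha> n = 0"
  then obtain k where "\<alpha> = - real k" unfolding pochhammer_eq_0_iff by blast
  moreover obtain i where "a $ i = \<alpha>" using min_comp_attained[of a] by blast
  ultimately have "- (a $ i) = real k" by simp
  then show False using nonpole[of i] by (metis of_nat_in_Nats)
qed

definition mult_order :: nat where "mult_order = card {i. a $ i = \<alpha>}"

lemma mult_order_pos: "mult_order > 0"
  unfolding mult_order_def card_gt_0_iff using min_comp_attained[of a] by auto

text \<open>
With \<open>u = - \<alpha> + v\<close>, the function \<open>regular_part v / v ^ mult_order\<close> is the part of the integrand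
that depends on neither \<open>n\<close> nor \<open>t\<close>: each Gamma factor with \<open>a$i = \<alpha>\<close> has been written as
\<open>Gamma (1 + v) / v\<close>.
\<close>

definition regular_part :: "complex \<Rightarrow> complex" where
  "regular_part v =
     (\<Prod>i\<in>UNIV. if a $ i = \<alpha> then Gamma (1 + v) else Gamma (of_real (a $ i - \<alpha>) + v)) *
     (\<Prod>i\<in>UNIV. rGamma (of_real (b $ i - \<alpha>) + v)) / pochhammer (of_real \<alpha> - v) K"

definition lead :: real where
  "lead = (\<Prod>i\<in>UNIV. if a $ i = \<alpha> then 1 else Gamma (a $ i - \<alpha>)) *
     (\<Prod>i\<in>UNIV. rGamma (b $ i - \<alpha>)) / pochhammer \<alpha> K"

lemma regular_part_0: "regular_part 0 = of_real lead"
proof -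
  have "(if a $ i = \<alpha> then Gamma (1 + 0) else Gamma (of_real (a $ i - \<alpha>) + 0)) =
      complex_of_real (if a $ i = \<alpha> then 1 else Gamma (a $ i - \<alpha>))" for i
    by (simp only: add_0_right Gamma_complex_of_real Gamma_1 of_real_1 split: if_split) simp
  then show ?thesis
    unfolding regular_part_def lead_def of_real_mult of_real_divide of_real_prod
    by (simp only: add_0_right rGamma_complex_of_real diff_zero pochhammer_of_real)
qed

lemma analytic_regular_part: "regular_part analytic_on {0}"
proof -
  have G: "(\<lambda>v. if a $ i = \<alpha> then Gamma (1 + v) else Gamma (of_real (a $ i - \<alpha>) + v)) analytic_on {0}" for i
  proof (cases "a $ i = \<alpha>")
    case True
    have "(\<lambda>v. Gamma (1 + v)) analytic_on {0::complex}"
      by (intro analytic_on_Gamma' analytic_intros) auto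
    then show ?thesis using True by simp
  next
    case False
    then have "a $ i - \<alpha> > 0" using min_comp_le[of a i] by simp
    then have "complex_of_real (a $ i - \<alpha>) \<notin> \<int>\<^sub>\<le>\<^sub>0"
      by (metis Re_complex_of_real nonpos_Ints_nonpos of_real_in_nonpos_Ints_iff not_le)
    then have "(\<lambda>v. Gamma (of_real (a $ i - \<alpha>) + v)) analytic_on {0::complex}"
      by (intro analytic_on_Gamma' analytic_intros) auto
    then show ?thesis using False by simp
  qed
  have R: "(\<lambda>v. rGamma (of_real (b $ i - \<alpha>) + v)) analytic_on {0::complex}" for i
    by (intro analytic_on_rGamma analytic_intros)
  have "pochhammer (complex_of_real \<alpha>) K \<noteq> 0"
    unfolding pochhammer_of_real using pochhammer_min_nonzero by simp
  then show ?thesis unfolding regular_part_def pochhammer_prod_lessThan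
    by (intro analytic_intros G R) auto
qed

text \<open>
The value at the rightmost left pole of the part of the integrand that depends on \<open>n\<close> and \<open>t\<close>; it is
the order of magnitude of the Meijer function as \<open>n\<close> grows.
\<close>

definition amplitude :: "nat \<Rightarrow> real \<Rightarrow> real" where
  "amplitude n t = t powr \<alpha> / pochhammer shift (n - K)"

lemma amplitude_pos: "t > 0 \<Longrightarrow> amplitude n t > 0"
  unfolding amplitude_def by (intro divide_pos_pos pochhammer_pos shift_pos) simp

lemma mellin_factor_near_main_pole:
  assumes n: "n \<ge> K" and t: "t > 0" and v: "v \<noteq> 0" "norm v < 1"
  shows "mellin_factor a b n t (- of_real \<alpha> + v) = of_real (amplitude n t) *
     (regular_part v * (exp (of_real (- ln t) * v) * (\<Prod>j<n - K. 1 / (1 - v / of_real (shift + real j)))) / v ^ mult_order)"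
proof -
  have "v \<notin> \<int>\<^sub>\<le>\<^sub>0"
  proof
    assume "v \<in> \<int>\<^sub>\<le>\<^sub>0"
    then obtain k where k: "v = - of_nat k" by (auto elim: nonpos_Ints_cases')
    then have "norm v = real k" by (simp only: norm_minus_cancel norm_of_nat)
    then show False using v k by simp
  qed
  then have Gv: "Gamma v = Gamma (1 + v) / v" using Gamma_plus1[of v] v by (simp add: add.commute)
  have "Gamma (of_real (a $ i) + (- of_real \<alpha> + v)) =
     (if a $ i = \<alpha> then Gamma (1 + v) else Gamma (of_real (a $ i - \<alpha>) + v)) * (if a $ i = \<alpha> then 1 / v else 1)" for i
    using Gv by (simp add: algebra_simps)
  then have "(\<Prod>i\<in>UNIV. Gamma (of_real (a $ i) + (- of_real \<alpha> + v))) =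
     (\<Prod>i\<in>UNIV. if a $ i = \<alpha> then Gamma (1 + v) else Gamma (of_real (a $ i - \<alpha>) + v)) * (\<Prod>i\<in>UNIV. if a $ i = \<alpha> then 1 / v else 1)"
    by (simp only: prod.distrib)
  also have "(\<Prod>i\<in>UNIV. if a $ i = \<alpha> then 1 / v else 1) = 1 / v ^ mult_order"
    by (simp add: prod.If_cases mult_order_def power_one_over)
  finally have A: "(\<Prod>i\<in>UNIV. Gamma (of_real (a $ i) + (- of_real \<alpha> + v))) =
     (\<Prod>i\<in>UNIV. if a $ i = \<alpha> then Gamma (1 + v) else Gamma (of_real (a $ i - \<alpha>) + v)) / v ^ mult_order" by simp
  have B: "(\<Prod>i\<in>UNIV. rGamma (of_real (b $ i) + (- of_real \<alpha> + v))) = (\<Prod>i\<in>UNIV. rGamma (of_real (b $ i - \<alpha>) + v))"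
    by (simp add: algebra_simps)
  have neg: "- (- of_real \<alpha> + v) = of_real \<alpha> + (- v)" by simp
  have T: "of_real t powr (- (- of_real \<alpha> + v)) = of_real (t powr \<alpha>) * exp (of_real (- ln t) * v)"
  proof -
    have "of_real t powr (of_real \<alpha> :: complex) = of_real (t powr \<alpha>)"
      using t by (intro powr_of_real) simp
    moreover have "of_real t powr (- v) = exp (of_real (- ln t) * v)"
      using t by (simp add: powr_def Ln_of_real mult.commute)
    ultimately show ?thesis unfolding neg powr_add by (simp only:)
  qed
  have "pochhammer (of_real \<alpha> - v + of_nat K) (n - K) =
      (\<Prod>j<n - K. of_real (shift + real j) * (1 - v / of_real (shift + real j)))"
    unfolding pochhammer_prod_lessThan
  proof (rule prod.cong[OF refl])
    fix j
    have "complex_of_real (shift + real j) \<noteq> 0" using shift_pos by (metis of_real_eq_0_iff add_pos_nonneg less_irrefl of_nat_0_le_iff)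
    then have "of_real (shift + real j) * (1 - v / of_real (shift + real j)) = of_real (shift + real j) - v"
      by (simp add: right_diff_distrib)
    then show "of_real \<alpha> - v + of_nat K + of_nat j = of_real (shift + real j) * (1 - v / of_real (shift + real j))"
      by (simp add: shift_def)
  qed
  also have "\<dots> = of_real (pochhammer shift (n - K)) * (\<Prod>j<n - K. 1 - v / of_real (shift + real j))"
    by (simp add: prod.distrib pochhammer_prod_lessThan)
  finally have P: "pochhammer (- (- of_real \<alpha> + v)) n = pochhammer (of_real \<alpha> - v) K *
      (of_real (pochhammer shift (n - K)) * (\<Prod>j<n - K. 1 - v / of_real (shift + real j)))"
    using pochhammer_product[OF n, of "of_real \<alpha> - v"] by simp
  have I: "(\<Prod>j<n - K. 1 / (1 - v / of_real (shift + real j))) = 1 / (\<Prod>j<n - K. 1 - v / of_real (shift + real j))"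
    by (simp only: prod_dividef prod.neutral_const)
  show ?thesis
    unfolding mellin_factor_def gamma_ratio_def A B T P regular_part_def amplitude_def I
    by (simp add: mult_ac)
qed

lemma main_residue:
  assumes n: "n \<ge> K" and t: "t > 0"
  shows "residue (mellin_factor a b n t) (- of_real \<alpha>) = of_real (amplitude n t) *
     residue (\<lambda>v. regular_part v * (exp (of_real (- ln t) * v) *
        (\<Prod>j<n - K. 1 / (1 - v / of_real (shift + real j)))) / v ^ mult_order) 0"
    (is "_ = ?\<kappa> * residue ?h 0")
proof -
  let ?f = "mellin_factor a b n t" and ?p = "- complex_of_real \<alpha>"
  have k0: "?\<kappa> \<noteq> 0" using amplitude_pos[OF t, of n] by simp
  have "residue (\<lambda>u. ?f u / ?\<kappa>) ?p = residue ?f ?p / ?\<kappa>"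
  proof (rule residue_div)
    show "open (- (all_poles a - {?p}))"
      by (rule open_Compl[OF real_discrete_closed[OF real_discrete_subset[OF real_discrete_all_poles]]]) blast
    show "?f holomorphic_on - (all_poles a - {?p}) - {?p}"
      by (rule holomorphic_on_subset[OF holomorphic_mellin_factor[OF t]]) blast
  qed simp
  moreover have "residue (\<lambda>u. ?f u / ?\<kappa>) ?p = residue (\<lambda>v. ?f (?p + v) / ?\<kappa>) 0"
    by (rule residue_shift_0)
  moreover have "residue (\<lambda>v. ?f (?p + v) / ?\<kappa>) 0 = residue ?h 0"
  proof (rule residue_cong)
    have "\<forall>\<^sub>F v in at 0. v \<in> ball 0 1 - {0::complex}"
      by (rule eventually_at_in_open) auto
    then show "\<forall>\<^sub>F v in at 0. ?f (?p + v) / ?\<kappa> = ?h v"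
    proof eventually_elim
      case (elim v)
      then have "?f (?p + v) = ?\<kappa> * ?h v"
        by (intro mellin_factor_near_main_pole n t) auto
      then show ?case using k0 by simp
    qed
  qed simp
  ultimately show ?thesis using k0 by (simp add: field_simps)
qed

lemma Gamma_diff_nonzero: "Gamma (b $ i - \<alpha>) \<noteq> 0"
proof -
  obtain j where j: "a $ j = \<alpha>" using min_comp_attained[of a] by blast
  have "b $ i - \<alpha> \<notin> \<int>\<^sub>\<le>\<^sub>0"
  proof
    assume "b $ i - \<alpha> \<in> \<int>\<^sub>\<le>\<^sub>0"
    then obtain k where "b $ i - \<alpha> = - real k" by (auto elim: nonpos_Ints_cases')
    then have "a $ j - b $ i = real k" using j by simp
    then show False using normal unfolding normal_params_def by (metis of_nat_in_Nats)
  qed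
  then show ?thesis by (simp add: Gamma_eq_zero_iff)
qed

lemma Gamma_a_nonzero: "Gamma (a $ i) \<noteq> 0"
proof -
  have "a $ i \<notin> \<int>\<^sub>\<le>\<^sub>0"
  proof
    assume "a $ i \<in> \<int>\<^sub>\<le>\<^sub>0"
    then obtain k where "a $ i = - real k" by (auto elim: nonpos_Ints_cases')
    then have "- (a $ i) = real k" by simp
    then show False using nonpole[of i] by (metis of_nat_in_Nats)
  qed
  then show ?thesis by (simp add: Gamma_eq_zero_iff)
qed

text \<open>
The Gamma factors in \<open>lead\<close> have positive arguments, so its sign is decided by the reciprocal Gamma
factors of \<open>b\<close>, which do not vanish for normal parameters, and by the Pochhammer symbol. These are the
factors of the sign that defines \<open>eta\<close>.
\<close>

lemma lead_nonzero: "lead \<noteq> 0"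
  and sgn_lead: "sgn lead = sgn (\<Prod>i\<in>UNIV. Gamma (a $ i)) * eta_sign a b K"
proof -
  have pos: "(\<Prod>i\<in>UNIV. if a $ i = \<alpha> then 1 else Gamma (a $ i - \<alpha>)) > 0"
  proof (rule prod_pos)
    fix i
    show "(if a $ i = \<alpha> then 1 else Gamma (a $ i - \<alpha>)) > 0"
      using min_comp_le[of a i] Gamma_real_pos[of "a $ i - \<alpha>"] by (cases "a $ i = \<alpha>") auto
  qed
  have r: "(\<Prod>i\<in>UNIV. rGamma (b $ i - \<alpha>)) = 1 / (\<Prod>i\<in>UNIV. Gamma (b $ i - \<alpha>))"
    by (simp add: rGamma_inverse_Gamma inverse_eq_divide prod_dividef)
  have g: "(\<Prod>i\<in>UNIV. Gamma (b $ i - \<alpha>)) \<noteq> 0" "(\<Prod>i\<in>UNIV. Gamma (a $ i)) \<noteq> 0"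
    using Gamma_diff_nonzero Gamma_a_nonzero by auto
  show "lead \<noteq> 0"
    unfolding lead_def r using pos g pochhammer_min_nonzero by (simp del: prod_zero_iff)
  have "sgn lead = sgn (1 / (\<Prod>i\<in>UNIV. Gamma (b $ i - \<alpha>))) / sgn (pochhammer \<alpha> K)"
    unfolding lead_def r using pos by (simp only: sgn_mult sgn_divide sgn_1_pos) simp
  moreover have "eta_sign a b K = sgn (1 / ((\<Prod>i\<in>UNIV. Gamma (a $ i)) * pochhammer \<alpha> K * (\<Prod>i\<in>UNIV. Gamma (b $ i - \<alpha>))))"
    unfolding eta_sign_def using nonpole by simp
  moreover have "sgn (\<Prod>i\<in>UNIV. Gamma (a $ i)) * sgn (\<Prod>i\<in>UNIV. Gamma (a $ i)) = 1"
    using g by (simp add: sgn_if)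
  ultimately show "sgn lead = sgn (\<Prod>i\<in>UNIV. Gamma (a $ i)) * eta_sign a b K"
    using g by (simp add: sgn_mult sgn_divide field_simps del: prod_zero_iff) (auto simp: sgn_if split: if_splits)
qed

text \<open>
In units of the amplitude, the residue at the rightmost left pole is \<open>lead * e\<close> with \<open>e \<ge> 1\<close>, up to an
error \<open>A / S * e\<close>, and all other residues together contribute at most \<open>M\<close> times a quotient of
Pochhammer symbols. Relative to \<open>e\<close>, both errors tend to 0 as \<open>n\<close> grows, uniformly in \<open>t\<close>; each is made at most a
quarter of the leading term.
\<close>

theorem W_positive:
  obtains N where "N \<ge> K + 1" "\<And>n t. n \<ge> N \<Longrightarrow> 0 < t \<Longrightarrow> t \<le> 1 \<Longrightarrow> sgn lead * Re (W n t) > 0"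
proof -
  obtain r where r: "mult_order = Suc r" using mult_order_pos gr0_conv_Suc by blast
  define q where "q j = shift + real j" for j
  have q: "q j > 0" for j using shift_pos by (simp add: q_def)
  obtain A where A: "A \<ge> 0" "\<And>N T S. T \<ge> 0 \<Longrightarrow> S = (\<Sum>j<N. 1 / q j) \<Longrightarrow> 0 < S \<Longrightarrow> real r \<le> S \<Longrightarrow>
     \<exists>e\<ge>1. norm (residue (\<lambda>v. regular_part v * (exp (of_real T * v) * (\<Prod>j<N. 1 / (1 - v / of_real (q j)))) / v ^ Suc r) 0
              - regular_part 0 * of_real e) \<le> A / S * e"
    by (rule dominant_residue[OF analytic_regular_part q]) (erule that)
  obtain M where M: "M \<ge> 0" "\<And>n t. n \<ge> K \<Longrightarrow> 0 < t \<Longrightarrow> t \<le> 1 \<Longrightarrow>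
     norm (W n t - residue (mellin_factor a b n t) (- of_real \<alpha>))
       \<le> M * (t powr (- c) / pochhammer (real K - c) (n - K))"
    using W_minus_main_residue by blast
  have l: "\<bar>lead\<bar> > 0" using lead_nonzero by simp
  have "\<forall>\<^sub>F N in sequentially. (\<Sum>j<N. 1 / q j) > max (real r) (4 * A / \<bar>lead\<bar>)"
    using sum_inverse_at_top[OF shift_pos] unfolding q_def filterlim_at_top_dense by blast
  moreover have "(\<lambda>N. M * (pochhammer shift N / pochhammer (shift + \<epsilon>) N)) \<longlonglongrightarrow> M * 0"
    by (intro tendsto_intros pochhammer_quotient_tendsto_0 shift_pos eps)
  then have "\<forall>\<^sub>F N in sequentially. M * (pochhammer shift N / pochhammer (shift + \<epsilon>) N) < \<bar>lead\<bar> / 4"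
    using l by (intro order_tendstoD(2)) auto
  ultimately have "\<forall>\<^sub>F N in sequentially. (\<Sum>j<N. 1 / q j) > max (real r) (4 * A / \<bar>lead\<bar>) \<and>
      M * (pochhammer shift N / pochhammer (shift + \<epsilon>) N) < \<bar>lead\<bar> / 4"
    by (rule eventually_conj)
  then obtain N0 where N0: "\<And>N. N \<ge> N0 \<Longrightarrow> (\<Sum>j<N. 1 / q j) > max (real r) (4 * A / \<bar>lead\<bar>)"
      "\<And>N. N \<ge> N0 \<Longrightarrow> M * (pochhammer shift N / pochhammer (shift + \<epsilon>) N) < \<bar>lead\<bar> / 4"
    unfolding eventually_sequentially by blast
  show ?thesis
  proof
    show "N0 + K + 1 \<ge> K + 1" by simp
    fix n t assume n: "n \<ge> N0 + K + 1" and t: "0 < (t::real)" "t \<le> 1"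
    define N where "N = n - K"
    have nK: "n \<ge> K" and N: "N \<ge> N0" using n by (auto simp: N_def)
    define S where "S = (\<Sum>j<N. 1 / q j)"
    have S: "S > real r" "S > 4 * A / \<bar>lead\<bar>" using N0(1)[OF N] by (auto simp: S_def)
    then have S0: "S > 0" by (metis of_nat_0_le_iff order_le_less_trans)
    have AS: "A / S \<le> \<bar>lead\<bar> / 4"
      using S(2) S0 l by (simp add: field_simps)
    define \<kappa> where "\<kappa> = amplitude n t"
    have \<kappa>: "\<kappa> > 0" using amplitude_pos[OF t(1)] by (simp add: \<kappa>_def)
    define X where "X = residue (\<lambda>v. regular_part v * (exp (of_real (- ln t) * v) * (\<Prod>j<N. 1 / (1 - v / of_real (q j)))) / v ^ Suc r) 0"
    have "- ln t \<ge> 0" using t by simp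
    from A(2)[OF this S_def S0] S obtain e where e: "e \<ge> 1" "norm (X - of_real (lead * e)) \<le> A / S * e"
      unfolding X_def regular_part_0 by auto
    have res: "residue (mellin_factor a b n t) (- of_real \<alpha>) = of_real \<kappa> * X"
      unfolding main_residue[OF nK t(1)] X_def \<kappa>_def r N_def q_def ..
    have "t powr (- c) / pochhammer (real K - c) N \<le> \<kappa> * (pochhammer shift N / pochhammer (shift + \<epsilon>) N)"
    proof -
      \<comment> \<open>The exponents differ by \<open>\<epsilon>\<close>: this is where \<open>t \<le> 1\<close> makes the estimate uniform.\<close>
      have "t powr (- c) \<le> t powr \<alpha>" by (rule powr_mono') (use t eps in \<open>auto simp: c_def\<close>)
      moreover have "real K - c = shift + \<epsilon>" by (simp add: c_def shift_def)
      moreover have "pochhammer (shift + \<epsilon>) N > 0" "pochhammer shift N > 0"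
        using shift_pos eps by (auto intro: pochhammer_pos)
      ultimately show ?thesis by (simp add: \<kappa>_def amplitude_def N_def[symmetric] divide_right_mono)
    qed
    then have "M * (t powr (- c) / pochhammer (real K - c) N) \<le> \<kappa> * (M * (pochhammer shift N / pochhammer (shift + \<epsilon>) N))"
      using mult_left_mono[OF _ M(1)] by (simp only: mult.left_commute)
    also have "\<dots> \<le> \<kappa> * (\<bar>lead\<bar> / 4)"
      by (rule mult_left_mono) (use N0(2)[OF N] \<kappa> in auto)
    finally have err: "norm (W n t - of_real \<kappa> * X) \<le> \<kappa> * (\<bar>lead\<bar> / 4)"
      using M(2)[OF nK t] unfolding res N_def by linarith
    have "norm (of_real \<kappa> * X - of_real (\<kappa> * (lead * e))) = \<kappa> * norm (X - of_real (lead * e))"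
      using \<kappa> by (simp add: norm_mult[symmetric] right_diff_distrib[symmetric])
         (simp add: norm_mult)
    also have "\<dots> \<le> \<kappa> * (\<bar>lead\<bar> / 4 * e)"
      using e AS \<kappa> by (intro mult_left_mono order_trans[OF e(2)] mult_right_mono) auto
    finally have "norm (W n t - of_real (\<kappa> * (lead * e))) \<le> \<kappa> * (\<bar>lead\<bar> / 4) + \<kappa> * (\<bar>lead\<bar> / 4 * e)"
      using err norm_triangle_ineq[of "W n t - of_real \<kappa> * X" "of_real \<kappa> * X - of_real (\<kappa> * (lead * e))"] by simp
    also have "\<dots> \<le> \<kappa> * (\<bar>lead\<bar> / 4 * e) + \<kappa> * (\<bar>lead\<bar> / 4 * e)"
      using e(1) \<kappa> l by (intro add_mono mult_left_mono) auto
    finally have "\<bar>Re (W n t) - \<kappa> * (lead * e)\<bar> \<le> \<kappa> * (\<bar>lead\<bar> * e) / 2"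
      using abs_Re_le_cmod[of "W n t - of_real (\<kappa> * (lead * e))"] by (simp add: mult_ac)
    then have close: "\<bar>Re (W n t) - \<kappa> * (lead * e)\<bar> \<le> \<bar>\<kappa> * (lead * e)\<bar> / 2"
      using \<kappa> e(1) by (simp add: abs_mult)
    show "sgn lead * Re (W n t) > 0"
    proof (cases "lead > 0")
      case True
      then have "\<kappa> * (lead * e) > 0" using \<kappa> e(1) by simp
      then have "Re (W n t) > 0" using close by linarith
      then show ?thesis using True by simp
    next
      case False
      then have "lead < 0" using lead_nonzero by simp
      then have "\<kappa> * (lead * e) < 0" using \<kappa> e(1) by (simp add: mult_pos_neg mult_neg_pos)
      then have "Re (W n t) < 0" using close by linarith
      then show ?thesis using \<open>lead < 0\<close> by (simp add: mult_neg_neg)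
    qed
  qed
qed

end

section \<open>The sign of the Meijer function\<close>

text \<open>
The uniqueness that the description in \<open>eta\<close> needs comes from the existence of at least one auxiliary
\<open>n\<close>.
\<close>

lemma minus_one_power_eta:
  assumes s: "\<And>n. real n + min_comp a > 0 \<Longrightarrow> eta_sign a b n = s" and "s = 1 \<or> s = -1"
  shows "(-1) ^ eta a b = s"
proof -
  obtain e :: nat where e: "e \<in> {0, 1}" "(-1) ^ e = s" using assms(2) by force
  have "eta a b = e"
    unfolding eta_def
  proof (rule the_equality)
    show "e \<in> {0, 1} \<and> (\<forall>n. 0 < real n + min_comp a \<longrightarrow> (- 1) ^ e = eta_sign a b n)"
      using e s by simp
    fix x :: nat assume x: "x \<in> {0, 1} \<and> (\<forall>n. 0 < real n + min_comp a \<longrightarrow> (- 1) ^ x = eta_sign a b n)"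
    obtain n where "- min_comp a < real n" using reals_Archimedean2 by blast
    then have n: "real n + min_comp a > 0" by simp
    then have "(-1) ^ x = eta_sign a b n" using x by blast
    then have "(-1) ^ x = (-1::real) ^ e" using e s[OF n] by simp
    then show "x = e" using x e by auto
  qed
  then show ?thesis using e by simp
qed

text \<open>
The gap to the next left pole leaves an interval for \<open>\<epsilon>\<close>, of which the condition on integer
translates excludes only countably many points.
\<close>

lemma separated_params_exist:
  fixes a b :: "real ^ 'p"
  assumes "normal_params a b" "\<And>i. - (a $ i) \<notin> \<nat>"
  obtains \<epsilon> K where "separated_params a b \<epsilon> K"
proof -
  obtain K0 where K0: "\<And>n t. n \<ge> K0 \<Longrightarrow> 0 < t \<Longrightarrow> t \<le> 1 \<Longrightarrow> decays_left (all_poles a) (mellin_factor a b n t)"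
    using decays_left_mellin_factor[of a b] by blast
  define K where "K = max K0 (nat \<lceil>max 1 (2 - min_comp a)\<rceil>)"
  have "max 1 (2 - min_comp a) \<le> real (nat \<lceil>max 1 (2 - min_comp a)\<rceil>)" by (rule real_nat_ceiling_ge)
  also have "\<dots> \<le> real K" by (simp add: K_def)
  finally have K: "real K \<ge> 2 - min_comp a" "K \<ge> 1" by auto
  have KK0: "K \<ge> K0" by (simp add: K_def)
  let ?q = "- complex_of_real (min_comp a)"
  obtain r where r: "0 < r" "r \<le> 1/2" "cball ?q r \<inter> left_poles a \<subseteq> {?q}"
    using isolated_in_real_discrete[OF real_discrete_left_poles, of "1/2" ?q a] by auto
  have gap: "Re p < - min_comp a - \<epsilon>" if p: "p \<in> left_poles a" "p \<noteq> ?q" and e: "\<epsilon> < r" for p \<epsilon>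
  proof (rule ccontr)
    assume "\<not> Re p < - min_comp a - \<epsilon>"
    moreover have "Re p \<le> - min_comp a" by (rule Re_left_pole_le[OF p(1)])
    moreover have "Im p = 0" using p(1) real_discrete_left_poles unfolding real_discrete_def by blast
    ultimately have "p \<in> cball ?q r" using e by (simp add: dist_norm cmod_eq_Re)
    then show False using r p by blast
  qed
  define Bad where "Bad = (\<lambda>(p, z). - min_comp a + real_of_int z - Re p) ` (all_poles a \<times> UNIV)"
  have "left_poles a \<subseteq> (\<lambda>(j, l). - complex_of_real (a $ j) - of_nat l) ` UNIV"
    unfolding left_poles_def by auto
  then have "countable (left_poles a)" by (rule countable_subset) auto
  then have "countable Bad" unfolding Bad_def all_poles_def by (intro countable_image countable_SIGMA countable_Un) auto
  then have "\<not> {0<..<r} \<subseteq> Bad"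
    using r(1) countable_subset uncountable_open_interval by blast
  then obtain \<epsilon> where "\<epsilon> \<in> {0<..<r}" "\<epsilon> \<notin> Bad" by blast
  then have \<epsilon>: "0 < \<epsilon>" "\<epsilon> < r" "\<epsilon> \<notin> Bad" by auto
  have "Re p \<noteq> - min_comp a - \<epsilon> + of_int z" if "p \<in> all_poles a" for p z
  proof
    assume "Re p = - min_comp a - \<epsilon> + of_int z"
    then have "\<epsilon> = (\<lambda>(p, z). - min_comp a + real_of_int z - Re p) (p, z)" by simp
    then have "\<epsilon> \<in> Bad" unfolding Bad_def by (rule image_eqI) (use that in auto)
    then show False using \<epsilon> by blast
  qed
  then have "separated_params a b \<epsilon> K"
    using assms \<epsilon> r gap K KK0 K0 by unfold_locales auto
  then show ?thesis using that by blast
qed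

context separated_params
begin

lemma eta_sign_eq: "(-1) ^ eta a b = eta_sign a b K"
proof (rule minus_one_power_eta)
  have sgn_eq: "sgn (pochhammer \<alpha> n) = sgn (pochhammer \<alpha> n')" if "real n + \<alpha> > 0" "n \<le> n'" for n n'
  proof -
    have "pochhammer (\<alpha> + real n) (n' - n) > 0" by (rule pochhammer_pos) (use that in simp)
    then show ?thesis using pochhammer_product[OF that(2), of \<alpha>] by (simp add: sgn_mult)
  qed
  have sgn_eq': "sgn (pochhammer \<alpha> n) = sgn (pochhammer \<alpha> K)" if "real n + \<alpha> > 0" for n
  proof (cases "n \<le> K")
    case True
    then show ?thesis by (rule sgn_eq[OF that])
  next
    case False
    have "real K + \<alpha> > 0" using K by simp
    from sgn_eq[OF this, of n] False show ?thesis by simp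
  qed
  show "eta_sign a b n = eta_sign a b K" if "real n + \<alpha> > 0" for n
    unfolding eta_sign_def using nonpole sgn_eq'[OF that] by (simp add: sgn_divide sgn_mult)
  have "sgn lead \<noteq> 0" using lead_nonzero by (simp add: sgn_if)
  then have "eta_sign a b K \<noteq> 0" unfolding sgn_lead by auto
  moreover have "eta_sign a b K = sgn (eta_sign a b K)" unfolding eta_sign_def using nonpole by simp
  ultimately show "eta_sign a b K = 1 \<or> eta_sign a b K = -1" by (metis sgn_if)
qed

text \<open>
At \<open>t = 1\<close> the left-hand side is a limit, and the right-hand side is continuous there from the left.
\<close>

lemma Ghat_over_Gamma_eq:
  assumes n: "n \<ge> K + 1" and t: "0 < t" "t \<le> 1"
  shows "Ghat_over_Gamma a b n t = of_real (t ^ (n - 1)) * W n t / of_real (\<Prod>i\<in>UNIV. Gamma (a $ i))"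
proof -
  let ?G = "complex_of_real (\<Prod>i\<in>UNIV. Gamma (a $ i))"
  have nK: "n \<ge> K" using n by simp
  have op: "Ghat_over_Gamma_open a b n t = of_real (t ^ (n - 1)) * W n t / ?G" if "0 < t" "t \<le> 1" for t
    unfolding Ghat_over_Gamma_open_def using nonpole Ghat_eq[OF nK that] by simp
  show ?thesis
  proof (cases "t = 1")
    case True
    have "?G \<noteq> 0" using Gamma_a_nonzero by simp
    then have "((\<lambda>t. of_real (t ^ (n - 1)) * W n t / ?G) \<longlongrightarrow> of_real (1 ^ (n - 1)) * W n 1 / ?G) (at_left 1)"
      by (intro tendsto_intros W_tendsto_1 n)
    moreover have "\<forall>\<^sub>F t in at_left (1::real). t \<in> {0<..<1}"
      by (rule eventually_at_leftI[of 0]) auto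
    then have "\<forall>\<^sub>F t in at_left 1. of_real (t ^ (n - 1)) * W n t / ?G = Ghat_over_Gamma_open a b n t"
      by eventually_elim (use op in auto)
    ultimately have "(Ghat_over_Gamma_open a b n \<longlongrightarrow> of_real (1 ^ (n - 1)) * W n 1 / ?G) (at_left 1)"
      by (rule Lim_transform_eventually)
    then have "Lim (at_left 1) (Ghat_over_Gamma_open a b n) = of_real (1 ^ (n - 1)) * W n 1 / ?G"
      by (intro tendsto_Lim) auto
    then show ?thesis unfolding Ghat_over_Gamma_def using True by simp
  qed (use op[OF t] in \<open>simp add: Ghat_over_Gamma_def\<close>)
qed

theorem positivity:
  "\<exists>N::nat. \<forall>n\<ge>N. \<forall>t::real. 0 < t \<and> t \<le> 1 \<longrightarrow>
     (- 1) ^ eta a b * Ghat_over_Gamma a b n t \<in> \<real> \<and>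
     0 < Re ((- 1) ^ eta a b * Ghat_over_Gamma a b n t)"
proof -
  obtain N where N: "N \<ge> K + 1" "\<And>n t. n \<ge> N \<Longrightarrow> 0 < t \<Longrightarrow> t \<le> 1 \<Longrightarrow> sgn lead * Re (W n t) > 0"
    using W_positive by blast
  let ?G = "\<Prod>i\<in>UNIV. Gamma (a $ i)"
  have G: "?G \<noteq> 0" using Gamma_a_nonzero by simp
  have "(- 1) ^ eta a b * Ghat_over_Gamma a b n t \<in> \<real> \<and> 0 < Re ((- 1) ^ eta a b * Ghat_over_Gamma a b n t)"
    if n: "n \<ge> N" and t: "0 < t" "t \<le> 1" for n t
  proof -
    have nK: "n \<ge> K + 1" "n \<ge> K" using n N by auto
    define x where "x = Re (W n t)"
    have W: "W n t = of_real x" using W_real[OF nK(2) t] by (simp add: x_def)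
    have "(- 1) ^ eta a b = complex_of_real ((- 1) ^ eta a b)" by simp
    then have eq: "(- 1) ^ eta a b * Ghat_over_Gamma a b n t = of_real (eta_sign a b K * (t ^ (n - 1) * x / ?G))"
      unfolding Ghat_over_Gamma_eq[OF nK(1) t] W eta_sign_eq by (simp del: of_real_prod)
    have "sgn ?G * eta_sign a b K * x > 0" using N(2)[OF n t] unfolding sgn_lead x_def .
    moreover have "t ^ (n - 1) / \<bar>?G\<bar> > 0" using t G by (simp del: prod_zero_iff)
    ultimately have "t ^ (n - 1) / \<bar>?G\<bar> * (sgn ?G * eta_sign a b K * x) > 0"
      by (intro mult_pos_pos[of "t ^ (n - 1) / \<bar>?G\<bar>"])
    also have "t ^ (n - 1) / \<bar>?G\<bar> * (sgn ?G * eta_sign a b K * x) = eta_sign a b K * (t ^ (n - 1) * x / ?G)"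
      using G by (simp add: sgn_if abs_if del: prod_zero_iff)
    finally show ?thesis unfolding eq by (simp del: of_real_mult of_real_divide of_real_prod)
  qed
  then show ?thesis by blast
qed

end

definition degenerate_term :: "real ^ 'p \<Rightarrow> real ^ 'p \<Rightarrow> nat \<Rightarrow> real" where
  "degenerate_term a b j = (\<Prod>i\<in>UNIV. pochhammer (a $ i) j) * (\<Prod>i\<in>UNIV. rGamma (b $ i + real j)) / fact j"

lemma pochhammer_one_minus: "pochhammer (1 - real n) j = (-1) ^ j * (\<Prod>l<j. real n - 1 - real l)"
proof -
  have "pochhammer (1 - real n) j = (\<Prod>l<j. - 1 * (real n - 1 - real l))"
    unfolding pochhammer_prod_lessThan by (rule prod.cong) auto
  then show ?thesis by (simp only: prod.distrib prod_constant card_lessThan)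
qed

text \<open>
One of the factors from index \<open>j\<close> on is at least \<open>n - m\<close>, the others are at least 1.
\<close>

lemma descending_product_le:
  assumes "j < m" "m < n"
  shows "(real n - real m) * (\<Prod>l<j. real n - 1 - real l) \<le> (\<Prod>l<m. real n - 1 - real l)"
proof -
  define f where "f l = real n - 1 - real l" for l
  have nn: "(\<Prod>l<j. f l) \<ge> 0" "f j \<ge> real n - real m" "(\<Prod>l\<in>{Suc j..<m}. f l) \<ge> 1"
    using assms by (auto simp: f_def intro!: prod_nonneg prod_ge_1)
  have "(\<Prod>l<m. f l) = (\<Prod>l<j. f l) * (f j * (\<Prod>l\<in>{Suc j..<m}. f l))"
    using prod.atLeastLessThan_concat[of 0 j m f] prod.atLeast_Suc_lessThan[of j m f] assms
    by (simp add: atLeast0LessThan)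
  moreover have "real n - real m \<le> f j * (\<Prod>l\<in>{Suc j..<m}. f l)"
    using mult_mono[OF nn(2,3)] nn assms by (simp add: f_def)
  ultimately show ?thesis
    using mult_left_mono[OF _ nn(1)] unfolding f_def by (metis mult.commute)
qed

text \<open>
As \<open>n\<close> grows, \<open>pochhammer (1 - n) j\<close> is of order \<open>n ^ j\<close> with sign \<open>(-1) ^ j\<close>, and
\<open>inverse t ^ j\<close> increases with \<open>j\<close> for \<open>t \<le> 1\<close>. So the last nonvanishing term dominates the others
by a factor of order \<open>n\<close>, uniformly in \<open>t\<close>.
\<close>

lemma degenerate_sum_sign:
  assumes C: "C m \<noteq> 0" and C0: "\<And>j. j > m \<Longrightarrow> C j = 0"
  shows "\<exists>N. \<forall>n\<ge>N. \<forall>t::real. 0 < t \<and> t \<le> 1 \<longrightarrow>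
     sgn ((-1) ^ m * C m) * (\<Sum>j<n. pochhammer (1 - real n) j * C j * inverse t ^ j) > (0::real)"
proof -
  define S where "S = (\<Sum>j<m. \<bar>C j\<bar>)"
  define N where "N = Suc m + nat \<lceil>S / \<bar>C m\<bar>\<rceil>"
  have "sgn ((-1) ^ m * C m) * (\<Sum>j<n. pochhammer (1 - real n) j * C j * inverse t ^ j) > 0"
    if n: "n \<ge> N" and t: "0 < t" "t \<le> 1" for n t
  proof -
    define p where "p j = (\<Prod>l<j. real n - 1 - real l)" for j
    define x where "x = inverse t"
    have x: "x \<ge> 1" using t by (simp add: x_def one_le_inverse_iff)
    have nm: "n > m" using n by (simp add: N_def)
    have "S / \<bar>C m\<bar> < real n - real m" using n real_nat_ceiling_ge[of "S / \<bar>C m\<bar>"] by (simp add: N_def)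
    then have big: "S < (real n - real m) * \<bar>C m\<bar>" using C by (simp add: field_simps)
    have pm: "p m > 0" unfolding p_def by (rule prod_pos) (use nm in auto)
    define D where "D = real n - real m"
    have D: "D > 0" using nm by (simp add: D_def)
    have summand: "pochhammer (1 - real n) j = (-1) ^ j * p j" for j
      unfolding p_def by (rule pochhammer_one_minus)
    have "(\<Sum>j<n. pochhammer (1 - real n) j * C j * x ^ j) = (\<Sum>j<Suc m. pochhammer (1 - real n) j * C j * x ^ j)"
      by (rule sum.mono_neutral_right) (use nm C0 in auto)
    then have split: "(\<Sum>j<n. pochhammer (1 - real n) j * C j * x ^ j) =
        (\<Sum>j<m. (-1) ^ j * p j * C j * x ^ j) + (-1) ^ m * C m * (p m * x ^ m)"
      by (simp add: summand)
    have "\<bar>\<Sum>j<m. (-1) ^ j * p j * C j * x ^ j\<bar> \<le> (\<Sum>j<m. \<bar>C j\<bar> * (p m / D * x ^ m))"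
    proof (rule order_trans[OF sum_abs], rule sum_mono)
      fix j assume j: "j \<in> {..<m}"
      have pj: "p j \<ge> 0" unfolding p_def by (rule prod_nonneg) (use nm j in auto)
      have "p j \<le> p m / D"
        using descending_product_le[of j m n] j nm D unfolding p_def D_def by (simp add: field_simps)
      moreover have "x ^ j \<le> x ^ m" by (rule power_increasing) (use x j in auto)
      ultimately have "p j * x ^ j \<le> p m / D * x ^ m"
        by (intro mult_mono) (use pm D x in auto)
      then have "\<bar>C j\<bar> * (p j * x ^ j) \<le> \<bar>C j\<bar> * (p m / D * x ^ m)" by (rule mult_left_mono) simp
      then show "\<bar>(-1) ^ j * p j * C j * x ^ j\<bar> \<le> \<bar>C j\<bar> * (p m / D * x ^ m)"
        using pj x by (simp add: abs_mult power_abs mult_ac)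
    qed
    also have "\<dots> = S / D * (p m * x ^ m)" unfolding S_def sum_distrib_right[symmetric] by simp
    also have "\<dots> < \<bar>C m\<bar> * (p m * x ^ m)"
    proof (rule mult_strict_right_mono)
      show "S / D < \<bar>C m\<bar>" using big D by (simp add: D_def[symmetric] field_simps)
    qed (use pm x in simp)
    also have "\<dots> = \<bar>(-1) ^ m * C m * (p m * x ^ m)\<bar>" using pm x by (simp add: abs_mult)
    finally have lt: "\<bar>\<Sum>j<m. (-1) ^ j * p j * C j * x ^ j\<bar> < \<bar>(-1) ^ m * C m * (p m * x ^ m)\<bar>" .
    have sgn: "sgn ((-1) ^ m * C m * (p m * x ^ m)) = sgn ((-1) ^ m * C m)" using pm x by (simp add: sgn_mult)
    have "sgn B * (A + B) > 0" if "\<bar>A\<bar> < \<bar>B\<bar>" for A B :: real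
      using that by (auto simp: sgn_if abs_if split: if_splits)
    from this[OF lt] show ?thesis unfolding sgn split x_def[symmetric] .
  qed
  then show ?thesis by blast
qed

text \<open>
Let \<open>- m\<close> be the largest non-positive integer component of \<open>a\<close>. The products of Pochhammer symbols vanish
beyond index \<open>m\<close>, so \<open>m\<close> is the index of the last term of the sum. That term is nonzero because the
parameters are normal, and \<open>eta\<close> is defined by its sign.
\<close>

lemma degenerate_positivity:
  fixes a b :: "real ^ 'p"
  assumes normal: "normal_params a b" and ex: "\<exists>i. - (a $ i) \<in> \<nat>"
  shows "\<exists>N::nat. \<forall>n\<ge>N. \<forall>t::real. 0 < t \<and> t \<le> 1 \<longrightarrow>
           (- 1) ^ eta a b * Ghat_over_Gamma a b n t \<in> \<real> \<and>
           0 < Re ((- 1) ^ eta a b * Ghat_over_Gamma a b n t)"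
proof -
  define Z where "Z = {k. \<exists>i. a $ i = - real k}"
  have "Z \<subseteq> (\<lambda>i. nat \<lfloor>- (a $ i)\<rfloor>) ` UNIV"
  proof
    fix k assume "k \<in> Z"
    then obtain i where "a $ i = - real k" unfolding Z_def by blast
    then have "k = nat \<lfloor>- (a $ i)\<rfloor>" by simp
    then show "k \<in> (\<lambda>i. nat \<lfloor>- (a $ i)\<rfloor>) ` UNIV" by blast
  qed
  then have finZ: "finite Z" by (rule finite_subset) simp
  obtain i where "- (a $ i) \<in> \<nat>" using ex by blast
  then obtain k where "- (a $ i) = real k" by (auto elim: Nats_cases)
  then have "a $ i = - real k" by simp
  then have Zne: "Z \<noteq> {}" unfolding Z_def by blast
  define m where "m = Min Z"
  have mZ: "m \<in> Z" unfolding m_def using finZ Zne by (rule Min_in)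
  then obtain i0 where i0: "a $ i0 = - real m" unfolding Z_def by blast
  define C where "C = degenerate_term a b"
  have poch: "pochhammer (a $ i) m \<noteq> 0" for i
  proof
    assume "pochhammer (a $ i) m = 0"
    then obtain k where k: "k < m" "a $ i = - real k" unfolding pochhammer_eq_0_iff by blast
    then have "m \<le> k" unfolding m_def using finZ by (intro Min_le) (auto simp: Z_def)
    then show False using k by simp
  qed
  have rg: "rGamma (b $ i + real m) \<noteq> 0" for i
  proof
    assume "rGamma (b $ i + real m) = 0"
    then have "b $ i + real m \<in> \<int>\<^sub>\<le>\<^sub>0" by (simp add: rGamma_eq_zero_iff)
    then obtain k where "b $ i + real m = - real k" by (auto elim: nonpos_Ints_cases')
    then have "a $ i0 - b $ i = real k" using i0 by simp
    then show False using normal unfolding normal_params_def by (metis of_nat_in_Nats)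
  qed
  have Cm: "C m \<noteq> 0" unfolding C_def degenerate_term_def using poch rg by simp
  have C0: "C j = 0" if "j > m" for j
  proof -
    have "pochhammer (a $ i0) j = 0" unfolding pochhammer_eq_0_iff using i0 that by blast
    then show ?thesis unfolding C_def degenerate_term_def by auto
  qed
  define s where "s = sgn ((-1) ^ m * C m)"
  have eta: "(-1) ^ eta a b = s"
  proof (rule minus_one_power_eta)
    show "s = 1 \<or> s = -1" unfolding s_def using Cm by (simp add: sgn_if)
    fix n assume "real n + min_comp a > 0"
    then have "m < n" using min_comp_le[of a i0] i0 by simp
    then have "min (n - 1) m = m" by simp
    then have "Min (insert (n - 1) Z) = m" using finZ Zne by (simp add: m_def)
    then show "eta_sign a b n = s"
      unfolding eta_sign_def s_def C_def degenerate_term_def Let_def using ex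
      by (auto simp: Z_def[symmetric] sgn_mult sgn_divide)
  qed
  obtain N where N: "\<And>n t. n \<ge> N \<Longrightarrow> 0 < t \<Longrightarrow> t \<le> 1 \<Longrightarrow>
     s * (\<Sum>j<n. pochhammer (1 - real n) j * C j * inverse t ^ j) > 0"
    using degenerate_sum_sign[of C m, OF Cm C0] unfolding s_def by blast
  define R where "R n t = t ^ (n - 1) / fact (n - 1) * (\<Sum>j<n. pochhammer (1 - real n) j * C j * inverse t ^ j)" for n and t :: real
  have op: "Ghat_over_Gamma_open a b n = (\<lambda>t. of_real (R n t))" for n
    unfolding Ghat_over_Gamma_open_def R_def C_def degenerate_term_def using ex
    by (auto simp: fun_eq_iff mult.assoc)
  have Gh: "Ghat_over_Gamma a b n t = of_real (R n t)" for n t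
  proof (cases "t = 1")
    case True
    have "((\<lambda>t. complex_of_real (R n t)) \<longlongrightarrow> of_real (R n 1)) (at_left 1)"
      unfolding R_def by (intro tendsto_intros) auto
    then have "Lim (at_left 1) (Ghat_over_Gamma_open a b n) = of_real (R n 1)"
      unfolding op by (intro tendsto_Lim) auto
    then show ?thesis unfolding Ghat_over_Gamma_def using True by simp
  qed (simp add: Ghat_over_Gamma_def op)
  have "(- 1) ^ eta a b * Ghat_over_Gamma a b n t \<in> \<real> \<and> 0 < Re ((- 1) ^ eta a b * Ghat_over_Gamma a b n t)"
    if n: "n \<ge> N" and t: "0 < t" "t \<le> 1" for n t
  proof -
    have "(- 1) ^ eta a b = complex_of_real ((- 1) ^ eta a b)" by simp
    then have eq: "(- 1) ^ eta a b * Ghat_over_Gamma a b n t = of_real (s * R n t)"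
      unfolding Gh eta by simp
    have "t ^ (n - 1) / fact (n - 1) * (s * (\<Sum>j<n. pochhammer (1 - real n) j * C j * inverse t ^ j)) > 0"
      by (rule mult_pos_pos[OF _ N[OF n t]]) (use t in simp)
    then have "s * R n t > 0" unfolding R_def by (simp only: mult.left_commute)
    then show ?thesis unfolding eq by (simp del: of_real_mult)
  qed
  then show ?thesis by blast
qed

theorem proposition8:
  fixes a b :: "real ^ 'p"
  assumes "normal_params a b"
  shows "\<exists>N::nat. \<forall>n\<ge>N. \<forall>t::real. 0 < t \<and> t \<le> 1 \<longrightarrow>
           (- 1) ^ eta a b * Ghat_over_Gamma a b n t \<in> \<real> \<and>
           0 < Re ((- 1) ^ eta a b * Ghat_over_Gamma a b n t)"
proof (cases "\<forall>i. - (a $ i) \<notin> \<nat>")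
  case True
  then obtain \<epsilon> K where "separated_params a b \<epsilon> K"
    using separated_params_exist[OF assms] by blast
  then show ?thesis by (rule separated_params.positivity)
next
  case False
  then show ?thesis using degenerate_positivity[OF assms] by blast
qed

end
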